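(* Let $m,N\in\mathbb{N}$ with $N+1\ge m$, let $a<b$ be real and $h=\frac{b-a}{N}$. Then the coefficients of the optimal quadrature formula in the sense of Sard of the form $$\int_a^b\varphi(x)\,dx\cong\sum_{\beta=0}^NC_{\beta,0}[a,b]\,\varphi(h\beta+a)$$ in the space $L_2^{(m)}[a,b]$ have the form $$\mathring{C}_{0,0}[a,b]=h\left(\frac12-\sum_{k=1}^{m-1}d_k\frac{q_k-q_k^N}{1-q_k}\right),$$ $$\mathring{C}_{\beta,0}[a,b]=h\left(1+\sum_{k=1}^{m-1}d_k\left(q_k^{\beta}+q_k^{N-\beta}\right)\right),\quad\beta=1,2,\dots,N-1,$$ $$\mathring{C}_{N,0}[a,b]=h\left(\frac12-\sum_{k=1}^{m-1}d_k\frac{q_k-q_k^N}{1-q_k}\right),$$ where $d_1,\dots,d_{m-1}$ satisfy the system $$\sum_{k=1}^{m-1}d_k\sum_{t=1}^j\frac{q_k+(-1)^{t+1}q_k^{N+t}}{(q_k-1)^{t+1}}\Delta^t0^j=\frac{B_{j+1}}{j+1},\quad j=1,2,\dots,m-1.$$ Here $B_{j+1}$ is the Bernoulli number, $q_1,\dots,q_{m-1}$ are the roots of the Euler-Frobenius polynomial $E_{2m-2}(x)$ of degree $2m-2$ with $|q_k|<1$, and $\Delta^t0^j=\sum_{l=1}^t(-1)^{t-l}\binom{t}{l}l^j$.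
   Context: $L_2^{(m)}[a,b]$ is the Sobolev space of complex-valued functions on $[a,b]$ having an absolutely continuous $(m-1)$-th derivative on $[a,b]$ and square integrable $m$-th derivative, with inner product $\langle\varphi,\psi\rangle=\int_a^b\varphi^{(m)}(x)\overline{\psi^{(m)}(x)}\,dx$ and (semi)norm $\|\varphi\|_{L_2^{(m)}[a,b]}=\langle\varphi,\varphi\rangle^{1/2}$. For nodes $x_\beta=h\beta+a$, the error functional of a quadrature formula $\int_a^b\varphi(x)\,dx\cong\sum_{\beta=0}^NC_\beta\varphi(x_\beta)$ (with $C_\beta\in\mathbb{C}$) is $(\ell,\varphi)=\int_a^b\varphi(x)\,dx-\sum_{\beta=0}^NC_\beta\varphi(x_\beta)$. It is required that $(\ell,x^\alpha)=0$ for $\alpha=0,1,\dots,m-1$, so that $\ell$ is a bounded functional with norm $\|\ell\|_{L_2^{(m)*}[a,b]}=\sup\{|(\ell,\varphi)|:\|\varphi\|_{L_2^{(m)}[a,b]}\le1\}$. The formula is optimal in the sense of Sard, with optimal coefficients denoted $\mathring{C}$, if these coefficients minimize $\|\ell\|_{L_2^{(m)*}[a,b]}$ over all coefficient vectors $(C_0,\dots,C_N)$ satisfying these conditions, the nodes being fixed. The Euler-Frobenius polynomials are $E_k(x)=\frac{(1-x)^{k+2}}{x}\left(x\frac{d}{dx}\right)^k\frac{x}{(1-x)^2}$, $k=0,1,2,\dots$; $E_k$ has degree $k$, its roots are real, negative and distinct, and $E_{2m-2}$ has exactly $m-1$ roots with absolute value less than $1$. Empty sums are zero. *)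

theory Defs
  imports "HOL-Analysis.Analysis" "HOL-Computational_Algebra.Formal_Power_Series"
begin

definition absolutely_continuous_on :: "real set \<Rightarrow> (real \<Rightarrow> complex) \<Rightarrow> bool" where
  "absolutely_continuous_on S f \<longleftrightarrow>
     (\<forall>\<epsilon>>0. \<exists>\<delta>>0. \<forall>(n::nat) u v.
        (\<forall>i<n. u i \<le> v i \<and> {u i..v i} \<subseteq> S) \<and>
        disjoint_family_on (\<lambda>i. {u i<..<v i}) {..<n} \<and>
        (\<Sum>i<n. v i - u i) < \<delta> \<longrightarrow>
        (\<Sum>i<n. cmod (f (v i) - f (u i))) < \<epsilon>)"

(* Derivatives are taken within [a,b], hence one-sided at the end points.  At points where the
   derivative does not exist the value is arbitrary; for the m-th derivative of a function in
   the space defined below these points form a null set. *)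
definition deriv_within_Icc :: "real \<Rightarrow> real \<Rightarrow> nat \<Rightarrow> (real \<Rightarrow> complex) \<Rightarrow> real \<Rightarrow> complex" where
  "deriv_within_Icc a b k =
     ((\<lambda>f x. vector_derivative f (at x within {a..b})) ^^ k)"

(* Intended for m \<ge> 1.  Only the values on [a,b] are relevant. *)
definition sobolev_space :: "nat \<Rightarrow> real \<Rightarrow> real \<Rightarrow> (real \<Rightarrow> complex) set" where
  "sobolev_space m a b =
     {\<phi>. (\<forall>k<m - 1. deriv_within_Icc a b k \<phi> differentiable_on {a..b}) \<and>
         absolutely_continuous_on {a..b} (deriv_within_Icc a b (m - 1) \<phi>) \<and>
         deriv_within_Icc a b m \<phi> \<in> borel_measurable (lebesgue_on {a..b}) \<and>
         integrable (lebesgue_on {a..b}) (\<lambda>x. (cmod (deriv_within_Icc a b m \<phi> x))\<^sup>2)}"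

definition sobolev_inner ::
  "nat \<Rightarrow> real \<Rightarrow> real \<Rightarrow> (real \<Rightarrow> complex) \<Rightarrow> (real \<Rightarrow> complex) \<Rightarrow> complex" where
  "sobolev_inner m a b \<phi> \<psi> =
     (LINT x|lebesgue_on {a..b}. deriv_within_Icc a b m \<phi> x * cnj (deriv_within_Icc a b m \<psi> x))"

definition sobolev_norm :: "nat \<Rightarrow> real \<Rightarrow> real \<Rightarrow> (real \<Rightarrow> complex) \<Rightarrow> real" where
  "sobolev_norm m a b \<phi> = sqrt (Re (sobolev_inner m a b \<phi> \<phi>))"

definition error_functional ::
  "nat \<Rightarrow> real \<Rightarrow> real \<Rightarrow> (nat \<Rightarrow> complex) \<Rightarrow> (real \<Rightarrow> complex) \<Rightarrow> complex" where
  "error_functional N a b C \<phi> =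
     (LINT x|lebesgue_on {a..b}. \<phi> x) - (\<Sum>\<beta>=0..N. C \<beta> * \<phi> ((b - a) / real N * real \<beta> + a))"

definition exact_on_monomials :: "nat \<Rightarrow> nat \<Rightarrow> real \<Rightarrow> real \<Rightarrow> (nat \<Rightarrow> complex) \<Rightarrow> bool" where
  "exact_on_monomials m N a b C \<longleftrightarrow>
     (\<forall>\<alpha><m. error_functional N a b C (\<lambda>x. complex_of_real x ^ \<alpha>) = 0)"

(* The supremum is taken in the extended reals, so that it is also meaningful for
   functionals that are not bounded. *)
definition error_norm :: "nat \<Rightarrow> nat \<Rightarrow> real \<Rightarrow> real \<Rightarrow> (nat \<Rightarrow> complex) \<Rightarrow> ereal" where
  "error_norm m N a b C =
     (SUP \<phi> \<in> {\<phi> \<in> sobolev_space m a b. sobolev_norm m a b \<phi> \<le> 1}.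
        ereal (cmod (error_functional N a b C \<phi>)))"

definition sard_optimal :: "nat \<Rightarrow> nat \<Rightarrow> real \<Rightarrow> real \<Rightarrow> (nat \<Rightarrow> complex) \<Rightarrow> bool" where
  "sard_optimal m N a b C \<longleftrightarrow>
     exact_on_monomials m N a b C \<and>
     (\<forall>C'. exact_on_monomials m N a b C' \<longrightarrow> error_norm m N a b C \<le> error_norm m N a b C')"

(* The defining expression makes sense only for x \<noteq> 0, 1; it agrees there with a unique
   polynomial, see poly_euler_frobenius below. *)
definition euler_frobenius :: "nat \<Rightarrow> real poly" where
  "euler_frobenius k =
     (THE p. \<forall>x. x \<noteq> 0 \<longrightarrow> x \<noteq> 1 \<longrightarrow>
        poly p x = (1 - x) ^ (k + 2) / x *
          ((\<lambda>f x. x * deriv f x) ^^ k) (\<lambda>x. x / (1 - x)\<^sup>2) x)"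

(* B_n, from the generating function t / (e^t - 1); here B_1 = -1/2. *)
definition bernoulli_number :: "nat \<Rightarrow> real" where
  "bernoulli_number n = fact n * fps_nth (fps_X / (fps_exp 1 - 1)) n"

(* \<Delta>^t 0^j *)
definition diff_zero_power :: "nat \<Rightarrow> nat \<Rightarrow> real" where
  "diff_zero_power t j = (\<Sum>l=1..t. (-1) ^ (t - l) * real (t choose l) * real l ^ j)"

definition coefficient_system :: "nat \<Rightarrow> nat \<Rightarrow> (nat \<Rightarrow> real) \<Rightarrow> (nat \<Rightarrow> real) \<Rightarrow> bool" where
  "coefficient_system m N q d \<longleftrightarrow>
     (\<forall>j\<in>{1..m - 1}.
        (\<Sum>k=1..m - 1. d k *
           (\<Sum>t=1..j. (q k + (-1) ^ (t + 1) * q k ^ (N + t)) / (q k - 1) ^ (t + 1)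
                        * diff_zero_power t j))
        = bernoulli_number (j + 1) / real (j + 1))"

lemma euler_frobenius_exists:
  "\<exists>p :: real poly. \<forall>x. x \<noteq> 1 \<longrightarrow>
     ((\<lambda>f x. x * deriv f x) ^^ k) (\<lambda>x. x / (1 - x)\<^sup>2) x = x * poly p x / (1 - x) ^ (k + 2)"
proof (induction k)
  case 0
  show ?case by (rule exI[of _ 1]) (simp add: power2_eq_square)
next
  case (Suc k)
  let ?g = "((\<lambda>f x. x * deriv f x) ^^ k) (\<lambda>x::real. x / (1 - x)\<^sup>2)"
  from Suc obtain p :: "real poly" where
    p: "\<And>x. x \<noteq> 1 \<Longrightarrow> ?g x = x * poly p x / (1 - x) ^ (k + 2)"
    by blast
  let ?r = "([:1, real k + 1:] * p + [:0, 1, -1:] * pderiv p)"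
  have "x * deriv ?g x = x * poly ?r x / (1 - x) ^ (Suc k + 2)" if x: "x \<noteq> 1" for x
  proof -
    have "((\<lambda>x. x * poly p x / (1 - x) ^ (k + 2)) has_field_derivative
            poly ?r x / (1 - x) ^ (k + 3)) (at x)"
    proof -
      define u where "u = 1 - x"
      define w where "w = u ^ (k + 1)"
      let ?a = "poly p x" and ?b = "poly (pderiv p) x"
      have u: "u \<noteq> 0" and w: "w \<noteq> 0" using x by (auto simp: u_def w_def)
      have D1: "((\<lambda>x. x * poly p x) has_field_derivative ?a + x * ?b) (at x)"
        using DERIV_mult[OF DERIV_ident poly_DERIV[of p x]] by (simp add: mult.commute)
      have "((\<lambda>x. 1 - x) has_field_derivative - 1) (at x)"
        using DERIV_diff[OF DERIV_const[of 1] DERIV_ident] by simp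
      from DERIV_power[OF this, of "k + 2"]
      have D2: "((\<lambda>x. (1 - x) ^ (k + 2)) has_field_derivative - (real (k + 2) * w)) (at x)"
        by (simp add: w_def u_def)
      have "(1 - x) ^ (k + 2) \<noteq> 0" using x by simp
      from DERIV_divide[OF D1 D2 this]
      have "((\<lambda>x. x * poly p x / (1 - x) ^ (k + 2)) has_field_derivative
          ((?a + x * ?b) * (u * w) + x * ?a * (real (k + 2) * w)) / ((u * w) * (u * w))) (at x)"
        by (simp add: u_def w_def)
      moreover have "((?a + x * ?b) * (u * w) + x * ?a * (real (k + 2) * w)) / ((u * w) * (u * w))
          = (w * ((?a + x * ?b) * u + x * ?a * real (k + 2))) / (w * (u * u * w))"
        by (simp add: algebra_simps)
      moreover have "\<dots> = ((?a + x * ?b) * u + x * ?a * real (k + 2)) / (u * u * w)"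
        using w by (rule mult_divide_mult_cancel_left)
      moreover have "(?a + x * ?b) * u + x * ?a * real (k + 2) = poly ?r x"
        by (simp add: u_def algebra_simps)
      moreover have "u * u * w = (1 - x) ^ (k + 3)"
        by (simp add: u_def w_def eval_nat_numeral)
      ultimately show ?thesis by simp
    qed
    then have "(?g has_field_derivative poly ?r x / (1 - x) ^ (k + 3)) (at x)"
      by (rule has_field_derivative_transform_within_open[where S = "- {1}"]) (use x p in auto)
    then have "deriv ?g x = poly ?r x / (1 - x) ^ (k + 3)"
      by (rule DERIV_imp_deriv)
    then show ?thesis by (simp add: numeral_3_eq_3)
  qed
  then have "\<forall>x. x \<noteq> 1 \<longrightarrow> ((\<lambda>f x. x * deriv f x) ^^ Suc k) (\<lambda>x. x / (1 - x)\<^sup>2) x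
      = x * poly ?r x / (1 - x) ^ (Suc k + 2)"
    by simp
  then show ?case by (rule exI)
qed

lemma poly_euler_frobenius:
  assumes "x \<noteq> 0" "x \<noteq> 1"
  shows "poly (euler_frobenius k) x = (1 - x) ^ (k + 2) / x *
           ((\<lambda>f x. x * deriv f x) ^^ k) (\<lambda>x. x / (1 - x)\<^sup>2) x"
proof -
  let ?P = "\<lambda>p :: real poly. \<forall>x. x \<noteq> 0 \<longrightarrow> x \<noteq> 1 \<longrightarrow>
        poly p x = (1 - x) ^ (k + 2) / x *
          ((\<lambda>f x. x * deriv f x) ^^ k) (\<lambda>x. x / (1 - x)\<^sup>2) x"
  obtain p :: "real poly" where p: "\<And>x. x \<noteq> 1 \<Longrightarrow>
     ((\<lambda>f x. x * deriv f x) ^^ k) (\<lambda>x. x / (1 - x)\<^sup>2) x = x * poly p x / (1 - x) ^ (k + 2)"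
    using euler_frobenius_exists[of k] by blast
  have "?P p" by (auto simp: p)
  moreover have "r = p" if "?P r" for r
  proof (rule ccontr)
    assume "r \<noteq> p"
    then have "finite {x. poly (r - p) x = 0}"
      by (intro poly_roots_finite) simp
    moreover have "- {0, 1} \<subseteq> {x. poly (r - p) x = 0}"
      using that \<open>?P p\<close> by auto
    ultimately have "finite (- {0, 1 :: real})"
      by (rule rev_finite_subset)
    then have "finite (UNIV :: real set)"
      using finite_compl[of "{0, 1 :: real}"] by simp
    then show False using infinite_UNIV_char_0 by blast
  qed
  ultimately have "?P (THE p. ?P p)" by (rule theI)
  with assms show ?thesis unfolding euler_frobenius_def by blast
qed

lemma bernoulli_number_generating_function:
  "Abs_fps (\<lambda>n. bernoulli_number n / fact n) * (fps_exp 1 - 1) = fps_X"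
proof -
  have "subdegree (fps_exp (1::real) - 1) = 1"
    by (rule subdegreeI) auto
  moreover have "Abs_fps (\<lambda>n. bernoulli_number n / fact n) = fps_X / (fps_exp 1 - 1)"
    by (simp add: bernoulli_number_def fps_eq_iff)
  ultimately show ?thesis
    by (simp add: fps_dvd_iff)
qed

end

theory Submission
  imports Defs
begin

text \<open>
  Let u be a spline of smoothness C^(2m-2) on the grid whose 2m-th derivative is 1 on every cell and
  whose derivatives of orders m, ..., 2m-2 vanish at both ends. Integration by parts on every cell
  turns the pairing of u^(m) with \<phi>^(m) into plus or minus an error functional (l, \<phi>) whose coefficients are
  the jumps of u^(2m-1). If u moreover vanishes at the nodes, then every competing functional takes the
  same value on u as l, namely the integral of u. So u is extremal for l and, by Cauchy-Schwarz,
  l is optimal; perturbing u by polynomials gives uniqueness.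

  Such a u is the periodic Bernoulli monospline plus a combination of null splines s with
  s(x + 1) = q s(x) that vanish at the integers; these exist exactly for the roots q of the
  Euler-Frobenius polynomial. On one cell, the derivatives at the two end points are the coefficients
  of a power series G(z) and of G(z) e^z, where z / (e^z - 1) accounts for the Bernoulli part and
  1 / (e^z - q) for the null splines. The boundary conditions become the linear system for the d_k.
  A solution of the homogeneous system gives a natural spline with zero data, which vanishes; hence the
  system is solvable. That the Sobolev space is defined by absolute continuity requires the
  fundamental theorem of calculus for absolutely continuous functions.
\<close>

section \<open>Absolutely continuous functions\<close>

text \<open>General Sobolev functions enter only through the upper bound for the norm of the optimal
  functional; lower bounds and uniqueness are tested on splines. The link between roots and null
  splines: for q different from 0 and 1, E_(2m-2)(q) is a nonzero multiple of the coefficient of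
  z^(2m-1) in 1/(e^z - 1/q), and substituting -z for z exchanges q and 1/q. So each root of modulus
  below 1 yields two null splines, one decaying from either end. Giving both the same coefficient
  d_k makes the spline symmetric about the midpoint; the m-1 boundary conditions at the left end
  then imply those at the right end, which leaves a square system for d_1, ..., d_(m-1). The
  condition N + 1 >= m enters where a polynomial of degree below m that vanishes at all N + 1 nodes
  has to be zero. To treat the inhomogeneous and the homogeneous system at once, the splines carry a
  parameter c, the value of the 2m-th derivative: c = 1 is the optimal spline, c = 0 the homogeneous
  case.\<close>

abbreviation short_intervals :: "real set \<Rightarrow> nat \<Rightarrow> (nat \<Rightarrow> real) \<Rightarrow> (nat \<Rightarrow> real) \<Rightarrow> real \<Rightarrow> bool" where
  "short_intervals S n u v \<delta> \<equiv> (\<forall>i<n. u i \<le> v i \<and> {u i..v i} \<subseteq> S) \<and>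
     disjoint_family_on (\<lambda>i. {u i<..<v i}) {..<n} \<and> (\<Sum>i<n. v i - u i) < \<delta>"

abbreviation short_interval_family :: "real set \<Rightarrow> 'i set \<Rightarrow> ('i \<Rightarrow> real) \<Rightarrow> ('i \<Rightarrow> real) \<Rightarrow> real \<Rightarrow> bool" where
  "short_interval_family S I u v \<delta> \<equiv> finite I \<and> (\<forall>i\<in>I. u i \<le> v i \<and> {u i..v i} \<subseteq> S) \<and>
     disjoint_family_on (\<lambda>i. {u i<..<v i}) I \<and> (\<Sum>i\<in>I. v i - u i) < \<delta>"

lemma absolutely_continuous_onE:
  assumes "absolutely_continuous_on S f" and "\<epsilon> > 0"
  obtains \<delta> where "\<delta> > 0"
    "\<forall>(n::nat) u v. short_intervals S n u v \<delta> \<longrightarrow>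
       (\<Sum>i<n. cmod (f (v i) - f (u i))) < \<epsilon>"
proof -
  from assms(1)[unfolded absolutely_continuous_on_def, rule_format, OF assms(2)]
  show ?thesis using that by (elim exE conjE)
qed

text \<open>Enumerating \<open>I\<close> reduces this to the index sets \<open>{..<n}\<close> of the
  definition. It serves families indexed by pairs, by sets of reals and by the one-point
  type.\<close>

lemma absolutely_continuous_on_finite_family:
  assumes "absolutely_continuous_on S f" and "\<epsilon> > 0"
  obtains \<delta> where "\<delta> > 0"
    "\<forall>(I :: 'i set) u v. short_interval_family S I u v \<delta> \<longrightarrow>
       (\<Sum>i\<in>I. cmod (f (v i) - f (u i))) < \<epsilon>"
proof -
  obtain \<delta> where \<delta>: "\<delta> > 0" and H: "\<forall>(n::nat) u v. short_intervals S n u v \<delta> \<longrightarrow> (\<Sum>i<n. cmod (f (v i) - f (u i))) < \<epsilon>"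
    by (rule absolutely_continuous_onE[OF assms])
  have "(\<Sum>i\<in>I. cmod (f (v i) - f (u i))) < \<epsilon>"
    if I: "finite I" and uv: "\<And>i. i \<in> I \<Longrightarrow> u i \<le> v i \<and> {u i..v i} \<subseteq> S"
      and dis: "disjoint_family_on (\<lambda>i. {u i<..<v i}) I" and len: "(\<Sum>i\<in>I. v i - u i) < \<delta>"
    for I :: "'i set" and u v
  proof -
    obtain g where g: "bij_betw g {..<card I} I"
      using ex_bij_betw_nat_finite[OF I] by (auto simp: atLeast0LessThan)
    have gi: "g i \<in> I" if "i < card I" for i using g that by (auto simp: bij_betw_def)
    have "(\<Sum>i<card I. cmod (f (v (g i)) - f (u (g i)))) < \<epsilon>"
    proof (intro H[rule_format] conjI allI ballI impI)
      show "u (g i) \<le> v (g i)" "{u (g i)..v (g i)} \<subseteq> S" if "i < card I" for i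
        using uv[OF gi[OF that]] by blast+
      show "disjoint_family_on (\<lambda>i. {u (g i)<..<v (g i)}) {..<card I}"
        unfolding disjoint_family_on_def
      proof (intro ballI impI)
        fix i j assume "i \<in> {..<card I}" "j \<in> {..<card I}" "i \<noteq> j"
        then have "g i \<noteq> g j" "g i \<in> I" "g j \<in> I"
          using g by (auto simp: bij_betw_def inj_on_def)
        then show "{u (g i)<..<v (g i)} \<inter> {u (g j)<..<v (g j)} = {}"
          using dis unfolding disjoint_family_on_def by blast
      qed
      show "(\<Sum>i<card I. v (g i) - u (g i)) < \<delta>"
        using len sum.reindex_bij_betw[OF g, of "\<lambda>i. v i - u i"] by simp
    qed
    then show ?thesis using sum.reindex_bij_betw[OF g, of "\<lambda>i. cmod (f (v i) - f (u i))"] by simp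
  qed
  then show ?thesis by (intro that[OF \<delta>] allI impI) blast
qed

lemma absolutely_continuous_on_imp_continuous_on:
  assumes "absolutely_continuous_on {a..b} f"
  shows "continuous_on {a..b} f"
  unfolding continuous_on_iff
proof (intro ballI allI impI)
  fix x \<epsilon> :: real assume x: "x \<in> {a..b}" and "\<epsilon> > 0"
  \<comment> \<open>Families consisting of a single interval suffice, hence the one-point index
    type.\<close>
  obtain \<delta> where \<delta>: "\<delta> > 0" and H: "\<forall>(I :: unit set) u v. short_interval_family {a..b} I u v \<delta> \<longrightarrow>
       (\<Sum>i\<in>I. cmod (f (v i) - f (u i))) < \<epsilon>"
    by (rule absolutely_continuous_on_finite_family[OF assms \<open>\<epsilon> > 0\<close>, where 'i = unit])
  have "dist (f y) (f x) < \<epsilon>" if "y \<in> {a..b}" "dist y x < \<delta>" for y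
  proof -
    have "cmod (f (max x y) - f (min x y)) < \<epsilon>"
      using H[rule_format, of UNIV "\<lambda>_. min x y" "\<lambda>_. max x y"] x that
      by (auto simp: disjoint_family_on_def dist_real_def max_def min_def UNIV_unit split: if_splits)
    then show ?thesis by (auto simp: dist_norm max_def min_def norm_minus_commute split: if_splits)
  qed
  with \<delta> show "\<exists>d>0. \<forall>y\<in>{a..b}. dist y x < d \<longrightarrow> dist (f y) (f x) < \<epsilon>" by blast
qed

text \<open>One transfer principle behind the closure properties: differences, products (with bounds
  of the factors as constants), real and imaginary parts, and functions that agree on
  \<open>S\<close>.\<close>

lemma absolutely_continuous_on_dominated:
  assumes F: "absolutely_continuous_on S F" and G: "absolutely_continuous_on S G"
    and "A > 0" "B > 0"
    and H: "\<And>u v. u \<in> S \<Longrightarrow> v \<in> S \<Longrightarrow> cmod (H v - H u) \<le> A * cmod (F v - F u) + B * cmod (G v - G u)"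
  shows "absolutely_continuous_on S H"
  unfolding absolutely_continuous_on_def
proof (intro allI impI)
  fix \<epsilon> :: real assume "\<epsilon> > 0"
  then have "\<epsilon> / (2 * A) > 0" "\<epsilon> / (2 * B) > 0" using assms by auto
  obtain d where d: "d > 0" and HF: "\<forall>(n::nat) u v. short_intervals S n u v d \<longrightarrow> (\<Sum>i<n. cmod (F (v i) - F (u i))) < \<epsilon> / (2 * A)"
    by (rule absolutely_continuous_onE[OF F \<open>\<epsilon> / (2 * A) > 0\<close>])
  obtain e where e: "e > 0" and HG: "\<forall>(n::nat) u v. short_intervals S n u v e \<longrightarrow> (\<Sum>i<n. cmod (G (v i) - G (u i))) < \<epsilon> / (2 * B)"
    by (rule absolutely_continuous_onE[OF G \<open>\<epsilon> / (2 * B) > 0\<close>])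
  show "\<exists>\<delta>>0. \<forall>(n::nat) u v. short_intervals S n u v \<delta> \<longrightarrow>
        (\<Sum>i<n. cmod (H (v i) - H (u i))) < \<epsilon>"
  proof (intro exI[of _ "min d e"] conjI allI impI)
    fix n u v assume *: "short_intervals S n u v (min d e)"
    have "(\<Sum>i<n. cmod (H (v i) - H (u i)))
        \<le> (\<Sum>i<n. A * cmod (F (v i) - F (u i)) + B * cmod (G (v i) - G (u i)))"
    proof (rule sum_mono)
      fix i assume "i \<in> {..<n}"
      with * have "u i \<le> v i" "{u i..v i} \<subseteq> S" by auto
      then have "u i \<in> S" "v i \<in> S" by auto
      then show "cmod (H (v i) - H (u i)) \<le> A * cmod (F (v i) - F (u i)) + B * cmod (G (v i) - G (u i))"
        by (rule H)
    qed
    also have "\<dots> = A * (\<Sum>i<n. cmod (F (v i) - F (u i))) + B * (\<Sum>i<n. cmod (G (v i) - G (u i)))"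
      by (simp add: sum.distrib sum_distrib_left)
    also have "\<dots> < A * (\<epsilon> / (2 * A)) + B * (\<epsilon> / (2 * B))"
      using HF[rule_format, of n u v] HG[rule_format, of n u v] * assms by (intro add_strict_mono mult_strict_left_mono) auto
    also have "\<dots> = \<epsilon>" using assms by (simp add: field_simps)
    finally show "(\<Sum>i<n. cmod (H (v i) - H (u i))) < \<epsilon>" .
  qed (use d e in auto)
qed

lemma absolutely_continuous_on_lipschitz:
  assumes L: "\<And>u v. u \<in> S \<Longrightarrow> v \<in> S \<Longrightarrow> cmod (f v - f u) \<le> L * \<bar>v - u\<bar>"
  shows "absolutely_continuous_on S f"
  unfolding absolutely_continuous_on_def
proof (intro allI impI)
  fix \<epsilon> :: real assume "\<epsilon> > 0"
  \<comment> \<open>\<open>L\<close> may be 0 or negative, whereas \<open>\<epsilon> / K\<close>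
    needs a positive denominator.\<close>
  define K where "K = \<bar>L\<bar> + 1"
  have K: "K > 0" by (simp add: K_def)
  show "\<exists>\<delta>>0. \<forall>(n::nat) u v. short_intervals S n u v \<delta> \<longrightarrow>
        (\<Sum>i<n. cmod (f (v i) - f (u i))) < \<epsilon>"
  proof (intro exI[of _ "\<epsilon> / K"] conjI allI impI)
    fix n u v assume *: "short_intervals S n u v (\<epsilon> / K)"
    have "(\<Sum>i<n. cmod (f (v i) - f (u i))) \<le> (\<Sum>i<n. K * (v i - u i))"
    proof (rule sum_mono)
      fix i assume "i \<in> {..<n}"
      with * have i: "u i \<le> v i" "{u i..v i} \<subseteq> S" by auto
      then have "u i \<in> S" "v i \<in> S" by auto
      then have "cmod (f (v i) - f (u i)) \<le> L * \<bar>v i - u i\<bar>" by (rule L)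
      also have "\<dots> \<le> K * (v i - u i)"
        using i by (auto simp: K_def intro!: mult_right_mono)
      finally show "cmod (f (v i) - f (u i)) \<le> K * (v i - u i)" .
    qed
    also have "\<dots> = K * (\<Sum>i<n. v i - u i)" by (simp add: sum_distrib_left)
    also have "\<dots> < K * (\<epsilon> / K)" using * K by (intro mult_strict_left_mono) auto
    finally show "(\<Sum>i<n. cmod (f (v i) - f (u i))) < \<epsilon>" using K by simp
  qed (use K \<open>\<epsilon> > 0\<close> in auto)
qed

lemma absolutely_continuous_on_diff:
  assumes "absolutely_continuous_on S f" "absolutely_continuous_on S g"
  shows "absolutely_continuous_on S (\<lambda>x. f x - g x)"
  by (rule absolutely_continuous_on_dominated[OF assms, of 1 1])
     (auto intro: order.trans[OF _ norm_triangle_ineq4] simp: algebra_simps)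

lemma absolutely_continuous_on_mult:
  assumes "absolutely_continuous_on {a..b} f" "absolutely_continuous_on {a..b} g"
  shows "absolutely_continuous_on {a..b} (\<lambda>x. f x * g x)"
proof -
  have "compact (f ` {a..b})" "compact (g ` {a..b})"
    using assms by (auto intro!: compact_continuous_image absolutely_continuous_on_imp_continuous_on)
  then obtain A B where AB: "A > 0" "B > 0"
    and A: "\<And>x. x \<in> {a..b} \<Longrightarrow> cmod (f x) \<le> A" and B: "\<And>x. x \<in> {a..b} \<Longrightarrow> cmod (g x) \<le> B"
    using compact_imp_bounded[of "f ` {a..b}"] compact_imp_bounded[of "g ` {a..b}"]
    by (auto simp: bounded_pos)
  show ?thesis
  proof (rule absolutely_continuous_on_dominated[OF assms AB(2,1)])
    fix u v assume uv: "u \<in> {a..b}" "v \<in> {a..b}"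
    have "f v * g v - f u * g u = g v * (f v - f u) + f u * (g v - g u)" by (simp add: algebra_simps)
    then have "cmod (f v * g v - f u * g u) \<le> cmod (g v) * cmod (f v - f u) + cmod (f u) * cmod (g v - g u)"
      by (metis norm_mult norm_triangle_ineq)
    also have "\<dots> \<le> B * cmod (f v - f u) + A * cmod (g v - g u)"
      using A[OF uv(1)] B[OF uv(2)] by (intro add_mono mult_right_mono) auto
    finally show "cmod (f v * g v - f u * g u) \<le> B * cmod (f v - f u) + A * cmod (g v - g u)" .
  qed
qed

text \<open>The lengths are the Lebesgue measures of disjoint open intervals whose union lies in
  [a,b].\<close>

lemma sum_length_disjoint_intervals_le:
  fixes u v :: "'i \<Rightarrow> real"
  assumes "finite I" "\<And>i. i \<in> I \<Longrightarrow> u i \<le> v i \<and> {u i..v i} \<subseteq> {a..b}"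
    and dis: "disjoint_family_on (\<lambda>i. {u i<..<v i}) I" and "a \<le> b"
  shows "(\<Sum>i\<in>I. v i - u i) \<le> b - a"
proof -
  have "(\<Sum>i\<in>I. v i - u i) = (\<Sum>i\<in>I. measure lborel {u i<..<v i})"
    by (intro sum.cong refl) (simp add: assms(2))
  also have "\<dots> = measure lborel (\<Union>i\<in>I. {u i<..<v i})"
    using assms(1) dis
    by (intro measure_finite_Union[symmetric]) (auto simp: assms(2))
  also have "\<dots> \<le> measure lborel {a..b}"
  proof (rule measure_mono_fmeasurable)
    show "(\<Union>i\<in>I. {u i<..<v i}) \<subseteq> {a..b}"
    proof (rule UN_least)
      fix i assume "i \<in> I"
      then have "{u i..v i} \<subseteq> {a..b}" using assms(2) by blast
      then show "{u i<..<v i} \<subseteq> {a..b}" by auto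
    qed
    show "{a..b} \<in> fmeasurable lborel" by (simp add: fmeasurable_def emeasure_lborel_Icc_eq)
  qed (use assms(1) in auto)
  finally show ?thesis using \<open>a \<le> b\<close> by simp
qed

lemma disjoint_family_on_subset_pointwise:
  assumes "disjoint_family_on B I" "\<And>i. A i \<subseteq> B i"
  shows "disjoint_family_on A I"
  unfolding disjoint_family_on_def
proof (intro ballI impI)
  fix i j assume "i \<in> I" "j \<in> I" "i \<noteq> j"
  then have "B i \<inter> B j = {}" using assms(1) by (auto simp: disjoint_family_on_def)
  then show "A i \<inter> A j = {}" using assms(2)[of i] assms(2)[of j] by auto
qed

section \<open>Positive variation of an absolutely continuous function\<close>

definition positive_variation_sums :: "(real \<Rightarrow> real) \<Rightarrow> real \<Rightarrow> real \<Rightarrow> real set" where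
  "positive_variation_sums f a b =
     {\<Sum>i<n. max 0 (f (v i) - f (u i)) | (n::nat) u v.
        (\<forall>i<n. u i \<le> v i \<and> {u i..v i} \<subseteq> {a..b}) \<and> disjoint_family_on (\<lambda>i. {u i<..<v i}) {..<n}}"

definition positive_variation :: "(real \<Rightarrow> real) \<Rightarrow> real \<Rightarrow> real \<Rightarrow> real" where
  "positive_variation f a x = Sup (positive_variation_sums f a x)"

lemma zero_in_positive_variation_sums: "0 \<in> positive_variation_sums f a b"
  unfolding positive_variation_sums_def disjoint_family_on_def mem_Collect_eq
  by (intro exI[of _ "0::nat"]) auto

text \<open>Cutting every interval of the family at \<open>b\<close> cannot decrease the sum,
  because the positive part is subadditive. An interval on one side of \<open>b\<close> leaves a
  degenerate interval on the other side, which contributes 0.\<close>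

lemma positive_variation_sums_split:
  assumes s: "s \<in> positive_variation_sums f a c" and ab: "a \<le> b" "b \<le> c"
  obtains y z where "y \<in> positive_variation_sums f a b" "z \<in> positive_variation_sums f b c" "s \<le> y + z"
proof -
  obtain n u v where s_eq: "s = (\<Sum>i<n. max 0 (f (v i) - f (u i)))"
    and uv: "\<And>i. i < n \<Longrightarrow> u i \<le> v i \<and> {u i..v i} \<subseteq> {a..c}"
    and dis: "disjoint_family_on (\<lambda>i. {u i<..<v i}) {..<n::nat}"
    using s unfolding positive_variation_sums_def by blast
  let ?y = "\<Sum>i<n. max 0 (f (min (v i) b) - f (min (u i) b))"
  let ?z = "\<Sum>i<n. max 0 (f (max (v i) b) - f (max (u i) b))"
  have bnd: "a \<le> u i" "u i \<le> v i" "v i \<le> c" if "i < n" for i using uv[OF that] by auto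
  have "{min (u i) b<..<min (v i) b} \<subseteq> {u i<..<v i}" for i
    by (auto simp: min_less_iff_disj)
  then have "disjoint_family_on (\<lambda>i. {min (u i) b<..<min (v i) b}) {..<n}"
    by (rule disjoint_family_on_subset_pointwise[OF dis])
  moreover have "\<forall>i<n. min (u i) b \<le> min (v i) b \<and> {min (u i) b..min (v i) b} \<subseteq> {a..b}"
    using bnd ab by (auto simp: min_le_iff_disj intro: order.trans)
  ultimately have y: "?y \<in> positive_variation_sums f a b"
    unfolding positive_variation_sums_def mem_Collect_eq
    by (intro exI[of _ n] exI[of _ "\<lambda>i. min (u i) b"] exI[of _ "\<lambda>i. min (v i) b"]) simp
  have "{max (u i) b<..<max (v i) b} \<subseteq> {u i<..<v i}" for i
    by (auto simp: less_max_iff_disj)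
  then have "disjoint_family_on (\<lambda>i. {max (u i) b<..<max (v i) b}) {..<n}"
    by (rule disjoint_family_on_subset_pointwise[OF dis])
  moreover have "\<forall>i<n. max (u i) b \<le> max (v i) b \<and> {max (u i) b..max (v i) b} \<subseteq> {b..c}"
    using bnd ab by (fastforce simp: le_max_iff_disj)
  ultimately have z: "?z \<in> positive_variation_sums f b c"
    unfolding positive_variation_sums_def mem_Collect_eq
    by (intro exI[of _ n] exI[of _ "\<lambda>i. max (u i) b"] exI[of _ "\<lambda>i. max (v i) b"]) simp
  have "s \<le> ?y + ?z" unfolding s_eq sum.distrib[symmetric]
  proof (rule sum_mono)
    fix i assume "i \<in> {..<n}"
    with bnd[of i] show "max 0 (f (v i) - f (u i)) \<le> max 0 (f (min (v i) b) - f (min (u i) b)) +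
             max 0 (f (max (v i) b) - f (max (u i) b))"
      by (cases "v i \<le> b"; cases "u i \<le> b") (auto simp: min_def max_def)
  qed
  with y z that show ?thesis by blast
qed

lemma positive_variation_sums_append:
  assumes s: "s \<in> positive_variation_sums f a b" and ab: "a \<le> b" "b \<le> c"
  shows "s + max 0 (f c - f b) \<in> positive_variation_sums f a c"
proof -
  obtain n u v where s_eq: "s = (\<Sum>i<n. max 0 (f (v i) - f (u i)))"
    and uv: "\<And>i. i < n \<Longrightarrow> u i \<le> v i \<and> {u i..v i} \<subseteq> {a..b}"
    and dis: "disjoint_family_on (\<lambda>i. {u i<..<v i}) {..<n::nat}"
    using s unfolding positive_variation_sums_def by blast
  have bnd: "a \<le> u i" "u i \<le> v i" "v i \<le> b" if "i < n" for i using uv[OF that] by auto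
  let ?u = "u(n := b)" and ?v = "v(n := c)"
  have "s + max 0 (f c - f b) = (\<Sum>i<Suc n. max 0 (f (?v i) - f (?u i)))"
    unfolding s_eq by simp
  moreover have "\<forall>i<Suc n. ?u i \<le> ?v i \<and> {?u i..?v i} \<subseteq> {a..c}"
    using bnd ab by (fastforce simp: less_Suc_eq)
  moreover have "disjoint_family_on (\<lambda>i. {?u i<..<?v i}) {..<Suc n}"
    unfolding disjoint_family_on_def
  proof (intro ballI impI)
    fix i j assume ij: "i \<in> {..<Suc n}" "j \<in> {..<Suc n}" "i \<noteq> j"
    consider "i < n" "j < n" | "i = n" "j < n" | "i < n" "j = n" using ij by fastforce
    then show "{?u i<..<?v i} \<inter> {?u j<..<?v j} = {}"
    proof cases
      case 1 then show ?thesis using dis ij unfolding disjoint_family_on_def by auto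
    next
      case 2 then show ?thesis using bnd[of j] by auto
    next
      case 3 then show ?thesis using bnd[of i] by auto
    qed
  qed
  ultimately show ?thesis unfolding positive_variation_sums_def by blast
qed

text \<open>Absolute continuity with bound 1 makes every sum over an interval shorter than
  \<open>\<delta>\<close> at most 1. A longer interval is exhausted by finitely many stretches of
  length at most \<open>\<delta> / 2\<close>, each adding at most 1.\<close>

lemma bdd_above_positive_variation_sums:
  assumes ac: "absolutely_continuous_on {a..b} (\<lambda>x. complex_of_real (f x))"
    and ab: "a \<le> c" "c \<le> d" "d \<le> b"
  shows "bdd_above (positive_variation_sums f c d)"
proof -
  obtain \<delta> where \<delta>: "\<delta> > 0" and H: "\<forall>(n::nat) u v. short_intervals {a..b} n u v \<delta> \<longrightarrow>
        (\<Sum>i<n. cmod (of_real (f (v i)) - of_real (f (u i)))) < 1"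
    by (rule absolutely_continuous_onE[OF ac zero_less_one])
  have small: "s \<le> 1" if s: "s \<in> positive_variation_sums f x y" and xy: "a \<le> x" "x \<le> y" "y \<le> b" "y - x < \<delta>" for s x y
  proof -
    obtain n u v where s_eq: "s = (\<Sum>i<n. max 0 (f (v i) - f (u i)))"
      and uv: "\<And>i. i < n \<Longrightarrow> u i \<le> v i \<and> {u i..v i} \<subseteq> {x..y}"
      and dis: "disjoint_family_on (\<lambda>i. {u i<..<v i}) {..<n::nat}"
      using s unfolding positive_variation_sums_def by blast
    have "s \<le> (\<Sum>i<n. cmod (of_real (f (v i)) - of_real (f (u i))))"
      unfolding s_eq by (intro sum_mono) (auto simp flip: of_real_diff)
    also have "\<dots> < 1"
    proof (intro H[rule_format] conjI allI ballI impI)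
      show "u i \<le> v i" "{u i..v i} \<subseteq> {a..b}" if "i < n" for i using uv[OF that] xy by auto
      have "(\<Sum>i<n. v i - u i) \<le> y - x"
        using uv xy by (intro sum_length_disjoint_intervals_le[OF _ _ dis]) auto
      then show "(\<Sum>i<n. v i - u i) < \<delta>" using xy by simp
    qed fact
    finally show ?thesis by simp
  qed
  have "\<forall>x s. c \<le> x \<longrightarrow> x \<le> d \<longrightarrow> x - c \<le> real k * (\<delta> / 2) \<longrightarrow> s \<in> positive_variation_sums f c x \<longrightarrow> s \<le> real (k+1)" for k
  proof (induction k)
    case 0
    then show ?case using small[of _ c] ab \<delta> by force
  next
    case (Suc k)
    show ?case
    proof (intro allI impI)
      fix x s assume x: "c \<le> x" "x \<le> d" "x - c \<le> real (Suc k) * (\<delta> / 2)" and s: "s \<in> positive_variation_sums f c x"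
      \<comment> \<open>Stepping back by \<open>\<delta> / 2\<close> keeps the last stretch strictly
        shorter than \<open>\<delta>\<close>; the maximum stops the descent at
        \<open>c\<close>.\<close>
      define y where "y = max c (x - \<delta> / 2)"
      have y: "c \<le> y" "y \<le> x" "x - y < \<delta>" "y - c \<le> real k * (\<delta>/2)"
        using \<delta> x by (auto simp: y_def max_def algebra_simps add_divide_distrib)
      obtain p q where pq: "p \<in> positive_variation_sums f c y" "q \<in> positive_variation_sums f y x" "s \<le> p + q"
        using positive_variation_sums_split[OF s y(1,2)] .
      have "p \<le> real (k + 1)" using Suc.IH y x pq by force
      moreover have "q \<le> 1" using small[OF pq(2)] y x ab by force
      ultimately show "s \<le> real (Suc k + 1)" using pq by simp
    qed
  qed
  note * = this
  obtain k where "(d - c) / (\<delta> / 2) \<le> real k" using real_arch_simple by blast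
  then have "d - c \<le> real k * (\<delta> / 2)" using \<delta> by (simp add: field_simps)
  then show ?thesis using *[of k] ab by (intro bdd_aboveI[of _ "real (k+1)"]) auto
qed

text \<open>So an absolutely continuous f is the difference of the nondecreasing functions P and P - f, both
  absolutely continuous, where P is the positive variation.\<close>

lemma absolutely_continuous_on_positive_variation:
  assumes ac: "absolutely_continuous_on {a..b} (\<lambda>x. complex_of_real (f x))"
  shows "absolutely_continuous_on {a..b} (\<lambda>x. complex_of_real (positive_variation f a x))"
    and "\<And>x y. a \<le> x \<Longrightarrow> x \<le> y \<Longrightarrow> y \<le> b \<Longrightarrow>
      positive_variation f a x + max 0 (f y - f x) \<le> positive_variation f a y"
proof -
  let ?P = "positive_variation f a"
  note bdd = bdd_above_positive_variation_sums[OF ac]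
  have ne: "positive_variation_sums f c d \<noteq> {}" for c d using zero_in_positive_variation_sums by blast
  show mono: "?P x + max 0 (f y - f x) \<le> ?P y" if xy: "a \<le> x" "x \<le> y" "y \<le> b" for x y
  proof -
    have "?P x \<le> ?P y - max 0 (f y - f x)"
      unfolding positive_variation_def
    proof (rule cSup_least[OF ne])
      fix s assume "s \<in> positive_variation_sums f a x"
      from positive_variation_sums_append[OF this xy(1,2)]
      have "s + max 0 (f y - f x) \<le> Sup (positive_variation_sums f a y)"
        using xy by (intro cSup_upper bdd) auto
      then show "s \<le> Sup (positive_variation_sums f a y) - max 0 (f y - f x)" by simp
    qed
    then show ?thesis by simp
  qed
  \<comment> \<open>The half of additivity that is used: the increment of the positive variation
    over [x,y] is attained, up to any positive error, by a sum over subintervals of [x,y].\<close>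
  have sub: "\<exists>s\<in>positive_variation_sums f x y. ?P y - ?P x - \<eta> \<le> s"
    if xy: "a \<le> x" "x \<le> y" "y \<le> b" "\<eta> > 0" for x y \<eta>
  proof -
    have "?P y - \<eta> < Sup (positive_variation_sums f a y)"
      using \<open>\<eta> > 0\<close> by (simp add: positive_variation_def)
    then obtain s where s: "s \<in> positive_variation_sums f a y" "?P y - \<eta> < s"
      using less_cSup_iff[OF ne bdd[of a y]] xy by auto
    obtain p q where pq: "p \<in> positive_variation_sums f a x" "q \<in> positive_variation_sums f x y" "s \<le> p + q"
      using positive_variation_sums_split[OF s(1) xy(1,2)] .
    have "p \<le> ?P x" unfolding positive_variation_def using xy by (intro cSup_upper pq bdd) auto
    then show ?thesis using s pq by (intro bexI[of _ q]) auto
  qed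
  show "absolutely_continuous_on {a..b} (\<lambda>x. complex_of_real (?P x))"
    unfolding absolutely_continuous_on_def
  proof (intro allI impI)
    fix \<epsilon> :: real assume "\<epsilon> > 0"
    then have "\<epsilon> / 2 > 0" by simp
    obtain \<delta> where \<delta>: "\<delta> > 0" and H: "\<forall>(I :: (nat \<times> nat) set) u v. short_interval_family {a..b} I u v \<delta> \<longrightarrow>
       (\<Sum>i\<in>I. cmod (of_real (f (v i)) - of_real (f (u i)))) < \<epsilon> / 2"
      by (rule absolutely_continuous_on_finite_family[OF ac \<open>\<epsilon> / 2 > 0\<close>, where 'i = "nat \<times> nat"])
    show "\<exists>\<delta>>0. \<forall>(n::nat) u v. short_intervals {a..b} n u v \<delta> \<longrightarrow>
        (\<Sum>i<n. cmod (of_real (?P (v i)) - of_real (?P (u i)))) < \<epsilon>"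
    proof (intro exI[of _ \<delta>] conjI allI impI \<delta>)
      fix n u v assume *: "short_intervals {a..b} n u v \<delta>"
      then have bnd: "a \<le> u i" "u i \<le> v i" "v i \<le> b" if "i < n" for i using that by auto
      \<comment> \<open>Chosen so that the approximation errors of all \<open>n\<close> intervals
        together stay below \<open>\<epsilon> / 2\<close>; the \<open>+ 1\<close> covers
        \<open>n = 0\<close>.\<close>
      define \<eta> where "\<eta> = \<epsilon> / (4 * real (n + 1))"
      have \<eta>: "\<eta> > 0" "real n * \<eta> < \<epsilon> / 2"
        using \<open>\<epsilon> > 0\<close> by (auto simp: \<eta>_def field_simps add_pos_nonneg)
      \<comment> \<open>The premise \<open>i < n\<close> stays inside the existential so that choice
        applies to all natural numbers \<open>i\<close>.\<close>
      have "\<exists>k s t. i < n \<longrightarrow> (\<forall>j<k. s j \<le> t j \<and> {s j..t j} \<subseteq> {u i..v i}) \<and>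
          disjoint_family_on (\<lambda>j. {s j<..<t j}) {..<k::nat} \<and>
          ?P (v i) - ?P (u i) - \<eta> \<le> (\<Sum>j<k. max 0 (f (t j) - f (s j)))" for i
        using sub[OF bnd \<eta>(1), of i] unfolding positive_variation_sums_def by (cases "i < n") blast+
      then have "\<forall>i. \<exists>k s t. i < n \<longrightarrow> (\<forall>j<k. s j \<le> t j \<and> {s j..t j} \<subseteq> {u i..v i}) \<and>
          disjoint_family_on (\<lambda>j. {s j<..<t j}) {..<k::nat} \<and>
          ?P (v i) - ?P (u i) - \<eta> \<le> (\<Sum>j<k. max 0 (f (t j) - f (s j)))" by (rule allI)
      then obtain k s t where sel: "\<forall>i. i < n \<longrightarrow> (\<forall>j<k i. s i j \<le> t i j \<and> {s i j..t i j} \<subseteq> {u i..v i}) \<and>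
          disjoint_family_on (\<lambda>j. {s i j<..<t i j}) {..<k i::nat} \<and>
          ?P (v i) - ?P (u i) - \<eta> \<le> (\<Sum>j<k i. max 0 (f (t i j) - f (s i j)))"
        unfolding choice_iff by (elim exE)
      have kst: "\<And>i j. i < n \<Longrightarrow> j < k i \<Longrightarrow> s i j \<le> t i j \<and> {s i j..t i j} \<subseteq> {u i..v i}"
        "\<And>i. i < n \<Longrightarrow> disjoint_family_on (\<lambda>j. {s i j<..<t i j}) {..<k i::nat}"
        "\<And>i. i < n \<Longrightarrow> ?P (v i) - ?P (u i) - \<eta> \<le> (\<Sum>j<k i. max 0 (f (t i j) - f (s i j)))"
        using sel by blast+
      \<comment> \<open>The subintervals chosen in all the given intervals form one nonoverlapping
        family, indexed by pairs, whose total length does not exceed the given one. Absolute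
        continuity of \<open>f\<close> is applied to this family.\<close>
      let ?I = "Sigma {..<n} (\<lambda>i. {..<k i})"
      have "(\<Sum>i<n. cmod (of_real (?P (v i)) - of_real (?P (u i)))) = (\<Sum>i<n. ?P (v i) - ?P (u i))"
      proof (rule sum.cong[OF refl])
        fix i assume "i \<in> {..<n}"
        then have "?P (u i) \<le> ?P (v i)" using mono[of "u i" "v i"] bnd[of i] by auto
        then show "cmod (of_real (?P (v i)) - of_real (?P (u i))) = ?P (v i) - ?P (u i)"
          by (simp flip: of_real_diff)
      qed
      also have "\<dots> \<le> (\<Sum>i<n. (\<Sum>j<k i. max 0 (f (t i j) - f (s i j))) + \<eta>)"
        using kst(3) by (intro sum_mono) (simp add: algebra_simps)
      also have "\<dots> = (\<Sum>i<n. \<Sum>j<k i. max 0 (f (t i j) - f (s i j))) + real n * \<eta>"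
        by (simp add: sum.distrib)
      also have "(\<Sum>i<n. \<Sum>j<k i. max 0 (f (t i j) - f (s i j)))
          \<le> (\<Sum>i<n. \<Sum>j<k i. cmod (of_real (f (t i j)) - of_real (f (s i j))))"
        by (intro sum_mono) (auto simp flip: of_real_diff)
      also have "\<dots> = (\<Sum>(i,j)\<in>?I. cmod (of_real (f (t i j)) - of_real (f (s i j))))"
        by (subst sum.Sigma) auto
      also have "\<dots> = (\<Sum>p\<in>?I. cmod (of_real (f (case_prod t p)) - of_real (f (case_prod s p))))"
        by (simp add: case_prod_unfold)
      also have "\<dots> < \<epsilon> / 2"
      proof (intro H[rule_format] conjI allI ballI impI)
        show "case_prod s p \<le> case_prod t p" "{case_prod s p..case_prod t p} \<subseteq> {a..b}" if "p \<in> ?I" for p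
        proof -
          obtain i j where p: "p = (i,j)" "i < n" "j < k i" using \<open>p \<in> ?I\<close> by auto
          show "case_prod s p \<le> case_prod t p" "{case_prod s p..case_prod t p} \<subseteq> {a..b}"
            using kst(1)[OF p(2,3)] bnd[OF p(2)] p(1) by auto
        qed
        show "disjoint_family_on (\<lambda>p. {case_prod s p<..<case_prod t p}) ?I"
          unfolding disjoint_family_on_def
        proof (intro ballI impI)
          fix p q assume "p \<in> ?I" "q \<in> ?I" and ne: "p \<noteq> q"
          then obtain i j i' j' where p: "p = (i,j)" "i < n" "j < k i" and q: "q = (i',j')" "i' < n" "j' < k i'"
            by auto
          show "{case_prod s p<..<case_prod t p} \<inter> {case_prod s q<..<case_prod t q} = {}"
          proof (cases "i = i'")
            case True
            then show ?thesis using kst(2)[OF p(2)] ne p q unfolding disjoint_family_on_def by auto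
          next
            case False
            then have "{u i<..<v i} \<inter> {u i'<..<v i'} = {}"
              using * p q unfolding disjoint_family_on_def by blast
            moreover have "{s i j<..<t i j} \<subseteq> {u i<..<v i}"
              using kst(1)[OF p(2,3)] by (auto simp: subset_iff)
            moreover have "{s i' j'<..<t i' j'} \<subseteq> {u i'<..<v i'}"
              using kst(1)[OF q(2,3)] by (auto simp: subset_iff)
            ultimately show ?thesis unfolding p(1) q(1) case_prod_conv by blast
          qed
        qed
        have "(\<Sum>p\<in>?I. case_prod t p - case_prod s p) = (\<Sum>i<n. \<Sum>j<k i. t i j - s i j)"
          by (subst sum.Sigma) (auto simp: case_prod_unfold)
        also have "\<dots> \<le> (\<Sum>i<n. v i - u i)"
        proof (rule sum_mono)
          fix i assume "i \<in> {..<n}"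
          then show "(\<Sum>j<k i. t i j - s i j) \<le> v i - u i"
            using kst(1,2)[of i] bnd[of i]
            by (intro sum_length_disjoint_intervals_le) auto
        qed
        finally show "(\<Sum>p\<in>?I. case_prod t p - case_prod s p) < \<delta>" using * by simp
      qed simp
      finally show "(\<Sum>i<n. cmod (of_real (?P (v i)) - of_real (?P (u i)))) < \<epsilon>"
        using \<eta> by simp
    qed
  qed
qed

section \<open>Absolutely continuous Stieltjes measures and the fundamental theorem of
  calculus\<close>

lemma absolutely_continuous_measure_of_monotone:
  fixes F :: "real \<Rightarrow> real"
  assumes ac: "absolutely_continuous_on {a..b} (\<lambda>x. complex_of_real (F x))"
    and G: "mono G" "continuous_on UNIV G" "\<And>x. x \<in> {a..b} \<Longrightarrow> G x = F x"
    and ab: "a < b" and N: "N \<in> null_sets lborel"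
  shows "emeasure (interval_measure G) (N \<inter> {a<..b}) = 0"
proof -
  let ?\<mu> = "interval_measure G"
  have Gm: "G x \<le> G y" if "x \<le> y" for x y using G(1) that by (rule monoD)
  have Icc: "emeasure ?\<mu> {x..y} = ennreal (G y - G x)" if "x \<le> y" for x y
    by (rule emeasure_interval_measure_Icc[OF that Gm G(2)])
  define S where "S = N \<inter> {a..b}"
  have "negligible N" using N by (simp add: negligible_iff_null_sets null_sets_completionI)
  then have "negligible S" unfolding S_def by (rule negligible_subset) auto
  then have S: "S \<in> lmeasurable" "measure lebesgue S = 0"
    by (auto simp: negligible_iff_measure)
  have "emeasure ?\<mu> (N \<inter> {a<..b}) \<le> 0"
  proof (rule ennreal_le_epsilon)
    fix \<epsilon> :: real assume "\<epsilon> > 0"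
    obtain \<delta> where \<delta>: "\<delta> > 0" and H: "\<forall>(I :: real set set) u v. short_interval_family {a..b} I u v \<delta> \<longrightarrow>
       (\<Sum>i\<in>I. cmod (of_real (F (v i)) - of_real (F (u i)))) < \<epsilon>"
      by (rule absolutely_continuous_on_finite_family[OF ac \<open>\<epsilon> > 0\<close>])
    \<comment> \<open>The null set is covered by countably many nonoverlapping closed intervals
      inside [a,b] whose union has measure at most \<open>\<delta> / 2\<close>, hence less than
      \<open>\<delta>\<close>.\<close>
    obtain D where D: "countable D"
        "\<And>K. K \<in> D \<Longrightarrow> K \<subseteq> cbox a b \<and> K \<noteq> {} \<and> (\<exists>c d. K = cbox c d)"
        "pairwise (\<lambda>A B. interior A \<inter> interior B = {}) D"
        "S \<subseteq> \<Union>D" "\<Union>D \<in> lmeasurable" "measure lebesgue (\<Union>D) \<le> measure lebesgue S + \<delta> / 2"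
      using measurable_outer_intervals_bounded[OF S(1), of a b "\<delta>/2"] \<delta>
      by (metis Int_lower2 S_def cbox_interval half_gt_zero)
    have K: "K = {Inf K..Sup K} \<and> Inf K \<le> Sup K \<and> {Inf K..Sup K} \<subseteq> {a..b}" if "K \<in> D" for K
      using D(2)[OF that] by auto
    \<comment> \<open>The Stieltjes measure of a finite subfamily is at most the sum of the
      increments of \<open>F\<close> over its intervals, and absolute continuity bounds that sum by
      \<open>\<epsilon>\<close>.\<close>
    have fin: "emeasure ?\<mu> (\<Union>T) \<le> ennreal \<epsilon>" if T: "finite T" "T \<subseteq> D" for T
    proof -
      have KT: "K = {Inf K..Sup K}" "Inf K \<le> Sup K" "{Inf K..Sup K} \<subseteq> {a..b}" if "K \<in> T" for K
        using K T that by blast+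
      have dis: "disjoint_family_on (\<lambda>K. {Inf K<..<Sup K}) T"
        unfolding disjoint_family_on_def
      proof (intro ballI impI)
        fix A B assume AB: "A \<in> T" "B \<in> T" "A \<noteq> B"
        then have "interior A \<inter> interior B = {}" using D(3) T unfolding pairwise_def by blast
        moreover have "interior A = {Inf A<..<Sup A}" "interior B = {Inf B<..<Sup B}"
          using KT(1)[OF AB(1)] KT(1)[OF AB(2)] interior_atLeastAtMost_real by metis+
        ultimately show "{Inf A<..<Sup A} \<inter> {Inf B<..<Sup B} = {}" by simp
      qed
      have "(\<Sum>K\<in>T. Sup K - Inf K) = (\<Sum>K\<in>T. measure lebesgue {Inf K<..<Sup K})"
        by (intro sum.cong refl) (simp add: KT)
      also have "\<dots> = measure lebesgue (\<Union>K\<in>T. {Inf K<..<Sup K})"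
        using T(1) dis by (intro measure_finite_Union[symmetric]) (auto simp: KT)
      also have "\<dots> \<le> measure lebesgue (\<Union>D)"
      proof (rule measure_mono_fmeasurable[OF _ _ D(5)])
        show "(\<Union>K\<in>T. {Inf K<..<Sup K}) \<subseteq> \<Union>D"
        proof (rule UN_least)
          fix K assume "K \<in> T"
          then have "{Inf K<..<Sup K} \<subseteq> K" using KT(1)[of K] greaterThanLessThan_subseteq_atLeastAtMost_iff by blast
          then show "{Inf K<..<Sup K} \<subseteq> \<Union>D" using \<open>K \<in> T\<close> T by blast
        qed
      qed (use T in auto)
      also have "\<dots> < \<delta>" using D(6) S(2) \<delta> by simp
      finally have len: "(\<Sum>K\<in>T. Sup K - Inf K) < \<delta>" .
      have "(\<Sum>K\<in>T. cmod (of_real (F (Sup K)) - of_real (F (Inf K)))) < \<epsilon>"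
        using KT T(1) dis len by (intro H[rule_format] conjI ballI) blast+
      moreover have "cmod (of_real (F (Sup K)) - of_real (F (Inf K))) = G (Sup K) - G (Inf K)"
        if "K \<in> T" for K
      proof -
        have "G (Sup K) = F (Sup K)" "G (Inf K) = F (Inf K)"
          using G(3) KT(2,3)[OF that] by auto
        then show ?thesis using Gm[OF KT(2)[OF that]] by (simp flip: of_real_diff)
      qed
      ultimately have le: "(\<Sum>K\<in>T. G (Sup K) - G (Inf K)) \<le> \<epsilon>" by simp
      have "emeasure ?\<mu> (\<Union>K\<in>T. K) \<le> (\<Sum>K\<in>T. emeasure ?\<mu> K)"
      proof (rule emeasure_subadditive_finite[OF T(1)])
        show "(\<lambda>K. K) ` T \<subseteq> sets ?\<mu>"
        proof
          fix K assume "K \<in> (\<lambda>K. K) ` T"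
          then have "K = {Inf K..Sup K}" using KT by blast
          then show "K \<in> sets ?\<mu>" by (metis atLeastAtMost_borel sets_interval_measure)
        qed
      qed
      also have "\<dots> = (\<Sum>K\<in>T. ennreal (G (Sup K) - G (Inf K)))"
      proof (intro sum.cong refl)
        fix K assume "K \<in> T"
        then show "emeasure ?\<mu> K = ennreal (G (Sup K) - G (Inf K))" using KT(1,2) Icc by metis
      qed
      also have "\<dots> = ennreal (\<Sum>K\<in>T. G (Sup K) - G (Inf K))"
        using KT(2) Gm by (intro sum_ennreal) simp
      also have "\<dots> \<le> ennreal \<epsilon>" using le by (rule ennreal_leI)
      finally show ?thesis by simp
    qed
    have "emeasure ?\<mu> (N \<inter> {a<..b}) \<le> ennreal \<epsilon>"
    proof (cases "D = {}")
      case True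
      then have "N \<inter> {a<..b} = {}" using D(4) unfolding S_def by auto
      then show ?thesis by simp
    next
      case False
      \<comment> \<open>Finite unions exhausting the cover, so that the bound for finite subfamilies
        passes to the whole cover by continuity from below.\<close>
      define E where "E n = \<Union>(from_nat_into D ` {..n})" for n
      have DE: "\<Union>D = (\<Union>n. E n)"
      proof -
        have "\<Union>D = (\<Union>n. from_nat_into D n)" using range_from_nat_into[OF False D(1)] by simp
        also have "\<dots> = (\<Union>n. E n)" unfolding E_def by blast
        finally show ?thesis .
      qed
      have Kb: "K \<in> sets ?\<mu>" if "K \<in> D" for K
        using K[OF that] by (metis atLeastAtMost_borel sets_interval_measure)
      have meas: "E n \<in> sets ?\<mu>" for n
        unfolding E_def using Kb from_nat_into[OF False] by (intro sets.finite_Union) auto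
      have "emeasure ?\<mu> (N \<inter> {a<..b}) \<le> emeasure ?\<mu> (\<Union>n. E n)"
      proof (rule emeasure_mono)
        show "N \<inter> {a<..b} \<subseteq> (\<Union>n. E n)" using D(4) unfolding DE[symmetric] S_def by auto
      qed (use meas in auto)
      also have "\<dots> = (SUP n. emeasure ?\<mu> (E n))"
        using meas by (intro SUP_emeasure_incseq[symmetric]) (auto simp: incseq_def E_def intro!: Union_mono image_mono)
      also have "\<dots> \<le> ennreal \<epsilon>"
        unfolding E_def using from_nat_into[OF False] by (intro SUP_least fin) auto
      finally show ?thesis .
    qed
    then show "emeasure ?\<mu> (N \<inter> {a<..b}) \<le> 0 + ennreal \<epsilon>" by simp
  qed
  then show ?thesis by simp
qed

text \<open>The Stieltjes measure of \<open>F\<close> is absolutely continuous with respect to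
  Lebesgue measure, so it has a Radon-Nikodym density, and the integrals of the density are the
  increments of \<open>F\<close>.\<close>

lemma monotone_absolutely_continuous_on_density:
  fixes F :: "real \<Rightarrow> real"
  assumes ac: "absolutely_continuous_on {a..b} (\<lambda>x. complex_of_real (F x))"
    and mono: "\<And>x y. a \<le> x \<Longrightarrow> x \<le> y \<Longrightarrow> y \<le> b \<Longrightarrow> F x \<le> F y" and ab: "a < b"
  obtains g where "\<And>x. g x \<ge> 0" "\<And>x. x \<in> {a..b} \<Longrightarrow> (g has_integral (F x - F a)) {a..x}"
proof -
  \<comment> \<open>Constant continuation of \<open>F\<close> beyond [a,b], which is monotone and
    continuous on the whole line.\<close>
  define G where "G x = F (max a (min b x))" for x
  have Gm: "mono G" unfolding G_def using ab by (auto intro!: monoI mono)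
  have "continuous_on {a..b} (\<lambda>x. Re (complex_of_real (F x)))"
    by (intro continuous_intros absolutely_continuous_on_imp_continuous_on[OF ac])
  then have "continuous_on {a..b} F" by simp
  then have Gc: "continuous_on UNIV G"
    unfolding G_def by (rule continuous_on_compose2) (use ab in \<open>auto intro!: continuous_intros\<close>)
  have GF: "G x = F x" if "x \<in> {a..b}" for x
    using that by (simp add: G_def min_absorb2 max_absorb2)
  let ?\<mu> = "interval_measure G"
  define \<nu> where "\<nu> = density ?\<mu> (indicator {a<..b})"
  have \<nu>: "emeasure \<nu> A = emeasure ?\<mu> (A \<inter> {a<..b})" if "A \<in> sets borel" for A
    unfolding \<nu>_def using that
    by (subst emeasure_density) (auto simp: Int_commute simp flip: indicator_inter_arith)
  have "absolutely_continuous lborel \<nu>"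
    unfolding absolutely_continuous_def
  proof
    fix N assume "N \<in> null_sets (lborel :: real measure)"
    moreover from this have "N \<in> sets borel" by auto
    moreover have "emeasure \<nu> N = 0"
      using absolutely_continuous_measure_of_monotone[OF ac Gm Gc GF ab] calculation by (simp add: \<nu>)
    ultimately show "N \<in> null_sets \<nu>" by (auto simp: null_sets_def \<nu>_def)
  qed
  moreover have "sets \<nu> = sets lborel" by (simp add: \<nu>_def)
  ultimately obtain f where f: "f \<in> borel_measurable lborel" "density lborel f = \<nu>"
    using sigma_finite_measure.Radon_Nikodym[OF sigma_finite_lborel] by blast
  have int: "(\<integral>\<^sup>+ t. f t * indicator {a<..x} t \<partial>lborel) = ennreal (F x - F a)" if x: "x \<in> {a..b}" for x
  proof -
    have "(\<integral>\<^sup>+ t. f t * indicator {a<..x} t \<partial>lborel) = emeasure \<nu> {a<..x}"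
      using f by (subst f(2)[symmetric], subst emeasure_density) auto
    also have "\<dots> = emeasure ?\<mu> {a<..x}" using x by (subst \<nu>) (auto simp: Int_absorb2)
    also have "\<dots> = G x - G a"
      using x Gm Gc by (intro emeasure_interval_measure_Ioc) (auto dest: monoD simp: continuous_on_eq_continuous_at
           intro: continuous_at_imp_continuous_at_within)
    finally show ?thesis using x ab by (simp add: GF)
  qed
  \<comment> \<open>The density takes extended values; it is finite almost everywhere on (a,b],
    because its integral there is \<open>F b - F a\<close>, so passing to real values leaves the
    integrals unchanged.\<close>
  define g where "g t = enn2real (f t)" for t
  have gm[measurable]: "g \<in> borel_measurable borel" using f(1) unfolding g_def by measurable
  have "AE t in lborel. f t * indicator {a<..b} t \<noteq> \<infinity>"
    using f(1) int[of b] ab by (intro nn_integral_PInf_AE) auto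
  then have fin: "AE t in lborel. t \<in> {a<..b} \<longrightarrow> f t \<noteq> \<infinity>"
    by eventually_elim auto
  have "(g has_integral (F x - F a)) {a..x}" if x: "x \<in> {a..b}" for x
  proof -
    have "((\<lambda>t. g t * indicator {a<..x} t) has_integral (F x - F a)) UNIV"
    proof (rule nn_integral_has_integral)
      have "(\<integral>\<^sup>+ t. ennreal (g t * indicator {a<..x} t) \<partial>lborel) = (\<integral>\<^sup>+ t. f t * indicator {a<..x} t \<partial>lborel)"
      proof (rule nn_integral_cong_AE)
        show "AE t in lborel. ennreal (g t * indicator {a<..x} t) = f t * indicator {a<..x} t"
          using fin by eventually_elim (use x in \<open>auto simp: g_def indicator_def less_top\<close>)
      qed
      then show "(\<integral>\<^sup>+ t. ennreal (g t * indicator {a<..x} t) \<partial>lborel) = ennreal (F x - F a)"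
        using int[OF x] by simp
      show "0 \<le> F x - F a" using mono[of a x] x by auto
      show "(\<lambda>t. g t * indicator {a<..x} t) \<in> borel_measurable borel" by measurable
    qed (auto simp: g_def)
    also have "(\<lambda>t. g t * indicator {a<..x} t) = (\<lambda>t. if t \<in> {a<..x} then g t else 0)"
      by (auto simp: indicator_def)
    finally have "(g has_integral (F x - F a)) {a<..x}" by (simp only: has_integral_restrict_UNIV)
    then show ?thesis
      by (rule has_integral_spike_set_eq[THEN iffD1, rotated 2])
         (auto intro: negligible_subset[of "{a}"])
  qed
  then show ?thesis by (intro that[of g]) (auto simp: g_def)
qed

text \<open>Lebesgue differentiation from both sides. The theorem applied controls difference
  quotients to the right of a point; those to the left come from applying it to the reflected
  function \<open>f1\<close>. Extension by 0 makes both functions integrable on every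
  interval.\<close>

lemma indefinite_integral_has_derivative_ae:
  fixes g :: "real \<Rightarrow> real"
  assumes g: "g integrable_on {a..b}"
  obtains N where "negligible N"
    "\<And>x. x \<in> {a..b} - N \<Longrightarrow> ((\<lambda>y. integral {a..y} g) has_field_derivative g x) (at x within {a..b})"
proof -
  define f0 where "f0 x = (if x \<in> {a..b} then g x else 0)" for x
  define f1 where "f1 x = f0 (- x)" for x
  have f0: "f0 integrable_on cbox c d" for c d
  proof -
    have "f0 integrable_on UNIV" unfolding f0_def using g by (subst integrable_restrict_UNIV)
    then show ?thesis by (rule integrable_on_subcbox) simp
  qed
  have f1: "f1 integrable_on cbox c d" for c d
    using f0[of "-d" "-c"] has_integral_reflect_real[where f = f0 and a = "-d" and b = "-c"]
    unfolding integrable_on_def f1_def[abs_def] cbox_interval minus_minus by meson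
  obtain N0 where N0: "negligible N0" and R: "\<And>x e. x \<notin> N0 \<Longrightarrow> 0 < e \<Longrightarrow>
      \<exists>d>0. \<forall>h. 0 < h \<and> h < d \<longrightarrow> norm (integral {x..x+h} f0 /\<^sub>R h - f0 x) < e"
    using integrable_ccontinuous_explicit[OF f0] by auto
  obtain N1 where N1: "negligible N1" and L: "\<And>x e. x \<notin> N1 \<Longrightarrow> 0 < e \<Longrightarrow>
      \<exists>d>0. \<forall>h. 0 < h \<and> h < d \<longrightarrow> norm (integral {x..x+h} f1 /\<^sub>R h - f1 x) < e"
    using integrable_ccontinuous_explicit[OF f1] by auto
  let ?N = "N0 \<union> uminus ` N1"
  have "negligible (uminus ` N1)"
    by (rule negligible_differentiable_image_negligible[OF _ N1]) (auto intro!: derivative_intros)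
  then have neg: "negligible ?N" using N0 by auto
  have cell: "integral {a..d} g - integral {a..c} g = integral {c..d} f0"
    if cd: "a \<le> c" "c \<le> d" "d \<le> b" for c d
  proof -
    have "g integrable_on {a..d}" using g by (rule integrable_on_subinterval) (use cd in auto)
    then have "integral {a..c} g + integral {c..d} g = integral {a..d} g"
      using cd by (intro Henstock_Kurzweil_Integration.integral_combine) auto
    moreover have "integral {c..d} g = integral {c..d} f0"
      using cd by (intro integral_cong) (auto simp: f0_def)
    ultimately show ?thesis by simp
  qed
  have "((\<lambda>y. integral {a..y} g) has_field_derivative g x) (at x within {a..b})"
    if x: "x \<in> {a..b} - ?N" for x
    unfolding has_field_derivative_iff Lim_within
  proof (intro allI impI)
    fix e :: real assume "e > 0"
    have xN: "x \<notin> N0" "- x \<notin> N1" using x by (auto simp: image_iff)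
    obtain d0 where d0: "d0 > 0" "\<And>h. 0 < h \<Longrightarrow> h < d0 \<Longrightarrow> norm (integral {x..x+h} f0 /\<^sub>R h - f0 x) < e"
      using R[OF xN(1) \<open>e > 0\<close>] by auto
    obtain d1 where d1: "d1 > 0" "\<And>h. 0 < h \<Longrightarrow> h < d1 \<Longrightarrow> norm (integral {-x..-x+h} f1 /\<^sub>R h - f1 (-x)) < e"
      using L[OF xN(2) \<open>e > 0\<close>] by auto
    have gx: "f0 x = g x" "f1 (-x) = g x" using x by (auto simp: f0_def f1_def)
    show "\<exists>d>0. \<forall>y\<in>{a..b}. 0 < dist y x \<and> dist y x < d \<longrightarrow>
        dist ((integral {a..y} g - integral {a..x} g) / (y - x)) (g x) < e"
    proof (intro exI[of _ "min d0 d1"] conjI ballI impI)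
      fix y assume y: "y \<in> {a..b}" "0 < dist y x \<and> dist y x < min d0 d1"
      show "dist ((integral {a..y} g - integral {a..x} g) / (y - x)) (g x) < e"
      proof (cases "x < y")
        case True
        then have "norm (integral {x..x+(y-x)} f0 /\<^sub>R (y-x) - f0 x) < e"
          using y by (intro d0(2)) (auto simp: dist_real_def)
        moreover have "integral {a..y} g - integral {a..x} g = integral {x..y} f0"
          using x y True by (intro cell) auto
        ultimately show ?thesis by (simp add: dist_norm gx divide_inverse_commute)
      next
        case False
        then have "y < x" using y by auto
        then have "norm (integral {-x..-x+(x-y)} f1 /\<^sub>R (x-y) - f1 (-x)) < e"
          using y by (intro d1(2)) (auto simp: dist_real_def)
        moreover have "integral {-x..-x+(x-y)} f1 = integral {y..x} f0"
          unfolding f1_def by simp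
        moreover have "integral {a..x} g - integral {a..y} g = integral {y..x} f0"
          using x y \<open>y < x\<close> by (intro cell) auto
        moreover have "(integral {a..y} g - integral {a..x} g) / (y - x) = (integral {a..x} g - integral {a..y} g) / (x - y)"
          by (metis minus_diff_eq minus_divide_divide)
        ultimately show ?thesis by (simp add: dist_norm gx divide_inverse_commute)
      qed
    qed (use d0 d1 in auto)
  qed
  with neg show ?thesis by (rule that)
qed

text \<open>Jordan decomposition: with P the positive variation, P and P - F are nondecreasing and
  absolutely continuous, so each has a nonnegative density. Hence F is a constant plus an indefinite
  integral, and Lebesgue differentiation gives its derivative almost everywhere.\<close>

lemma absolutely_continuous_on_FTC_real:
  fixes F :: "real \<Rightarrow> real"
  assumes ac: "absolutely_continuous_on {a..b} (\<lambda>x. complex_of_real (F x))" and ab: "a < b"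
  obtains g N where "negligible N"
    "\<And>x. x \<in> {a..b} - N \<Longrightarrow> (F has_field_derivative g x) (at x within {a..b})"
    "g absolutely_integrable_on {a..b}"
    "\<And>x. x \<in> {a..b} \<Longrightarrow> (g has_integral (F x - F a)) {a..x}"
proof -
  let ?P = "positive_variation F a"
  note P = absolutely_continuous_on_positive_variation[OF ac]
  obtain g1 where g1: "\<And>x. g1 x \<ge> 0" "\<And>x. x \<in> {a..b} \<Longrightarrow> (g1 has_integral (?P x - ?P a)) {a..x}"
    using monotone_absolutely_continuous_on_density[OF P(1) _ ab] P(2)
    by (smt (verit))
  have Q: "absolutely_continuous_on {a..b} (\<lambda>x. complex_of_real (?P x - F x))"
    using absolutely_continuous_on_diff[OF P(1) ac] by simp
  have "?P x - F x \<le> ?P y - F y" if "a \<le> x" "x \<le> y" "y \<le> b" for x y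
    using P(2)[OF that] by (simp add: max_def split: if_splits)
  then obtain g2 where g2: "\<And>x. g2 x \<ge> 0"
      "\<And>x. x \<in> {a..b} \<Longrightarrow> (g2 has_integral ((?P x - F x) - (?P a - F a))) {a..x}"
    using monotone_absolutely_continuous_on_density[OF Q _ ab] by metis
  define g where "g x = g1 x - g2 x" for x
  have int: "(g has_integral (F x - F a)) {a..x}" if "x \<in> {a..b}" for x
    using has_integral_diff[OF g1(2)[OF that] g2(2)[OF that]] by (simp add: g_def[abs_def])
  have abs: "g absolutely_integrable_on {a..b}"
    unfolding g_def using g1(1) g2(1) ab
      has_integral_integrable[OF g1(2), of b] has_integral_integrable[OF g2(2), of b]
    by (intro set_integral_diff(1) nonnegative_absolutely_integrable_1) auto
  then have "g integrable_on {a..b}" by (rule set_lebesgue_integral_eq_integral)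
  then obtain N where N: "negligible N"
    "\<And>x. x \<in> {a..b} - N \<Longrightarrow> ((\<lambda>y. integral {a..y} g) has_field_derivative g x) (at x within {a..b})"
    using indefinite_integral_has_derivative_ae by blast
  have "(F has_field_derivative g x) (at x within {a..b})" if "x \<in> {a..b} - N" for x
  proof -
    have "((\<lambda>y. F a + integral {a..y} g) has_field_derivative 0 + g x) (at x within {a..b})"
      by (intro derivative_intros N that)
    then have "((\<lambda>y. F a + integral {a..y} g) has_field_derivative g x) (at x within {a..b})" by simp
    then show ?thesis
      by (rule has_field_derivative_transform_within[OF _ zero_less_one])
         (use that in \<open>auto simp: integral_unique[OF int]\<close>)
  qed
  with N(1) abs int show ?thesis by (intro that)
qed

lemma absolutely_continuous_on_FTC:
  assumes ac: "absolutely_continuous_on {a..b} f" and ab: "a < b"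
  obtains g N where "negligible N"
    "\<And>x. x \<in> {a..b} - N \<Longrightarrow> (f has_vector_derivative g x) (at x within {a..b})"
    "g absolutely_integrable_on {a..b}"
    "\<And>x. x \<in> {a..b} \<Longrightarrow> (g has_integral (f x - f a)) {a..x}"
proof -
  have "absolutely_continuous_on {a..b} (\<lambda>x. complex_of_real (Re (f x)))"
    by (rule absolutely_continuous_on_dominated[OF ac ac, of 1 1])
       (auto simp flip: of_real_diff minus_complex.sel intro: order.trans[OF abs_Re_le_cmod])
  from absolutely_continuous_on_FTC_real[OF this ab]
  obtain g1 N1 where 1: "negligible N1"
    "\<And>x. x \<in> {a..b} - N1 \<Longrightarrow> ((\<lambda>x. Re (f x)) has_field_derivative g1 x) (at x within {a..b})"
    "g1 absolutely_integrable_on {a..b}"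
    "\<And>x. x \<in> {a..b} \<Longrightarrow> (g1 has_integral (Re (f x) - Re (f a))) {a..x}" by metis
  have "absolutely_continuous_on {a..b} (\<lambda>x. complex_of_real (Im (f x)))"
    by (rule absolutely_continuous_on_dominated[OF ac ac, of 1 1])
       (auto simp flip: of_real_diff minus_complex.sel intro: order.trans[OF abs_Im_le_cmod])
  from absolutely_continuous_on_FTC_real[OF this ab]
  obtain g2 N2 where 2: "negligible N2"
    "\<And>x. x \<in> {a..b} - N2 \<Longrightarrow> ((\<lambda>x. Im (f x)) has_field_derivative g2 x) (at x within {a..b})"
    "g2 absolutely_integrable_on {a..b}"
    "\<And>x. x \<in> {a..b} \<Longrightarrow> (g2 has_integral (Im (f x) - Im (f a))) {a..x}" by metis
  define g where "g x = Complex (g1 x) (g2 x)" for x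
  show ?thesis
  proof (rule that)
    show "negligible (N1 \<union> N2)" using 1 2 by auto
    show "(f has_vector_derivative g x) (at x within {a..b})" if x: "x \<in> {a..b} - (N1 \<union> N2)" for x
    proof -
      show ?thesis
        using 1(2)[of x] 2(2)[of x] x by (simp add: has_vector_derivative_complex_iff g_def)
    qed
    show "(g has_integral (f x - f a)) {a..x}" if "x \<in> {a..b}" for x
    proof -
      have "((\<lambda>t. complex_of_real (g1 t) + \<i> * complex_of_real (g2 t)) has_integral
          (of_real (Re (f x) - Re (f a)) + \<i> * of_real (Im (f x) - Im (f a)))) {a..x}"
        by (intro has_integral_add has_integral_mult_right has_integral_of_real 1(4) 2(4) that)
      moreover have "of_real (Re (f x) - Re (f a)) + \<i> * of_real (Im (f x) - Im (f a)) = f x - f a"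
        by (simp add: complex_eq_iff)
      ultimately show ?thesis by (simp add: g_def[abs_def] Complex_eq)
    qed
    have "(\<lambda>t. complex_of_real (g1 t)) absolutely_integrable_on {a..b}"
         "(\<lambda>t. \<i> * complex_of_real (g2 t)) absolutely_integrable_on {a..b}"
      using absolutely_integrable_linear[OF 1(3) bounded_linear_of_real]
            absolutely_integrable_linear[OF absolutely_integrable_linear[OF 2(3) bounded_linear_of_real] bounded_linear_mult_right[of \<i>]]
      by (auto simp: o_def)
    then show "g absolutely_integrable_on {a..b}"
      unfolding g_def[abs_def] Complex_eq by (rule set_integral_add(1))
  qed
qed

lemma absolutely_continuous_on_C1:
  assumes f: "\<And>x. x \<in> {a..b} \<Longrightarrow> (f has_vector_derivative f' x) (at x within {a..b})"
    and cont: "continuous_on {a..b} f'"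
  shows "absolutely_continuous_on {a..b} f"
proof -
  have "bounded (f' ` {a..b})" using cont by (intro compact_imp_bounded compact_continuous_image) auto
  then obtain L where L: "\<forall>x\<in>{a..b}. cmod (f' x) \<le> L" by (auto simp: bounded_iff)
  show ?thesis
  proof (rule absolutely_continuous_on_lipschitz)
    fix u v assume "u \<in> {a..b}" "v \<in> {a..b}"
    then have "norm (f v - f u) \<le> L * norm (v - u)"
      using f L unfolding has_vector_derivative_def
      by (intro differentiable_bound[of "{a..b}" f "\<lambda>x h. h *\<^sub>R f' x"] onorm_le)
         (auto simp: mult.commute[of L] intro!: mult_left_mono)
    then show "cmod (f v - f u) \<le> L * \<bar>v - u\<bar>" by simp
  qed
qed

text \<open>The product of \<open>f\<close> with a polynomial is again absolutely continuous, so the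
  fundamental theorem applies to it, and the product rule holds wherever \<open>f\<close> is
  differentiable. Elsewhere, on a null set, \<open>vector_derivative\<close> may be
  anything.\<close>

lemma absolutely_continuous_on_by_parts:
  assumes ac: "absolutely_continuous_on {a..b} f" and ab: "a < b"
    and cd: "a \<le> c" "c \<le> d" "d \<le> b"
  shows "((\<lambda>x. poly p (of_real x) * vector_derivative f (at x within {a..b})) has_integral
     (poly p (of_real d) * f d - poly p (of_real c) * f c
      - integral {c..d} (\<lambda>x. poly (pderiv p) (of_real x) * f x))) {c..d}"
proof -
  let ?P = "\<lambda>x. poly p (complex_of_real x)" and ?Q = "\<lambda>x. poly (pderiv p) (complex_of_real x)"
  have P: "(?P has_vector_derivative ?Q x) (at x within S)" for x S
    by (rule has_vector_derivative_real_field) (rule poly_DERIV)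
  have Qc: "continuous_on S ?Q" for S by (intro continuous_intros)
  have "absolutely_continuous_on {a..b} ?P" by (intro absolutely_continuous_on_C1[of _ _ _ ?Q] P Qc)
  from absolutely_continuous_on_mult[OF this ac]
  have ac2: "absolutely_continuous_on {a..b} (\<lambda>x. ?P x * f x)" .
  obtain g1 N1 where 1: "negligible N1"
    "\<And>x. x \<in> {a..b} - N1 \<Longrightarrow> ((\<lambda>x. ?P x * f x) has_vector_derivative g1 x) (at x within {a..b})"
    "\<And>x. x \<in> {a..b} \<Longrightarrow> (g1 has_integral (?P x * f x - ?P a * f a)) {a..x}"
    using absolutely_continuous_on_FTC[OF ac2 ab] by metis
  obtain g2 N2 where 2: "negligible N2"
    "\<And>x. x \<in> {a..b} - N2 \<Longrightarrow> (f has_vector_derivative g2 x) (at x within {a..b})"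
    using absolutely_continuous_on_FTC[OF ac ab] by metis
  \<comment> \<open>The fundamental theorem supplies integrals that start at \<open>a\<close>; the
    one over [c,d] is a difference of two of them.\<close>
  have int: "(g1 has_integral (?P d * f d - ?P c * f c)) {c..d}"
  proof -
    have "g1 integrable_on {c..d}"
      using has_integral_integrable[OF 1(3)[of b]] ab cd by (rule_tac integrable_on_subinterval[of _ "{a..b}"]) auto
    then obtain i where i: "(g1 has_integral i) {c..d}" by (auto simp: integrable_on_def)
    have "(g1 has_integral ((?P c * f c - ?P a * f a) + i)) {a..d}"
      using cd by (intro has_integral_combine[OF cd(1,2) 1(3) i]) auto
    from has_integral_unique[OF this 1(3)[of d]] cd have "i = ?P d * f d - ?P c * f c"
      by (simp add: algebra_simps)
    with i show ?thesis by simp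
  qed
  have "continuous_on {c..d} (\<lambda>x. ?Q x * f x)"
    using absolutely_continuous_on_imp_continuous_on[OF ac] cd
    by (intro continuous_intros) (auto elim: continuous_on_subset)
  then have "(\<lambda>x. ?Q x * f x) integrable_on {c..d}" by (rule integrable_continuous_real)
  then have "((\<lambda>x. ?Q x * f x) has_integral (integral {c..d} (\<lambda>x. ?Q x * f x))) {c..d}"
    by (rule integrable_integral)
  from has_integral_diff[OF int this]
  show ?thesis
  proof (rule has_integral_spike[rotated 2])
    show "negligible (N1 \<union> N2)" using 1 2 by auto
    fix x assume x: "x \<in> {c..d} - (N1 \<union> N2)"
    then have x': "x \<in> {a..b} - N1" "x \<in> {a..b} - N2" "x \<in> {a..b}" using cd by auto
    have "((\<lambda>x. ?P x * f x) has_vector_derivative (?P x * g2 x + ?Q x * f x)) (at x within {a..b})"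
      by (intro has_vector_derivative_mult P 2 x')
    then have "g1 x = ?P x * g2 x + ?Q x * f x"
      using 1(2)[OF x'(1)] vector_derivative_within_closed_interval[OF ab x'(3)] by metis
    moreover have "vector_derivative f (at x within {a..b}) = g2 x"
      using 2(2)[OF x'(2)] vector_derivative_within_closed_interval[OF ab x'(3)] by metis
    ultimately show "?P x * vector_derivative f (at x within {a..b}) = g1 x - ?Q x * f x"
      by simp
  qed
qed

section \<open>Iterated derivatives of Sobolev functions and repeated integration by parts\<close>

lemma deriv_within_Icc_0 [simp]: "deriv_within_Icc a b 0 \<phi> = \<phi>"
  by (simp add: deriv_within_Icc_def)

lemma deriv_within_Icc_Suc:
  "deriv_within_Icc a b (Suc k) \<phi> x = vector_derivative (deriv_within_Icc a b k \<phi>) (at x within {a..b})"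
  by (simp add: deriv_within_Icc_def)

text \<open>Below the top order the next derivative is continuous, being itself differentiable or
  absolutely continuous, so the derivative of order \<open>k\<close> is continuously differentiable
  and hence Lipschitz.\<close>

lemma sobolev_space_absolutely_continuous_deriv:
  assumes \<phi>: "\<phi> \<in> sobolev_space m a b" and ab: "a < b" and k: "k < m"
  shows "absolutely_continuous_on {a..b} (deriv_within_Icc a b k \<phi>)"
proof (cases "k = m - 1")
  case True
  then show ?thesis using \<phi> by (simp add: sobolev_space_def)
next
  case False
  let ?D = "\<lambda>k. deriv_within_Icc a b k \<phi>"
  have diff: "(?D j has_vector_derivative ?D (Suc j) x) (at x within {a..b})"
    if "j < m - 1" "x \<in> {a..b}" for j x
  proof -
    have "?D j differentiable (at x within {a..b})"
      using \<phi> that by (auto simp: sobolev_space_def differentiable_on_def)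
    then show ?thesis unfolding deriv_within_Icc_Suc by (simp add: vector_derivative_works)
  qed
  have cont: "continuous_on {a..b} (?D (Suc k))"
  proof (cases "Suc k = m - 1")
    case True
    then show ?thesis
      using \<phi> by (auto simp: sobolev_space_def intro: absolutely_continuous_on_imp_continuous_on)
  next
    case F: False
    with False k have "Suc k < m - 1" by simp
    then show ?thesis
      by (intro continuous_on_vector_derivative[OF diff]) auto
  qed
  then show ?thesis using False k by (intro absolutely_continuous_on_C1[OF diff]) auto
qed

text \<open>All \<open>m\<close> derivatives are moved from the Sobolev function to the polynomial.
  It is applied on one cell with \<open>p\<close> the m-th derivative of a spline piece, where
  \<open>(pderiv ^^ m) p\<close> is a constant.\<close>

lemma sobolev_poly_integral:
  assumes \<phi>: "\<phi> \<in> sobolev_space m a b" and ab: "a < b" and cd: "a \<le> c" "c \<le> d" "d \<le> b" and "m \<ge> 1"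
  defines "D \<equiv> \<lambda>k. deriv_within_Icc a b k \<phi>"
  shows "((\<lambda>x. poly p (of_real x) * D m x) has_integral
     ((\<Sum>i<m. (-1)^i * (poly ((pderiv ^^ i) p) (of_real d) * D (m - 1 - i) d
                     - poly ((pderiv ^^ i) p) (of_real c) * D (m - 1 - i) c))
      + (-1)^m * integral {c..d} (\<lambda>x. poly ((pderiv ^^ m) p) (of_real x) * \<phi> x))) {c..d}"
proof -
  let ?P = "\<lambda>i x. poly ((pderiv ^^ i) p) (complex_of_real x)"
  have step: "((\<lambda>x. ?P i x * D (m - i) x) has_integral (?P i d * D (m - 1 - i) d - ?P i c * D (m - 1 - i) c
      - integral {c..d} (\<lambda>x. ?P (Suc i) x * D (m - 1 - i) x))) {c..d}" if "i < m" for i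
  proof -
    have "absolutely_continuous_on {a..b} (D (m - 1 - i))"
      unfolding D_def using that by (intro sobolev_space_absolutely_continuous_deriv[OF \<phi> ab]) simp
    from absolutely_continuous_on_by_parts[OF this ab cd, of "(pderiv ^^ i) p"]
    show ?thesis using that
      by (simp add: D_def deriv_within_Icc_Suc[symmetric] Suc_diff_Suc)
  qed
  define S where "S = (\<lambda>j. (\<Sum>i<j. (-1)^i * (?P i d * D (m - 1 - i) d - ?P i c * D (m - 1 - i) c)))"
  have "integral {c..d} (\<lambda>x. ?P 0 x * D m x) = S j + (-1)^j * integral {c..d} (\<lambda>x. ?P j x * D (m - j) x)"
    if "j \<le> m" for j
    using that
  proof (induction j)
    case 0
    then show ?case by (simp add: S_def)
  next
    case (Suc j)
    then have "integral {c..d} (\<lambda>x. ?P j x * D (m - j) x) = ?P j d * D (m - 1 - j) d - ?P j c * D (m - 1 - j) c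
      - integral {c..d} (\<lambda>x. ?P (Suc j) x * D (m - Suc j) x)"
      using step[of j] by (simp add: integral_unique)
    moreover have "integral {c..d} (\<lambda>x. ?P 0 x * D m x) = S j + (-1)^j * integral {c..d} (\<lambda>x. ?P j x * D (m - j) x)"
      using Suc by simp
    moreover have "B = s + e * (x - y) \<Longrightarrow> B = (s + e * x) + (- 1 * e) * y" for B s e x y :: complex
      by (simp add: algebra_simps)
    ultimately show ?case by (simp only: S_def sum.lessThan_Suc power_Suc)
  qed
  from this[of m] have "integral {c..d} (\<lambda>x. poly p (of_real x) * D m x) = S m + (-1)^m * integral {c..d} (\<lambda>x. ?P m x * \<phi> x)"
    by (simp add: D_def)
  moreover have "(\<lambda>x. poly p (of_real x) * D m x) integrable_on {c..d}"
    using step[of 0] \<open>m \<ge> 1\<close> by (auto simp: integrable_on_def)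
  ultimately show ?thesis unfolding S_def by (simp add: has_integral_iff)
qed

section \<open>Splines on a uniform grid\<close>

lemma funpow_pderiv_add: "(pderiv ^^ j) (p + q :: complex poly) = (pderiv ^^ j) p + (pderiv ^^ j) q"
  by (induction j arbitrary: p q) (auto simp: pderiv_add)

lemma funpow_pderiv_smult: "(pderiv ^^ j) (smult c p :: complex poly) = smult c ((pderiv ^^ j) p)"
  by (induction j arbitrary: p) (auto simp: pderiv_smult)

lemma funpow_pderiv_diff: "(pderiv ^^ j) (p - q :: complex poly) = (pderiv ^^ j) p - (pderiv ^^ j) q"
  using funpow_pderiv_add[of j p "smult (-1) q"]
  unfolding funpow_pderiv_smult by simp

lemma funpow_pderiv_pcompose_linear:
  "(pderiv ^^ j) (pcompose p [:u, v:]) = smult (v ^ j) (pcompose ((pderiv ^^ j) p) [:u, v :: complex:])"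
proof (induction j)
  case (Suc j)
  have "pderiv [:u, v:] = [:v:]" by (simp add: pderiv_pCons)
  then show ?case using Suc by (simp add: pderiv_smult pderiv_pcompose mult.commute)
qed simp

section \<open>The uniform grid, its cells, and piecewise polynomials\<close>

locale uniform_grid =
  fixes a b :: real and N :: nat
  assumes ab: "a < b" and N: "N \<ge> 1"
begin

definition h :: real where "h = (b - a) / real N"

definition node :: "nat \<Rightarrow> real" where "node \<beta> = h * real \<beta> + a"

lemma h_pos: "h > 0" using ab N by (simp add: h_def)

lemma node_0 [simp]: "node 0 = a" by (simp add: node_def)

lemma node_N [simp]: "node N = b" using N by (simp add: node_def h_def)

lemma node_Suc: "node (Suc \<beta>) = node \<beta> + h" by (simp add: node_def algebra_simps)

lemma node_le_iff [simp]: "node i \<le> node j \<longleftrightarrow> i \<le> j" using h_pos by (simp add: node_def)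

lemma node_less_iff [simp]: "node i < node j \<longleftrightarrow> i < j" using h_pos by (simp add: node_def)

lemma node_eq_iff [simp]: "node i = node j \<longleftrightarrow> i = j" using h_pos by (simp add: node_def)

lemma node_in: "\<beta> \<le> N \<Longrightarrow> node \<beta> \<in> {a..b}"
  using node_le_iff[of 0 \<beta>] node_le_iff[of \<beta> N] by simp

text \<open>The minimum puts the right end point b into the last cell.\<close>

definition cell :: "real \<Rightarrow> nat" where "cell x = min (N - 1) (nat \<lfloor>(x - a) / h\<rfloor>)"

lemma cell_less: "cell x < N" using N by (simp add: cell_def)

lemma cell_eq: assumes "\<beta> < N" "node \<beta> \<le> x" "x < node (Suc \<beta>)" shows "cell x = \<beta>"
proof -
  have "\<lfloor>(x - a) / h\<rfloor> = int \<beta>"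
    using assms h_pos by (intro floor_unique) (auto simp: node_def field_simps)
  then show ?thesis using assms by (simp add: cell_def)
qed

lemma cell_b: "cell b = N - 1"
proof -
  have "(b - a) / h = real N" using ab N by (simp add: h_def)
  then show ?thesis by (simp add: cell_def)
qed

lemma in_cell: assumes "x \<in> {a..b}" shows "x \<in> {node (cell x)..node (Suc (cell x))}"
proof (cases "x = b")
  case True
  then show ?thesis using N node_N by (auto simp: cell_b node_le_iff[of "N-1" N, simplified])
next
  case False
  define \<beta> where "\<beta> = nat \<lfloor>(x - a) / h\<rfloor>"
  have "0 \<le> (x - a) / h" using assms h_pos by simp
  then have 1: "real \<beta> \<le> (x - a) / h" "(x - a) / h < real \<beta> + 1" unfolding \<beta>_def by linarith+
  have 2: "node \<beta> \<le> x" "x < node (Suc \<beta>)" using 1 h_pos by (auto simp: node_def field_simps)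
  have "\<beta> < N" using 2 assms False node_less_iff[of \<beta> N] by simp
  with 2 have "cell x = \<beta>" by (intro cell_eq)
  with 2 show ?thesis by auto
qed

lemma has_integral_cells:
  fixes f :: "real \<Rightarrow> complex"
  assumes "\<And>\<beta>. \<beta> < N \<Longrightarrow> (f has_integral I \<beta>) {node \<beta>..node (Suc \<beta>)}"
  shows "(f has_integral (\<Sum>\<beta><N. I \<beta>)) {a..b}"
proof -
  have "(f has_integral (\<Sum>\<beta><k. I \<beta>)) {a..node k}" if "k \<le> N" for k
    using that
  proof (induction k)
    case 0
    then show ?case by (auto intro: has_integral_null_real)
  next
    case (Suc k)
    then have "(f has_integral ((\<Sum>\<beta><k. I \<beta>) + I k)) {a..node (Suc k)}"
      using node_in[of k] by (intro has_integral_combine[of a "node k"] assms) auto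
    then show ?case by simp
  qed
  from this[of N] show ?thesis by simp
qed

text \<open>At an interior node the piece to the right is evaluated. For matching pieces this choice
  is immaterial, but the definition also has to serve derivatives that jump at the nodes.\<close>

definition spline :: "(nat \<Rightarrow> complex poly) \<Rightarrow> real \<Rightarrow> complex" where
  "spline p x = poly (p (cell x)) (of_real x)"

definition matching :: "(nat \<Rightarrow> complex poly) \<Rightarrow> bool" where
  "matching p \<longleftrightarrow> (\<forall>\<beta>. Suc \<beta> < N \<longrightarrow> poly (p \<beta>) (of_real (node (Suc \<beta>))) = poly (p (Suc \<beta>)) (of_real (node (Suc \<beta>))))"

lemma spline_on_open_cell:
  assumes "\<beta> < N" "x \<in> {node \<beta><..<node (Suc \<beta>)}"
  shows "spline p x = poly (p \<beta>) (of_real x)"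
  using cell_eq[of \<beta> x] assms by (simp add: spline_def)

lemma spline_on_cell:
  assumes "matching p" "\<beta> < N" "x \<in> {node \<beta>..node (Suc \<beta>)}"
  shows "spline p x = poly (p \<beta>) (of_real x)"
proof (cases "x < node (Suc \<beta>)")
  case True
  then show ?thesis using cell_eq[of \<beta> x] assms by (simp add: spline_def)
next
  case False
  then have x: "x = node (Suc \<beta>)" using assms by auto
  show ?thesis
  proof (cases "Suc \<beta> < N")
    case True
    have "cell x = Suc \<beta>" unfolding x by (rule cell_eq[OF True]) simp_all
    then show ?thesis using assms(1) True by (simp add: spline_def matching_def x)
  next
    case False
    then have "Suc \<beta> = N" using assms by simp
    then have "x = b" using x node_N by simp
    then show ?thesis using \<open>Suc \<beta> = N\<close> cell_b by (auto simp: spline_def)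
  qed
qed

lemma cells_cover: "{a..b} = (\<Union>\<beta><N. {node \<beta>..node (Suc \<beta>)})"
proof
  show "{a..b} \<subseteq> (\<Union>\<beta><N. {node \<beta>..node (Suc \<beta>)})" using in_cell cell_less by blast
  show "(\<Union>\<beta><N. {node \<beta>..node (Suc \<beta>)}) \<subseteq> {a..b}"
  proof (rule UN_least)
    fix \<beta> assume "\<beta> \<in> {..<N}"
    then show "{node \<beta>..node (Suc \<beta>)} \<subseteq> {a..b}"
      using node_in[of \<beta>] node_in[of "Suc \<beta>"] by auto
  qed
qed

lemma continuous_on_spline: assumes "matching p" shows "continuous_on {a..b} (spline p)"
  unfolding cells_cover
proof (rule continuous_on_closed_Union)
  fix \<beta> assume "\<beta> \<in> {..<N}"
  then have "continuous_on {node \<beta>..node (Suc \<beta>)} (\<lambda>x. poly (p \<beta>) (complex_of_real x))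
      \<longleftrightarrow> continuous_on {node \<beta>..node (Suc \<beta>)} (spline p)"
    using assms by (intro continuous_on_cong) (auto simp: spline_on_cell)
  moreover have "continuous_on {node \<beta>..node (Suc \<beta>)} (\<lambda>x. poly (p \<beta>) (complex_of_real x))"
    by (intro continuous_intros)
  ultimately show "continuous_on {node \<beta>..node (Suc \<beta>)} (spline p)" by simp
qed auto

lemma spline_has_derivative_off_nodes:
  assumes "x \<in> {a..b} - node ` {..N}"
  shows "(spline p has_vector_derivative spline (\<lambda>\<beta>. pderiv (p \<beta>)) x) (at x)"
proof -
  let ?c = "cell x"
  have "x \<in> {a..b}" using assms by simp
  from in_cell[OF this] have "x \<in> {node ?c..node (Suc ?c)}" .
  moreover have "x \<noteq> node ?c" "x \<noteq> node (Suc ?c)" using assms cell_less[of x] by auto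
  ultimately have x: "x \<in> {node ?c<..<node (Suc ?c)}" by auto
  have "((\<lambda>x. poly (p ?c) (of_real x)) has_vector_derivative poly (pderiv (p ?c)) (of_real x)) (at x)"
    by (rule has_vector_derivative_real_field) (rule poly_DERIV)
  then have "(spline p has_vector_derivative poly (pderiv (p ?c)) (of_real x)) (at x)"
    by (rule has_vector_derivative_transform_within_open[OF _ open_greaterThanLessThan x])
       (simp add: spline_on_open_cell[OF cell_less])
  then show ?thesis by (simp add: spline_def)
qed

lemma spline_FTC:
  assumes "matching p" "a \<le> u" "u \<le> v" "v \<le> b"
  shows "(spline (\<lambda>\<beta>. pderiv (p \<beta>)) has_integral (spline p v - spline p u)) {u..v}"
proof (rule fundamental_theorem_of_calculus_strong[of "node ` {..N}"])
  show "continuous_on {u..v} (spline p)"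
    using continuous_on_spline[OF assms(1)] by (rule continuous_on_subset) (use assms in auto)
  show "(spline p has_vector_derivative spline (\<lambda>\<beta>. pderiv (p \<beta>)) x) (at x)"
    if "x \<in> {u..v} - node ` {..N}" for x
    using that assms by (intro spline_has_derivative_off_nodes) auto
qed (use assms in auto)

text \<open>At a node the derivative cannot be read off from a single piece. Instead the spline is
  written as a constant plus the integral of its piecewise derivative, which is continuous by the
  second matching condition.\<close>

lemma spline_has_derivative:
  assumes "matching p" "matching (\<lambda>\<beta>. pderiv (p \<beta>))" and x: "x \<in> {a..b}"
  shows "(spline p has_vector_derivative spline (\<lambda>\<beta>. pderiv (p \<beta>)) x) (at x within {a..b})"
proof -
  let ?q = "spline (\<lambda>\<beta>. pderiv (p \<beta>))"
  have "((\<lambda>u. integral {a..u} ?q) has_vector_derivative ?q x) (at x within {a..b})"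
    by (rule integral_has_vector_derivative[OF continuous_on_spline[OF assms(2)] x])
  then have "((\<lambda>u. spline p a + integral {a..u} ?q) has_vector_derivative 0 + ?q x) (at x within {a..b})"
    by (intro has_vector_derivative_add has_vector_derivative_const)
  then have "((\<lambda>u. spline p a + integral {a..u} ?q) has_vector_derivative ?q x) (at x within {a..b})" by simp
  then show ?thesis
  proof (rule has_vector_derivative_transform[rotated 2])
    fix u assume "u \<in> {a..b}"
    then have "integral {a..u} ?q = spline p u - spline p a"
      by (intro integral_unique spline_FTC[OF assms(1)]) auto
    then show "spline p u = spline p a + integral {a..u} ?q" by simp
  qed (use x in auto)
qed

lemma spline_bounded: "\<exists>M>0. \<forall>x\<in>{a..b}. cmod (spline p x) \<le> M"
proof -
  have "\<exists>B. \<forall>x\<in>{a..b}. cmod (poly (p \<beta>) (of_real x)) \<le> B" for \<beta>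
  proof -
    have "continuous_on {a..b} (\<lambda>x. poly (p \<beta>) (complex_of_real x))" by (intro continuous_intros)
    then have "bounded ((\<lambda>x. poly (p \<beta>) (complex_of_real x)) ` {a..b})"
      by (intro compact_imp_bounded compact_continuous_image) auto
    then show ?thesis by (auto simp: bounded_iff)
  qed
  then obtain B where B: "\<And>\<beta> x. x \<in> {a..b} \<Longrightarrow> cmod (poly (p \<beta>) (of_real x)) \<le> B \<beta>" by metis
  show ?thesis
  proof (intro exI[of _ "(\<Sum>\<beta><N. \<bar>B \<beta>\<bar>) + 1"] conjI ballI)
    fix x assume "x \<in> {a..b}"
    then have "cmod (spline p x) \<le> \<bar>B (cell x)\<bar>" using B[of x "cell x"] by (simp add: spline_def)
    also have "\<dots> \<le> (\<Sum>\<beta><N. \<bar>B \<beta>\<bar>)" using cell_less by (intro member_le_sum) auto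
    finally show "cmod (spline p x) \<le> (\<Sum>\<beta><N. \<bar>B \<beta>\<bar>) + 1" by simp
  qed (auto intro!: add_nonneg_pos sum_nonneg)
qed

lemma absolutely_continuous_on_spline:
  assumes "matching p" shows "absolutely_continuous_on {a..b} (spline p)"
proof -
  obtain M where M: "M > 0" "\<forall>x\<in>{a..b}. cmod (spline (\<lambda>\<beta>. pderiv (p \<beta>)) x) \<le> M"
    using spline_bounded by blast
  have le: "cmod (spline p v - spline p u) \<le> M * (v - u)" if "a \<le> u" "u \<le> v" "v \<le> b" for u v
    using has_integral_bound_real[OF less_imp_le[OF M(1)] finite.emptyI spline_FTC[OF assms that]] M(2) that by auto
  show ?thesis
  proof (rule absolutely_continuous_on_lipschitz)
    fix u v assume "u \<in> {a..b}" "v \<in> {a..b}"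
    then show "cmod (spline p v - spline p u) \<le> M * \<bar>v - u\<bar>"
      using le[of u v] le[of v u] by (cases "u \<le> v") (auto simp: norm_minus_commute)
  qed
qed

lemma spline_borel_measurable: "spline p \<in> borel_measurable borel"
proof -
  have "spline p = (\<lambda>x. \<Sum>\<beta><N. if cell x = \<beta> then poly (p \<beta>) (of_real x) else 0)"
    using cell_less by (auto simp: spline_def fun_eq_iff)
  moreover have [measurable]: "(\<lambda>x. poly (p \<beta>) (complex_of_real x)) \<in> borel_measurable borel" for \<beta>
    by (intro borel_measurable_continuous_onI continuous_intros)
  moreover have [measurable]: "Measurable.pred borel (\<lambda>x. cell x = \<beta>)" for \<beta>
    unfolding cell_def by measurable
  moreover have "(\<lambda>x. \<Sum>\<beta><N. if cell x = \<beta> then poly (p \<beta>) (complex_of_real x) else 0) \<in> borel_measurable borel"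
    by measurable
  ultimately show ?thesis by (simp only:)
qed

lemma deriv_within_Icc_spline:
  assumes "\<And>j. j < m \<Longrightarrow> matching (\<lambda>\<beta>. (pderiv ^^ j) (p \<beta>))"
  shows "k < m \<Longrightarrow> x \<in> {a..b} \<Longrightarrow> deriv_within_Icc a b k (spline p) x = spline (\<lambda>\<beta>. (pderiv ^^ k) (p \<beta>)) x"
proof (induction k arbitrary: x)
  case 0
  then show ?case by simp
next
  case (Suc k)
  have "(spline (\<lambda>\<beta>. (pderiv ^^ k) (p \<beta>)) has_vector_derivative spline (\<lambda>\<beta>. (pderiv ^^ Suc k) (p \<beta>)) x) (at x within {a..b})"
    using spline_has_derivative[of "\<lambda>\<beta>. (pderiv ^^ k) (p \<beta>)"] assms[of k] assms[of "Suc k"] Suc.prems by simp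
  then have "(deriv_within_Icc a b k (spline p) has_vector_derivative spline (\<lambda>\<beta>. (pderiv ^^ Suc k) (p \<beta>)) x) (at x within {a..b})"
    by (rule has_vector_derivative_transform[rotated 2]) (use Suc in auto)
  then show ?case
    unfolding deriv_within_Icc_Suc using vector_derivative_within_closed_interval[OF ab Suc.prems(2)] by blast
qed

lemma deriv_within_Icc_spline_off_nodes:
  assumes match: "\<And>j. j < m \<Longrightarrow> matching (\<lambda>\<beta>. (pderiv ^^ j) (p \<beta>))"
    and x: "x \<in> {a..b} - node ` {..N}" and "m \<ge> 1"
  shows "deriv_within_Icc a b m (spline p) x = spline (\<lambda>\<beta>. (pderiv ^^ m) (p \<beta>)) x"
proof -
  obtain k where m: "m = Suc k" using \<open>m \<ge> 1\<close> by (cases m) auto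
  have "(spline (\<lambda>\<beta>. (pderiv ^^ k) (p \<beta>)) has_vector_derivative spline (\<lambda>\<beta>. (pderiv ^^ Suc k) (p \<beta>)) x) (at x within {a..b})"
    using has_vector_derivative_at_within[OF spline_has_derivative_off_nodes[OF x, of "\<lambda>\<beta>. (pderiv ^^ k) (p \<beta>)"]] by simp
  then have "(deriv_within_Icc a b k (spline p) has_vector_derivative spline (\<lambda>\<beta>. (pderiv ^^ Suc k) (p \<beta>)) x) (at x within {a..b})"
    by (rule has_vector_derivative_transform[rotated 2])
       (use x m deriv_within_Icc_spline[OF match, where k = k] in auto)
  then show ?thesis unfolding m deriv_within_Icc_Suc
    using vector_derivative_within_closed_interval[OF ab] x by blast
qed

lemma AE_off_nodes: "AE x in lebesgue_on {a..b}. x \<in> {a..b} - node ` {..N}"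
proof -
  have "negligible (node ` {..N})" by (intro negligible_finite) simp
  then have "AE x in lebesgue. x \<notin> node ` {..N}"
    by (intro AE_not_in) (simp add: negligible_iff_null_sets)
  then show ?thesis by (subst AE_restrict_space_iff) (auto elim: eventually_mono)
qed

text \<open>At the nodes the m-th derivative need not exist and its value is unspecified. It
  therefore equals a piecewise polynomial corrected at finitely many points, and the correction is
  written as a finite sum of indicators.\<close>

lemma measurable_deriv_within_Icc_spline:
  assumes match: "\<And>j. j < m \<Longrightarrow> matching (\<lambda>\<beta>. (pderiv ^^ j) (p \<beta>))" and "m \<ge> 1"
  shows "deriv_within_Icc a b m (spline p) \<in> borel_measurable (lebesgue_on {a..b})"
proof -
  let ?D = "deriv_within_Icc a b m (spline p)" and ?s = "spline (\<lambda>\<beta>. (pderiv ^^ m) (p \<beta>))"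
  have s: "?s \<in> borel_measurable lebesgue"
    by (intro measurable_completion) (simp add: spline_borel_measurable)
  have "(\<lambda>x. ?s x + (\<Sum>t\<in>node ` {..N}. indicator {t} x * (?D t - ?s t))) \<in> borel_measurable lebesgue"
    by (intro borel_measurable_add s borel_measurable_sum borel_measurable_times borel_measurable_const borel_measurable_indicator) auto
  then have "(\<lambda>x. ?s x + (\<Sum>t\<in>node ` {..N}. indicator {t} x * (?D t - ?s t))) \<in> borel_measurable (lebesgue_on {a..b})"
    by (rule measurable_restrict_space1)
  moreover have "?s x + (\<Sum>t\<in>node ` {..N}. indicator {t} x * (?D t - ?s t)) = ?D x" if "x \<in> {a..b}" for x
  proof -
    have "(\<Sum>t\<in>node ` {..N}. indicator {t} x * (?D t - ?s t)) = (\<Sum>t\<in>node ` {..N}. if t = x then ?D x - ?s x else 0)"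
      by (intro sum.cong) auto
    also have "\<dots> = (if x \<in> node ` {..N} then ?D x - ?s x else 0)" by (simp add: sum.delta')
    finally show ?thesis using deriv_within_Icc_spline_off_nodes[OF match, where x = x] that \<open>m \<ge> 1\<close> by auto
  qed
  ultimately show ?thesis by (subst measurable_cong[symmetric]) auto
qed

end

section \<open>Sobolev norms of splines and the pairing with natural splines\<close>

lemma absolutely_continuous_on_cong:
  assumes "\<And>x. x \<in> S \<Longrightarrow> f x = g x" "absolutely_continuous_on S g"
  shows "absolutely_continuous_on S f"
  by (rule absolutely_continuous_on_dominated[OF assms(2) assms(2), of 1 1]) (auto simp: assms(1))

text \<open>Cauchy-Schwarz, transferred from nonnegative integrals. If the product is not
  integrable, its integral is 0 by convention.\<close>

lemma cmod_integral_mult_le: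
  fixes f g :: "'a \<Rightarrow> complex"
  assumes [measurable]: "f \<in> borel_measurable M" "g \<in> borel_measurable M"
    and f: "integrable M (\<lambda>x. (cmod (f x))\<^sup>2)" and g: "integrable M (\<lambda>x. (cmod (g x))\<^sup>2)"
  shows "(cmod (LINT x|M. f x * g x))\<^sup>2 \<le> (LINT x|M. (cmod (f x))\<^sup>2) * (LINT x|M. (cmod (g x))\<^sup>2)"
proof (cases "integrable M (\<lambda>x. f x * g x)")
  case True
  have "ennreal (cmod (LINT x|M. f x * g x)) \<le> (\<integral>\<^sup>+x. ennreal (cmod (f x)) * ennreal (cmod (g x)) \<partial>M)"
    using integral_norm_bound_ennreal[OF True] by (simp add: norm_mult ennreal_mult)
  then have "(ennreal (cmod (LINT x|M. f x * g x)))\<^sup>2 \<le> (\<integral>\<^sup>+x. ennreal (cmod (f x)) * ennreal (cmod (g x)) \<partial>M)\<^sup>2"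
    by (rule power_mono) simp
  also have "\<dots> \<le> (\<integral>\<^sup>+x. (ennreal (cmod (f x)))\<^sup>2 \<partial>M) * (\<integral>\<^sup>+x. (ennreal (cmod (g x)))\<^sup>2 \<partial>M)"
    by (rule Cauchy_Schwarz_nn_integral) auto
  also have "\<dots> = ennreal (LINT x|M. (cmod (f x))\<^sup>2) * ennreal (LINT x|M. (cmod (g x))\<^sup>2)"
    using f g by (simp add: ennreal_power nn_integral_eq_integral)
  finally show ?thesis
    by (simp add: ennreal_power integral_nonneg_AE flip: ennreal_mult)
next
  case False
  then show ?thesis by (simp add: not_integrable_integral_eq integral_nonneg_AE)
qed

text \<open>Here \<open>f \<beta> \<gamma>\<close> stands for a boundary term of the piece on cell
  \<open>\<beta>\<close>, taken at node \<open>\<gamma>\<close>. Regrouping by nodes turns the two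
  contributions at an interior node into a jump.\<close>

lemma sum_cells_by_parts:
  fixes f :: "nat \<Rightarrow> nat \<Rightarrow> complex"
  assumes "N \<ge> 1"
  shows "(\<Sum>\<beta><N. f \<beta> (Suc \<beta>) - f \<beta> \<beta>) = f (N-1) N - f 0 0 + (\<Sum>\<beta>=1..N-1. f (\<beta>-1) \<beta> - f \<beta> \<beta>)"
proof -
  have "(\<Sum>\<beta><Suc n. f \<beta> (Suc \<beta>) - f \<beta> \<beta>) = f n (Suc n) - f 0 0 + (\<Sum>\<beta>=1..n. f (\<beta>-1) \<beta> - f \<beta> \<beta>)" for n
    by (induction n) (auto simp: sum.nat_ivl_Suc')
  from this[of "N-1"] assms show ?thesis by simp
qed

context uniform_grid begin

lemma finite_measure_Icc: "finite_measure (lebesgue_on {a..b})"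
  by (rule finite_measure_lebesgue_on) simp

lemma spline_measurable_lebesgue [measurable]: "spline p \<in> borel_measurable (lebesgue_on {a..b})"
  by (intro measurable_restrict_space1 measurable_completion) (simp add: spline_borel_measurable)

lemma integrable_bounded:
  assumes "f \<in> borel_measurable (lebesgue_on {a..b})" "\<And>x. x \<in> {a..b} \<Longrightarrow> norm (f x) \<le> B"
  shows "integrable (lebesgue_on {a..b}) (f :: real \<Rightarrow> 'c::{banach,second_countable_topology})"
  by (rule finite_measure.integrable_const_bound[OF finite_measure_Icc, of _ B])
     (use assms in \<open>auto intro!: AE_I2\<close>)

lemma integrable_spline_mult: "integrable (lebesgue_on {a..b}) (\<lambda>x. spline p x * cnj (spline r x))"
proof -
  obtain A B where A: "A > 0" "\<forall>x\<in>{a..b}. cmod (spline p x) \<le> A" and B: "B > 0" "\<forall>x\<in>{a..b}. cmod (spline r x) \<le> B"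
    using spline_bounded by meson
  have "(\<lambda>x. spline p x * cnj (spline r x)) \<in> borel_measurable (lebesgue_on {a..b})"
    using borel_measurable_continuous_on[OF continuous_on_cnj[OF continuous_on_id, of UNIV] spline_measurable_lebesgue[of r]]
    by measurable
  then show ?thesis
  proof (rule integrable_bounded[of _ "A * B"])
    fix x assume "x \<in> {a..b}"
    then show "norm (spline p x * cnj (spline r x)) \<le> A * B"
      using A B by (auto simp: norm_mult intro!: mult_mono)
  qed
qed

lemma integrable_spline: "integrable (lebesgue_on {a..b}) (spline p)"
  using spline_bounded[of p] by (auto intro: integrable_bounded)

lemma integrable_norm_spline_power2: "integrable (lebesgue_on {a..b}) (\<lambda>x. (cmod (spline p x))\<^sup>2)"
  using integrable_norm[OF integrable_spline_mult[of p p]] by (simp add: norm_mult power2_eq_square)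

lemma spline_const [simp]: "spline (\<lambda>_. p) x = poly p (of_real x)" by (simp add: spline_def)

definition smooth_pieces :: "nat \<Rightarrow> (nat \<Rightarrow> complex poly) \<Rightarrow> bool" where
  "smooth_pieces n p \<longleftrightarrow> (\<forall>j<n. matching (\<lambda>\<beta>. (pderiv ^^ j) (p \<beta>)))"

abbreviation pieces_deriv :: "nat \<Rightarrow> (nat \<Rightarrow> complex poly) \<Rightarrow> nat \<Rightarrow> complex poly" where
  "pieces_deriv m p \<equiv> (\<lambda>\<beta>. (pderiv ^^ m) (p \<beta>))"

lemma smooth_pieces_const: "smooth_pieces n (\<lambda>_. p)" by (simp add: smooth_pieces_def matching_def)

lemma smooth_pieces_lincomb:
  assumes "smooth_pieces n p" "smooth_pieces n r"
  shows "smooth_pieces n (\<lambda>\<beta>. p \<beta> + smult c (r \<beta>))"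
  using assms by (auto simp: smooth_pieces_def matching_def funpow_pderiv_add funpow_pderiv_smult)

lemma spline_lincomb: "spline (\<lambda>\<beta>. p \<beta> + smult c (r \<beta>)) x = spline p x + c * spline r x"
  by (simp add: spline_def)

lemma deriv_spline_AE:
  assumes "smooth_pieces m p" "m \<ge> 1"
  shows "AE x in lebesgue_on {a..b}. deriv_within_Icc a b m (spline p) x = spline (pieces_deriv m p) x"
  using AE_off_nodes
  by eventually_elim (use assms deriv_within_Icc_spline_off_nodes[of m p] in \<open>auto simp: smooth_pieces_def\<close>)

lemma deriv_spline_measurable:
  assumes "smooth_pieces m p" "m \<ge> 1"
  shows "deriv_within_Icc a b m (spline p) \<in> borel_measurable (lebesgue_on {a..b})"
  using assms by (intro measurable_deriv_within_Icc_spline) (auto simp: smooth_pieces_def)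

lemma spline_in_sobolev_space:
  assumes p: "smooth_pieces m p" and m: "m \<ge> 1"
  shows "spline p \<in> sobolev_space m a b"
proof -
  have match: "\<And>j. j < m \<Longrightarrow> matching (pieces_deriv j p)" using p by (simp add: smooth_pieces_def)
  have "deriv_within_Icc a b k (spline p) differentiable_on {a..b}" if k: "k < m - 1" for k
    unfolding differentiable_on_def
  proof
    fix x assume x: "x \<in> {a..b}"
    have "(spline (pieces_deriv k p) has_vector_derivative spline (pieces_deriv (Suc k) p) x) (at x within {a..b})"
      using spline_has_derivative[of "pieces_deriv k p" x] match[of k] match[of "Suc k"] k x by simp
    then have "(deriv_within_Icc a b k (spline p) has_vector_derivative spline (pieces_deriv (Suc k) p) x) (at x within {a..b})"
      by (rule has_vector_derivative_transform[rotated 2])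
         (use x k deriv_within_Icc_spline[OF match, where k = k] in auto)
    then show "deriv_within_Icc a b k (spline p) differentiable at x within {a..b}"
      by (rule differentiableI_vector)
  qed
  moreover have "absolutely_continuous_on {a..b} (deriv_within_Icc a b (m - 1) (spline p))"
    using m match deriv_within_Icc_spline[OF match, where k = "m - 1"]
    by (intro absolutely_continuous_on_cong[OF _ absolutely_continuous_on_spline[of "pieces_deriv (m-1) p"]]) auto
  moreover have "integrable (lebesgue_on {a..b}) (\<lambda>x. (cmod (deriv_within_Icc a b m (spline p) x))\<^sup>2)"
  proof (subst integrable_cong_AE)
    show "AE x in lebesgue_on {a..b}. (cmod (deriv_within_Icc a b m (spline p) x))\<^sup>2 = (cmod (spline (pieces_deriv m p) x))\<^sup>2"
      using deriv_spline_AE[OF p m] by eventually_elim simp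
    show "integrable (lebesgue_on {a..b}) (\<lambda>x. (cmod (spline (pieces_deriv m p) x))\<^sup>2)"
      by (rule integrable_norm_spline_power2)
  qed (use deriv_spline_measurable[OF p m] in measurable)
  ultimately show ?thesis
    using deriv_spline_measurable[OF p m] by (auto simp: sobolev_space_def)
qed

lemma sobolev_inner_self:
  "sobolev_inner m a b \<phi> \<phi> = of_real (LINT x|lebesgue_on {a..b}. (cmod (deriv_within_Icc a b m \<phi> x))\<^sup>2)"
  unfolding sobolev_inner_def by (simp only: complex_norm_square[symmetric] integral_complex_of_real)

lemma sobolev_norm_power2:
  "(sobolev_norm m a b \<phi>)\<^sup>2 = (LINT x|lebesgue_on {a..b}. (cmod (deriv_within_Icc a b m \<phi> x))\<^sup>2)"
  by (simp add: sobolev_norm_def sobolev_inner_self integral_nonneg_AE)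

lemma sobolev_norm_nonneg: "sobolev_norm m a b \<phi> \<ge> 0"
  by (simp add: sobolev_norm_def sobolev_inner_self integral_nonneg_AE)

lemma sobolev_norm_spline:
  assumes p: "smooth_pieces m p" and m: "m \<ge> 1"
  shows "(sobolev_norm m a b (spline p))\<^sup>2 = (LINT x|lebesgue_on {a..b}. (cmod (spline (pieces_deriv m p) x))\<^sup>2)"
  unfolding sobolev_norm_power2
proof (rule integral_cong_AE)
  show "AE x in lebesgue_on {a..b}. (cmod (deriv_within_Icc a b m (spline p) x))\<^sup>2 = (cmod (spline (pieces_deriv m p) x))\<^sup>2"
    using deriv_spline_AE[OF p m] by eventually_elim simp
qed (use deriv_spline_measurable[OF p m] in measurable)

lemma sobolev_norm_spline_smult:
  assumes p: "smooth_pieces m p" and m: "m \<ge> 1"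
  shows "sobolev_norm m a b (spline (\<lambda>\<beta>. smult c (p \<beta>))) = cmod c * sobolev_norm m a b (spline p)"
proof -
  have "smooth_pieces m (\<lambda>\<beta>. smult c (p \<beta>))"
    using p by (auto simp: smooth_pieces_def matching_def funpow_pderiv_smult)
  from sobolev_norm_spline[OF this m]
  have "(sobolev_norm m a b (spline (\<lambda>\<beta>. smult c (p \<beta>))))\<^sup>2 = (cmod c * sobolev_norm m a b (spline p))\<^sup>2"
    by (simp add: funpow_pderiv_smult spline_def norm_mult power_mult_distrib sobolev_norm_spline[OF p m])
  then show ?thesis using sobolev_norm_nonneg by (simp add: power2_eq_iff_nonneg)
qed

text \<open>The coefficients C are the jumps of the derivative of order 2m-1, the spline being continued
  outside [a,b] by polynomials of degree less than m.\<close>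

definition natural_spline :: "nat \<Rightarrow> complex \<Rightarrow> (nat \<Rightarrow> complex poly) \<Rightarrow> (nat \<Rightarrow> complex) \<Rightarrow> bool" where
  "natural_spline m c p C \<longleftrightarrow> smooth_pieces (2 * m - 1) p \<and>
     (\<forall>j\<in>{m..<2 * m - 1}. poly ((pderiv ^^ j) (p 0)) (of_real a) = 0 \<and> poly ((pderiv ^^ j) (p (N - 1))) (of_real b) = 0) \<and>
     (\<forall>\<beta><N. (pderiv ^^ (2 * m)) (p \<beta>) = [:c:]) \<and>
     C 0 = - poly ((pderiv ^^ (2 * m - 1)) (p 0)) (of_real a) \<and>
     C N = poly ((pderiv ^^ (2 * m - 1)) (p (N - 1))) (of_real b) \<and>
     (\<forall>\<beta>\<in>{1..N - 1}. C \<beta> = poly ((pderiv ^^ (2 * m - 1)) (p (\<beta> - 1))) (of_real (node \<beta>))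
                     - poly ((pderiv ^^ (2 * m - 1)) (p \<beta>)) (of_real (node \<beta>)))"

lemma sum_nodes_split: "(\<Sum>\<beta>=0..N. g \<beta>) = g 0 + g N + (\<Sum>\<beta>=1..N-1. g \<beta>)" for g :: "nat \<Rightarrow> complex"
proof -
  obtain n where n: "N = Suc n" using N by (cases N) auto
  have "(\<Sum>\<beta>=0..N. g \<beta>) = g 0 + (\<Sum>\<beta>=1..Suc n. g \<beta>)" unfolding n by (simp add: sum.atLeast_Suc_atMost)
  then show ?thesis by (simp add: n)
qed

text \<open>Integration by parts on every cell, with the boundary terms regrouped by nodes. The
  terms with spline derivatives of orders m, ..., 2m-2 cancel inside by smoothness and vanish at the
  ends by the boundary conditions; order 2m-1 leaves the jumps, which are the numbers
  \<open>C \<beta>\<close>. The sign in front of \<open>C\<close> comes from (-1)^(m-1) =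
  -(-1)^m.\<close>

lemma natural_spline_pairing:
  assumes p: "natural_spline m c p C" and m: "m \<ge> 1" and \<phi>: "\<phi> \<in> sobolev_space m a b"
  shows "(LINT x|lebesgue_on {a..b}. spline (pieces_deriv m p) x * deriv_within_Icc a b m \<phi> x)
     = (-1)^m * (c * (LINT x|lebesgue_on {a..b}. \<phi> x) - (\<Sum>\<beta>=0..N. C \<beta> * \<phi> (node \<beta>)))"
proof -
  let ?M = "lebesgue_on {a..b}"
  let ?D = "\<lambda>k. deriv_within_Icc a b k \<phi>"
  define A where "A = (\<lambda>i \<beta> \<gamma>. poly ((pderiv ^^ (m + i)) (p \<beta>)) (of_real (node \<gamma>)) * ?D (m - 1 - i) (node \<gamma>))"
  define J where "J = (\<lambda>\<beta>. integral {node \<beta>..node (Suc \<beta>)} \<phi>)"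
  have cont: "continuous_on {a..b} \<phi>"
    using absolutely_continuous_on_imp_continuous_on[OF sobolev_space_absolutely_continuous_deriv[OF \<phi> ab, of 0]] m by simp
  have cell: "(((\<lambda>x. spline (pieces_deriv m p) x * ?D m x) has_integral
      (\<Sum>i<m. (-1)^i * (A i \<beta> (Suc \<beta>) - A i \<beta> \<beta>)) + (-1)^m * (c * J \<beta>)) {node \<beta>..node (Suc \<beta>)})" if \<beta>: "\<beta> < N" for \<beta>
  proof -
    have "a \<le> node \<beta>" "node \<beta> \<le> node (Suc \<beta>)" "node (Suc \<beta>) \<le> b"
      using node_in[of \<beta>] node_in[of "Suc \<beta>"] \<beta> by auto
    from sobolev_poly_integral[OF \<phi> ab this m, of "(pderiv ^^ m) (p \<beta>)"]
    have "((\<lambda>x. poly ((pderiv ^^ m) (p \<beta>)) (of_real x) * ?D m x) has_integral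
      (\<Sum>i<m. (-1)^i * (A i \<beta> (Suc \<beta>) - A i \<beta> \<beta>)) + (-1)^m * (c * J \<beta>)) {node \<beta>..node (Suc \<beta>)}"
      using p \<beta> by (simp add: A_def J_def natural_spline_def funpow_add[symmetric, THEN fun_cong, unfolded o_apply] add.commute mult_2)
    then show ?thesis
      by (rule has_integral_spike[rotated 2, where S = "{node \<beta>, node (Suc \<beta>)}"])
         (use \<beta> in \<open>auto simp: spline_on_open_cell\<close>)
  qed
  have "(\<Sum>\<beta><N. J \<beta>) = integral {a..b} \<phi>"
  proof -
    have "(\<phi> has_integral (\<Sum>\<beta><N. J \<beta>)) {a..b}"
    proof (rule has_integral_cells)
      fix \<beta> assume "\<beta> < N"
      then have "{node \<beta>..node (Suc \<beta>)} \<subseteq> {a..b}" using node_in[of \<beta>] node_in[of "Suc \<beta>"] by auto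
      then show "(\<phi> has_integral J \<beta>) {node \<beta>..node (Suc \<beta>)}" unfolding J_def
        by (intro integrable_integral integrable_continuous_real continuous_on_subset[OF cont])
    qed
    then show ?thesis by (simp add: integral_unique)
  qed
  also have "integral {a..b} \<phi> = (LINT x|?M. \<phi> x)"
    using cont by (intro lebesgue_integral_eq_integral[symmetric] continuous_imp_integrable_real) auto
  finally have J: "(\<Sum>\<beta><N. J \<beta>) = (LINT x|?M. \<phi> x)" .
  have inner0: "(\<Sum>\<beta><N. A i \<beta> (Suc \<beta>) - A i \<beta> \<beta>) = 0" if i: "i < m - 1" for i
  proof -
    have "A i (N - 1) N = 0" "A i 0 0 = 0"
      using p i unfolding A_def natural_spline_def by auto
    moreover have "A i (\<beta> - 1) \<beta> - A i \<beta> \<beta> = 0" if "\<beta> \<in> {1..N-1}" for \<beta>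
    proof -
      have "matching (pieces_deriv (m + i) p)" using p i by (auto simp: natural_spline_def smooth_pieces_def)
      then have "poly ((pderiv ^^ (m + i)) (p (\<beta> - 1))) (of_real (node \<beta>)) = poly ((pderiv ^^ (m + i)) (p \<beta>)) (of_real (node \<beta>))"
        unfolding matching_def using that by (auto dest!: spec[of _ "\<beta> - 1"])
      then show ?thesis by (simp add: A_def)
    qed
    ultimately show ?thesis unfolding sum_cells_by_parts[OF N] by simp
  qed
  have outer: "(\<Sum>\<beta><N. A (m-1) \<beta> (Suc \<beta>) - A (m-1) \<beta> \<beta>) = (\<Sum>\<beta>=0..N. C \<beta> * \<phi> (node \<beta>))"
  proof -
    have e: "m + (m - 1) = 2 * m - 1" using m by simp
    have "A (m-1) (\<beta> - 1) \<beta> - A (m-1) \<beta> \<beta> = C \<beta> * \<phi> (node \<beta>)" if "\<beta> \<in> {1..N-1}" for \<beta>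
    proof -
      have "C \<beta> = poly ((pderiv ^^ (2 * m - 1)) (p (\<beta> - 1))) (of_real (node \<beta>))
                     - poly ((pderiv ^^ (2 * m - 1)) (p \<beta>)) (of_real (node \<beta>))"
        using p that unfolding natural_spline_def by blast
      then show ?thesis unfolding A_def e by (simp add: left_diff_distrib)
    qed
    moreover have "A (m-1) (N-1) N = C N * \<phi> (node N)" "A (m-1) 0 0 = - C 0 * \<phi> (node 0)"
      using p unfolding A_def e natural_spline_def by auto
    ultimately show ?thesis unfolding sum_cells_by_parts[OF N] sum_nodes_split by simp
  qed
  have "((\<lambda>x. spline (pieces_deriv m p) x * ?D m x) has_integral
      (\<Sum>\<beta><N. (\<Sum>i<m. (-1)^i * (A i \<beta> (Suc \<beta>) - A i \<beta> \<beta>)) + (-1)^m * (c * J \<beta>))) {a..b}"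
    by (rule has_integral_cells[OF cell])
  also have "(\<Sum>\<beta><N. (\<Sum>i<m. (-1)^i * (A i \<beta> (Suc \<beta>) - A i \<beta> \<beta>)) + (-1)^m * (c * J \<beta>))
     = (\<Sum>i<m. (-1)^i * (\<Sum>\<beta><N. A i \<beta> (Suc \<beta>) - A i \<beta> \<beta>)) + (-1)^m * (c * (\<Sum>\<beta><N. J \<beta>))"
    by (simp add: sum.distrib sum_distrib_left sum.swap[of _ "{..<N}"])
  also have "(\<Sum>i<m. (-1)^i * (\<Sum>\<beta><N. A i \<beta> (Suc \<beta>) - A i \<beta> \<beta>)) = (-1)^(m-1) * (\<Sum>\<beta>=0..N. C \<beta> * \<phi> (node \<beta>))"
  proof -
    obtain n where n: "m = Suc n" using m by (cases m) auto
    show ?thesis using inner0 outer unfolding n by simp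
  qed
  also have "\<dots> + (-1)^m * (c * (\<Sum>\<beta><N. J \<beta>)) = (-1)^m * (c * (LINT x|?M. \<phi> x) - (\<Sum>\<beta>=0..N. C \<beta> * \<phi> (node \<beta>)))"
    using m unfolding J by (cases m) (auto simp: algebra_simps)
  finally have HK: "((\<lambda>x. spline (pieces_deriv m p) x * ?D m x) has_integral
      (-1)^m * (c * (LINT x|?M. \<phi> x) - (\<Sum>\<beta>=0..N. C \<beta> * \<phi> (node \<beta>)))) {a..b}" .
  have Dm: "?D m \<in> borel_measurable ?M" "integrable ?M (\<lambda>x. (cmod (?D m x))\<^sup>2)"
    using \<phi> by (auto simp: sobolev_space_def)
  obtain B where B: "B > 0" "\<forall>x\<in>{a..b}. cmod (spline (pieces_deriv m p) x) \<le> B" using spline_bounded by blast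
  \<comment> \<open>The value found so far is a gauge integral. It is the Lebesgue integral once the
    product is integrable, and this follows from t <= 1 + t^2, since the square of the m-th
    derivative is integrable.\<close>
  have "integrable ?M (\<lambda>x. B * (1 + (cmod (?D m x))\<^sup>2))"
    by (intro integrable_mult_right Bochner_Integration.integrable_add Dm finite_measure.integrable_const[OF finite_measure_Icc])
  then have "integrable ?M (\<lambda>x. spline (pieces_deriv m p) x * ?D m x)"
  proof (rule Bochner_Integration.integrable_bound)
    show "(\<lambda>x. spline (pieces_deriv m p) x * ?D m x) \<in> borel_measurable ?M" using Dm(1) by measurable
    show "AE x in ?M. norm (spline (pieces_deriv m p) x * ?D m x) \<le> norm (B * (1 + (cmod (?D m x))\<^sup>2))"
    proof (rule AE_I2)
      fix x assume "x \<in> space ?M"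
      then have x: "x \<in> {a..b}" by simp
      have "cmod (?D m x) \<le> 1 + (cmod (?D m x))\<^sup>2"
        using sum_squares_ge_zero[of "cmod (?D m x) - 1" 0] zero_le_power2[of "cmod (?D m x) - 1/2"]
        by (simp add: power2_eq_square algebra_simps)
      then have "cmod (spline (pieces_deriv m p) x) * cmod (?D m x) \<le> B * (1 + (cmod (?D m x))\<^sup>2)"
        using B x by (intro mult_mono) auto
      then show "norm (spline (pieces_deriv m p) x * ?D m x) \<le> norm (B * (1 + (cmod (?D m x))\<^sup>2))"
        using B(1) by (simp add: norm_mult)
    qed
  qed
  from lebesgue_integral_eq_integral[OF this] integral_unique[OF HK] show ?thesis by simp
qed

end

section \<open>Optimality of natural splines\<close>

context uniform_grid begin

lemma error_functional_node:
  "error_functional N a b C \<phi> = (LINT x|lebesgue_on {a..b}. \<phi> x) - (\<Sum>\<beta>=0..N. C \<beta> * \<phi> (node \<beta>))"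
  by (simp add: error_functional_def node_def h_def)

lemma error_functional_spline_lincomb:
  "error_functional N a b C (spline (\<lambda>\<beta>. p \<beta> + smult t (r \<beta>)))
     = error_functional N a b C (spline p) + t * error_functional N a b C (spline r)"
proof -
  have "(LINT x|lebesgue_on {a..b}. spline p x + t * spline r x)
      = (LINT x|lebesgue_on {a..b}. spline p x) + t * (LINT x|lebesgue_on {a..b}. spline r x)"
    by (subst Bochner_Integration.integral_add) (auto simp: integrable_spline)
  then show ?thesis
    unfolding error_functional_node spline_lincomb
    by (simp add: algebra_simps sum.distrib sum_distrib_left)
qed

lemma error_functional_spline_smult:
  "error_functional N a b C (spline (\<lambda>\<beta>. smult t (r \<beta>))) = t * error_functional N a b C (spline r)"
  using error_functional_spline_lincomb[of C "\<lambda>_. 0" t r] by (simp add: error_functional_node)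

text \<open>Homogeneity, used on splines only. A spline of norm 0 stays in the unit ball under every
  scaling, so a finite error norm forces the functional to vanish on it.\<close>

lemma error_functional_le_error_norm:
  assumes p: "smooth_pieces m p" and m: "m \<ge> 1" and C: "error_norm m N a b C \<le> ereal \<nu>"
  shows "cmod (error_functional N a b C (spline p)) \<le> \<nu> * sobolev_norm m a b (spline p)"
proof -
  have unit: "cmod (t * error_functional N a b C (spline p)) \<le> \<nu>"
    if t: "cmod t * sobolev_norm m a b (spline p) \<le> 1" for t
  proof -
    have "smooth_pieces m (\<lambda>\<beta>. smult t (p \<beta>))"
      using p by (auto simp: smooth_pieces_def matching_def funpow_pderiv_smult)
    then have "spline (\<lambda>\<beta>. smult t (p \<beta>)) \<in> {\<phi> \<in> sobolev_space m a b. sobolev_norm m a b \<phi> \<le> 1}"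
      using t spline_in_sobolev_space[OF _ m] by (simp add: sobolev_norm_spline_smult[OF p m])
    then have "ereal (cmod (error_functional N a b C (spline (\<lambda>\<beta>. smult t (p \<beta>))))) \<le> error_norm m N a b C"
      unfolding error_norm_def by (rule SUP_upper)
    with C have "ereal (cmod (error_functional N a b C (spline (\<lambda>\<beta>. smult t (p \<beta>))))) \<le> ereal \<nu>"
      by (rule order.trans[rotated])
    then show ?thesis by (simp add: error_functional_spline_smult)
  qed
  let ?n = "sobolev_norm m a b (spline p)" and ?E = "cmod (error_functional N a b C (spline p))"
  show ?thesis
  proof (cases "?n = 0")
    case True
    have "?E \<le> 0"
    proof (rule ccontr)
      assume "\<not> ?E \<le> 0"
      then obtain k :: nat where "real k * ?E > \<nu>" using reals_Archimedean3[of ?E] by force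
      moreover have "cmod (of_nat k * error_functional N a b C (spline p)) \<le> \<nu>"
        using True by (intro unit) simp
      ultimately show False by (simp add: norm_mult)
    qed
    then show ?thesis using True by simp
  next
    case False
    then have n: "?n > 0" using sobolev_norm_nonneg[of m "spline p"] by simp
    have "cmod (of_real (1 / ?n) * error_functional N a b C (spline p)) \<le> \<nu>"
      using n by (intro unit) (simp add: norm_divide)
    then show ?thesis using n by (simp add: norm_mult norm_divide field_simps)
  qed
qed

lemma error_norm_nonneg: "m \<ge> 1 \<Longrightarrow> 0 \<le> error_norm m N a b C"
proof -
  assume m: "m \<ge> 1"
  have "spline (\<lambda>_. 0) \<in> sobolev_space m a b"
    by (rule spline_in_sobolev_space[OF smooth_pieces_const m])
  moreover have "sobolev_norm m a b (spline (\<lambda>_. 0)) = 0"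
    using sobolev_norm_spline_smult[OF smooth_pieces_const[of m 0] m, of 0] by simp
  ultimately have "ereal (cmod (error_functional N a b C (spline (\<lambda>_. 0)))) \<le> error_norm m N a b C"
    unfolding error_norm_def by (intro SUP_upper CollectI conjI) (simp_all only: zero_le_one)
  then show ?thesis by (simp add: error_functional_node zero_ereal_def)
qed

lemma integral_norm_lincomb:
  "(LINT x|lebesgue_on {a..b}. (cmod (spline p x + t * spline r x))\<^sup>2)
    = (LINT x|lebesgue_on {a..b}. (cmod (spline p x))\<^sup>2)
      + 2 * Re (t * (LINT x|lebesgue_on {a..b}. spline r x * cnj (spline p x)))
      + (cmod t)\<^sup>2 * (LINT x|lebesgue_on {a..b}. (cmod (spline r x))\<^sup>2)"
proof -
  let ?M = "lebesgue_on {a..b}"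
  have pt: "(cmod (z + t * w))\<^sup>2 = (cmod z)\<^sup>2 + 2 * Re (t * (w * cnj z)) + (cmod t)\<^sup>2 * (cmod w)\<^sup>2" for z w
    unfolding cmod_power2 by (simp add: power2_eq_square algebra_simps)
  have i: "integrable ?M (\<lambda>x. t * (spline r x * cnj (spline p x)))"
    by (intro integrable_mult_right integrable_spline_mult)
  define g where "g x = Re (t * (spline r x * cnj (spline p x)))" for x
  have g: "integrable ?M g" unfolding g_def[abs_def] using i by (rule integrable_Re)
  have "(LINT x|?M. g x) = Re (t * (LINT x|?M. spline r x * cnj (spline p x)))"
    unfolding g_def using i by (subst integral_Re) auto
  then show ?thesis
    unfolding pt g_def[symmetric] by (simp add: integrable_norm_spline_power2 g)
qed

text \<open>First variation: the inequality is an equality at t = 0, so the terms linear in t must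
  agree on both sides.\<close>

lemma quadratic_perturbation_bound:
  assumes H: "\<And>t :: complex. (cmod (of_real (s * n) + t * A))\<^sup>2 \<le> n * (n + 2 * Re (t * B) + (cmod t)\<^sup>2 * K)"
    and s: "s * s = (1 :: real)" and n: "n > 0" and K: "K \<ge> 0"
  shows "A = of_real s * B"
proof (rule ccontr)
  assume ne: "A \<noteq> of_real s * B"
  define w where "w = of_real s * A - B"
  have w: "w \<noteq> 0"
  proof
    assume "w = 0"
    then have "of_real s * (of_real s * A) = of_real s * B" by (simp add: w_def)
    then have "of_real (s * s) * A = of_real s * B" by (simp add: mult.assoc)
    with ne s show False by simp
  qed
  \<comment> \<open>With \<open>t = of_real e * cnj w\<close> the linear terms give 2 e |w|^2
    against e^2 |w|^2 K, which is impossible when e K < 1.\<close>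
  define e where "e = 1 / (K + 1)"
  have e: "e > 0" "e * K < 1" using K by (auto simp: e_def field_simps)
  define t where "t = of_real e * cnj w"
  have "(cmod (of_real (s * n) + t * A))\<^sup>2 = n\<^sup>2 + 2 * n * Re (t * (of_real s * A)) + (cmod (t * A))\<^sup>2"
  proof -
    have "(cmod (of_real r + z))\<^sup>2 = r\<^sup>2 + 2 * r * Re z + (cmod z)\<^sup>2" for r z
      unfolding cmod_power2 by (simp add: power2_eq_square algebra_simps)
    moreover have "(s * n)\<^sup>2 = n\<^sup>2" using s by (simp add: power2_eq_square)
    moreover have "2 * (s * n) * Re (t * A) = 2 * n * Re (t * (of_real s * A))" by (simp add: algebra_simps)
    ultimately show ?thesis by (simp only:)
  qed
  with H[of t] have "2 * n * Re (t * (of_real s * A)) \<le> n * (2 * Re (t * B) + (cmod t)\<^sup>2 * K)"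
    by (simp add: power2_eq_square algebra_simps) (smt (verit) mult_nonneg_nonneg norm_ge_zero)
  then have "2 * Re (t * (of_real s * A)) \<le> 2 * Re (t * B) + (cmod t)\<^sup>2 * K"
    using n by (simp add: mult.assoc mult.left_commute[of 2])
  then have "2 * Re (t * w) \<le> (cmod t)\<^sup>2 * K" by (simp add: w_def right_diff_distrib)
  moreover have "Re (t * w) = e * (cmod w)\<^sup>2"
    unfolding cmod_power2 by (simp add: t_def power2_eq_square algebra_simps)
  moreover have "(cmod t)\<^sup>2 = e\<^sup>2 * (cmod w)\<^sup>2" by (simp add: t_def norm_mult power_mult_distrib)
  ultimately have "e * (cmod w)\<^sup>2 * 2 \<le> e * (cmod w)\<^sup>2 * (e * K)" by (simp add: power2_eq_square algebra_simps)
  then have "2 \<le> e * K" using e w by simp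
  with e show False by simp
qed

text \<open>For uniqueness, another optimal functional has error norm at most that of the norm of u,
  yet takes the same value on u as the first one. So u is extremal for both, and comparing first
  variations at u shows that both functionals agree on all splines with m matching orders, in
  particular on polynomials.\<close>

lemma sard_optimal_natural_spline:
  assumes u: "natural_spline m 1 u C" and m: "m \<ge> 1"
    and zero: "\<And>\<beta>. \<beta> \<le> N \<Longrightarrow> spline u (node \<beta>) = 0"
    and real: "\<And>x. cnj (spline (pieces_deriv m u) x) = spline (pieces_deriv m u) x"
  shows "sard_optimal m N a b C' \<longleftrightarrow> (\<forall>\<beta>\<le>N. C' \<beta> = C \<beta>)"
proof -
  let ?M = "lebesgue_on {a..b}" and ?K = "spline (pieces_deriv m u)" and ?D = "deriv_within_Icc a b m"
  define n where "n = (LINT x|?M. (cmod (?K x))\<^sup>2)"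
  define \<nu> where "\<nu> = sobolev_norm m a b (spline u)"
  have su: "smooth_pieces m u" using u m by (auto simp: natural_spline_def smooth_pieces_def)
  have n\<nu>: "n = \<nu>\<^sup>2" unfolding n_def \<nu>_def by (rule sobolev_norm_spline[OF su m, symmetric])
  have \<nu>0: "\<nu> \<ge> 0" unfolding \<nu>_def by (rule sobolev_norm_nonneg)
  have pairing: "(LINT x|?M. ?K x * ?D \<phi> x) = (-1)^m * error_functional N a b C \<phi>" if "\<phi> \<in> sobolev_space m a b" for \<phi>
    using natural_spline_pairing[OF u m that] by (simp add: error_functional_node)
  have E: "error_functional N a b C \<phi> = (-1)^m * (LINT x|?M. ?K x * ?D \<phi> x)" if "\<phi> \<in> sobolev_space m a b" for \<phi>
    using pairing[OF that] by (simp add: mult.assoc[symmetric] flip: power_mult_distrib)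
  have LINT_spline: "(LINT x|?M. ?K x * ?D (spline p) x) = (LINT x|?M. spline (pieces_deriv m p) x * cnj (?K x))"
    if p: "smooth_pieces m p" for p
  proof (rule integral_cong_AE)
    show "(\<lambda>x. ?K x * ?D (spline p) x) \<in> borel_measurable ?M"
      using deriv_spline_measurable[OF p m] by measurable
    show "(\<lambda>x. spline (pieces_deriv m p) x * cnj (?K x)) \<in> borel_measurable ?M"
      using integrable_spline_mult by (rule borel_measurable_integrable)
    show "AE x in ?M. ?K x * ?D (spline p) x = spline (pieces_deriv m p) x * cnj (?K x)"
      using deriv_spline_AE[OF p m] by eventually_elim (simp add: real)
  qed
  have norm_C: "error_norm m N a b C \<le> ereal \<nu>"
    unfolding error_norm_def
  proof (rule SUP_least)
    fix \<phi> assume "\<phi> \<in> {\<phi> \<in> sobolev_space m a b. sobolev_norm m a b \<phi> \<le> 1}"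
    then have \<phi>: "\<phi> \<in> sobolev_space m a b" and le1: "sobolev_norm m a b \<phi> \<le> 1" by auto
    have "(cmod (error_functional N a b C \<phi>))\<^sup>2 = (cmod (LINT x|?M. ?K x * ?D \<phi> x))\<^sup>2"
      by (simp add: E[OF \<phi>] norm_mult norm_power)
    also have "\<dots> \<le> n * (LINT x|?M. (cmod (?D \<phi> x))\<^sup>2)"
      unfolding n_def using \<phi>
      by (intro cmod_integral_mult_le integrable_norm_spline_power2) (auto simp: sobolev_space_def)
    also have "\<dots> = (\<nu> * sobolev_norm m a b \<phi>)\<^sup>2" by (simp add: n\<nu> sobolev_norm_power2 power_mult_distrib)
    also have "\<dots> \<le> \<nu>\<^sup>2"
      using \<nu>0 le1 sobolev_norm_nonneg[of m \<phi>] by (intro power_mono) (auto intro: mult_left_le)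
    finally show "ereal (cmod (error_functional N a b C \<phi>)) \<le> ereal \<nu>"
      unfolding ereal_less_eq by (rule power2_le_imp_le[OF _ \<nu>0])
  qed
  \<comment> \<open>Since \<open>u\<close> vanishes at the nodes, no choice of coefficients affects
    the value of the functional on it.\<close>
  have value_u: "error_functional N a b C'' (spline u) = of_real ((-1)^m * n)" for C''
  proof -
    have "error_functional N a b C'' (spline u) = error_functional N a b C (spline u)"
      by (simp add: error_functional_node zero)
    also have "\<dots> = (-1)^m * (LINT x|?M. ?K x * cnj (?K x))"
      by (simp add: E[OF spline_in_sobolev_space[OF su m]] LINT_spline[OF su])
    also have "(LINT x|?M. ?K x * cnj (?K x)) = of_real n"
      unfolding n_def by (simp only: complex_norm_square[symmetric] integral_complex_of_real)
    finally show ?thesis by simp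
  qed
  \<comment> \<open>Monomials of degree below \<open>m\<close> have m-th derivative 0, so their
    pairing with the natural spline vanishes.\<close>
  have exact: "exact_on_monomials m N a b C"
    unfolding exact_on_monomials_def
  proof (intro allI impI)
    fix \<alpha> assume "\<alpha> < m"
    let ?p = "\<lambda>_ :: nat. monom (1 :: complex) \<alpha>"
    have mono: "spline ?p = (\<lambda>x. complex_of_real x ^ \<alpha>)" by (auto simp: poly_monom)
    have "degree ((pderiv ^^ j) (monom (1::complex) \<alpha>)) \<le> \<alpha> - j" for j
      by (induction j) (auto simp: degree_pderiv degree_monom_eq)
    have zero: "(pderiv ^^ m) (monom (1::complex) \<alpha>) = 0"
      using \<open>\<alpha> < m\<close>
    proof (induction m arbitrary: \<alpha>)
      case (Suc m)
      show ?case
      proof (cases \<alpha>)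
        case 0
        then show ?thesis by (simp add: funpow_Suc_right pderiv_monom del: funpow.simps)
      next
        case (Suc \<alpha>')
        then have "pderiv (monom (1::complex) \<alpha>) = smult (of_nat \<alpha>) (monom 1 \<alpha>')"
          by (simp add: pderiv_monom smult_monom)
        then show ?thesis using Suc.IH[of \<alpha>'] Suc \<open>\<alpha> < Suc m\<close>
          by (simp add: funpow_Suc_right funpow_pderiv_smult del: funpow.simps)
      qed
    qed simp
    have "spline ?p \<in> sobolev_space m a b" by (rule spline_in_sobolev_space[OF smooth_pieces_const m])
    from E[OF this] have "error_functional N a b C (spline ?p) = 0"
      unfolding LINT_spline[OF smooth_pieces_const] by (simp add: zero)
    then show "error_functional N a b C (\<lambda>x. complex_of_real x ^ \<alpha>) = 0" unfolding mono .
  qed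
  have optimal: "error_norm m N a b C \<le> error_norm m N a b C''" for C''
  proof (rule order.trans[OF norm_C])
    show "ereal \<nu> \<le> error_norm m N a b C''"
    proof (rule ccontr)
      assume "\<not> ereal \<nu> \<le> error_norm m N a b C''"
      then have less: "error_norm m N a b C'' < ereal \<nu>" by simp
      with error_norm_nonneg[OF m, of C''] obtain \<mu> where \<mu>: "error_norm m N a b C'' = ereal \<mu>"
        by (cases "error_norm m N a b C''") auto
      have "0 \<le> \<mu>" "\<mu> < \<nu>" using \<mu> less error_norm_nonneg[OF m, of C''] by auto
      have "cmod (of_real ((-1)^m * n)) \<le> \<mu> * \<nu>"
        using error_functional_le_error_norm[OF su m, of C'' \<mu>] \<mu> unfolding value_u \<nu>_def[symmetric] by simp
      then have "\<nu> * \<nu> \<le> \<mu> * \<nu>" by (simp add: n\<nu> norm_mult norm_power power2_eq_square)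
      then show False using \<open>0 \<le> \<mu>\<close> \<open>\<mu> < \<nu>\<close> by simp
    qed
  qed
  have unique: "C' \<beta> = C \<beta>" if opt: "sard_optimal m N a b C'" and \<beta>: "\<beta> \<le> N" for \<beta>
  proof -
    have norm_C': "error_norm m N a b C' \<le> ereal \<nu>"
      using opt exact norm_C unfolding sard_optimal_def by (meson order.trans)
    have same: "error_functional N a b C' (spline p) = error_functional N a b C (spline p)"
      if p: "smooth_pieces m p" for p
    proof (cases "\<nu> = 0")
      \<comment> \<open>The variational argument requires \<open>n > 0\<close>. For
        \<open>\<nu> = 0\<close> both functionals vanish on splines by the bound through the error
        norm.\<close>
      case True
      then show ?thesis
        using error_functional_le_error_norm[OF p m norm_C'] error_functional_le_error_norm[OF p m norm_C] by simp
    next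
      case False
      define A where "A = error_functional N a b C' (spline p)"
      define B where "B = (LINT x|?M. spline (pieces_deriv m p) x * cnj (?K x))"
      define k where "k = (LINT x|?M. (cmod (spline (pieces_deriv m p) x))\<^sup>2)"
      have "(cmod (of_real ((-1)^m * n) + t * A))\<^sup>2 \<le> n * (n + 2 * Re (t * B) + (cmod t)\<^sup>2 * k)" for t
      proof -
        let ?v = "\<lambda>\<beta>. u \<beta> + smult t (p \<beta>)"
        have sv: "smooth_pieces m ?v" by (rule smooth_pieces_lincomb[OF su p])
        have "pieces_deriv m ?v = (\<lambda>\<beta>. pieces_deriv m u \<beta> + smult t (pieces_deriv m p \<beta>))"
          by (simp add: funpow_pderiv_add funpow_pderiv_smult)
        then have "(sobolev_norm m a b (spline ?v))\<^sup>2 = n + 2 * Re (t * B) + (cmod t)\<^sup>2 * k"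
          unfolding sobolev_norm_spline[OF sv m] by (simp only: spline_lincomb integral_norm_lincomb n_def B_def k_def)
        moreover have "cmod (of_real ((-1)^m * n) + t * A) \<le> \<nu> * sobolev_norm m a b (spline ?v)"
          using error_functional_le_error_norm[OF sv m norm_C']
          unfolding error_functional_spline_lincomb value_u A_def .
        then have "(cmod (of_real ((-1)^m * n) + t * A))\<^sup>2 \<le> (\<nu> * sobolev_norm m a b (spline ?v))\<^sup>2"
          by (rule power_mono) simp
        ultimately show ?thesis by (simp add: power_mult_distrib n\<nu>)
      qed
      from quadratic_perturbation_bound[OF this]
      have "A = of_real ((-1)^m) * B"
        using False \<nu>0 by (simp add: n\<nu> k_def integral_nonneg_AE flip: power_mult_distrib)
      also have "\<dots> = error_functional N a b C (spline p)"
        unfolding E[OF spline_in_sobolev_space[OF p m]] LINT_spline[OF p] B_def by simp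
      finally show ?thesis unfolding A_def .
    qed
    \<comment> \<open>A polynomial that vanishes at all nodes except \<open>node \<beta>\<close>;
      equality of the two functionals on it isolates the coefficient with index
      \<open>\<beta>\<close>.\<close>
    define L where "L = (\<Prod>\<gamma>\<in>{0..N} - {\<beta>}. [:- complex_of_real (node \<gamma>), 1:])"
    have L: "poly L (of_real (node \<gamma>)) = 0" if "\<gamma> \<in> {0..N} - {\<beta>}" for \<gamma>
      using that unfolding L_def poly_prod by (intro prod_zero) (auto intro!: bexI[of _ \<gamma>])
    have L\<beta>: "poly L (of_real (node \<beta>)) \<noteq> 0" unfolding L_def poly_prod by auto
    have sum: "(\<Sum>\<gamma>=0..N. G \<gamma> * spline (\<lambda>_. L) (node \<gamma>)) = G \<beta> * poly L (of_real (node \<beta>))" for G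
    proof -
      have "(\<Sum>\<gamma>=0..N. G \<gamma> * spline (\<lambda>_. L) (node \<gamma>)) = (\<Sum>\<gamma>\<in>{\<beta>}. G \<gamma> * spline (\<lambda>_. L) (node \<gamma>))"
        using \<beta> L by (intro sum.mono_neutral_right) auto
      then show ?thesis by simp
    qed
    have "C' \<beta> * poly L (of_real (node \<beta>)) = C \<beta> * poly L (of_real (node \<beta>))"
      using same[OF smooth_pieces_const[of m L]] unfolding error_functional_node sum by simp
    then show ?thesis using L\<beta> by simp
  qed
  have cong: "error_functional N a b C' = error_functional N a b C" if "\<forall>\<beta>\<le>N. C' \<beta> = C \<beta>"
    using that by (auto simp: fun_eq_iff error_functional_def)
  show ?thesis
  proof
    assume "\<forall>\<beta>\<le>N. C' \<beta> = C \<beta>"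
    then show "sard_optimal m N a b C'"
      using exact optimal unfolding sard_optimal_def exact_on_monomials_def error_norm_def cong[OF \<open>\<forall>\<beta>\<le>N. C' \<beta> = C \<beta>\<close>]
      by blast
  qed (use unique in blast)
qed

end

section \<open>Power series of the null splines\<close>

text \<open>Gaussian elimination by induction on the number of unknowns. A column of zeros would
  make a unit vector a nontrivial homogeneous solution, so column \<open>\<kappa>\<close> has a
  pivot, and \<open>a'\<close> is the matrix reduced by the pivot row \<open>\<rho>\<close>.\<close>

lemma square_linear_system_solvable:
  fixes a :: "'j \<Rightarrow> 'k \<Rightarrow> real"
  assumes "finite J" "finite K" "card J = card K"
    and "\<And>d. (\<And>j. j \<in> J \<Longrightarrow> (\<Sum>k\<in>K. d k * a j k) = 0) \<Longrightarrow> (\<And>k. k \<in> K \<Longrightarrow> d k = 0)"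
  shows "\<exists>d. \<forall>j\<in>J. (\<Sum>k\<in>K. d k * a j k) = b j"
  using assms
proof (induction "card K" arbitrary: J K a b)
  case 0
  then show ?case by simp
next
  case (Suc n)
  then obtain \<kappa> where \<kappa>: "\<kappa> \<in> K" by fastforce
  have "\<exists>\<rho>\<in>J. a \<rho> \<kappa> \<noteq> 0"
  proof (rule ccontr)
    assume "\<not> ?thesis"
    then have "(\<Sum>k\<in>K. (if k = \<kappa> then 1 else 0) * a j k) = 0" if "j \<in> J" for j
      using that by (intro sum.neutral) auto
    from Suc.prems(4)[OF this \<kappa>] show False by simp
  qed
  then obtain \<rho> where \<rho>: "\<rho> \<in> J" "a \<rho> \<kappa> \<noteq> 0" by blast
  define a' where "a' j k = a j k - a j \<kappa> / a \<rho> \<kappa> * a \<rho> k" for j k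
  have split: "(\<Sum>k\<in>K. d k * a j k) = d \<kappa> * a j \<kappa> + (\<Sum>k\<in>K - {\<kappa>}. d k * a j k)" for d j
    using Suc.prems(2) \<kappa> by (simp add: sum.remove)
  have red: "(\<Sum>k\<in>K - {\<kappa>}. d k * a' j k)
      = (\<Sum>k\<in>K - {\<kappa>}. d k * a j k) - a j \<kappa> / a \<rho> \<kappa> * (\<Sum>k\<in>K - {\<kappa>}. d k * a \<rho> k)" for d j
    by (simp add: a'_def algebra_simps sum_subtractf sum_distrib_left)
  \<comment> \<open>Back substitution: the entry at \<open>\<kappa>\<close> is chosen so that row
    \<open>\<rho>\<close> takes the value \<open>r\<close>. With \<open>r = 0\<close> this transfers
    injectivity to the reduced system, with \<open>r = b \<rho>\<close> it lifts a solution.\<close>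
  have ext: "\<exists>d'. (\<forall>k\<in>K - {\<kappa>}. d' k = d k) \<and> (\<Sum>k\<in>K. d' k * a \<rho> k) = r \<and>
      (\<forall>j\<in>J - {\<rho>}. (\<Sum>k\<in>K. d' k * a j k) = (\<Sum>k\<in>K - {\<kappa>}. d k * a' j k) + a j \<kappa> / a \<rho> \<kappa> * r)" for d r
  proof -
    define d' where "d' = d(\<kappa> := (r - (\<Sum>k\<in>K - {\<kappa>}. d k * a \<rho> k)) / a \<rho> \<kappa>)"
    have s: "(\<Sum>k\<in>K - {\<kappa>}. d' k * a j k) = (\<Sum>k\<in>K - {\<kappa>}. d k * a j k)" for j
      by (intro sum.cong) (auto simp: d'_def)
    have \<kappa>': "d' \<kappa> = (r - (\<Sum>k\<in>K - {\<kappa>}. d k * a \<rho> k)) / a \<rho> \<kappa>" by (simp add: d'_def)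
    have "(\<Sum>k\<in>K. d' k * a \<rho> k) = r" unfolding split s \<kappa>' using \<rho>(2) by simp
    moreover have "(\<Sum>k\<in>K. d' k * a j k) = (\<Sum>k\<in>K - {\<kappa>}. d k * a' j k) + a j \<kappa> / a \<rho> \<kappa> * r" for j
      unfolding split s \<kappa>' red using \<rho>(2) by (simp add: field_simps)
    moreover have "\<forall>k\<in>K - {\<kappa>}. d' k = d k" by (simp add: d'_def)
    ultimately show ?thesis by blast
  qed
  have "\<exists>d. \<forall>j\<in>J - {\<rho>}. (\<Sum>k\<in>K - {\<kappa>}. d k * a' j k) = b j - a j \<kappa> / a \<rho> \<kappa> * b \<rho>"
  proof (rule Suc.hyps(1))
    show "n = card (K - {\<kappa>})" "card (J - {\<rho>}) = card (K - {\<kappa>})"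
      using Suc.hyps(2) Suc.prems \<kappa> \<rho> by auto
    fix d k
    assume d: "\<And>j. j \<in> J - {\<rho>} \<Longrightarrow> (\<Sum>k\<in>K - {\<kappa>}. d k * a' j k) = 0" and k: "k \<in> K - {\<kappa>}"
    obtain d' where d': "\<forall>k\<in>K - {\<kappa>}. d' k = d k" "(\<Sum>k\<in>K. d' k * a \<rho> k) = 0"
      "\<forall>j\<in>J - {\<rho>}. (\<Sum>k\<in>K. d' k * a j k) = (\<Sum>k\<in>K - {\<kappa>}. d k * a' j k) + a j \<kappa> / a \<rho> \<kappa> * 0"
      using ext[of d 0] by blast
    have "(\<Sum>k\<in>K. d' k * a j k) = 0" if "j \<in> J" for j
      using d d' that by (cases "j = \<rho>") auto
    then have "d' k = 0" using Suc.prems(4)[of d' k] k by blast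
    then show "d k = 0" using d' k by simp
  qed (use Suc.prems in auto)
  then obtain d where d: "\<forall>j\<in>J - {\<rho>}. (\<Sum>k\<in>K - {\<kappa>}. d k * a' j k) = b j - a j \<kappa> / a \<rho> \<kappa> * b \<rho>" by blast
  obtain d' where d': "(\<Sum>k\<in>K. d' k * a \<rho> k) = b \<rho>"
      "\<forall>j\<in>J - {\<rho>}. (\<Sum>k\<in>K. d' k * a j k) = (\<Sum>k\<in>K - {\<kappa>}. d k * a' j k) + a j \<kappa> / a \<rho> \<kappa> * b \<rho>"
    using ext[of d "b \<rho>"] by blast
  have "(\<Sum>k\<in>K. d' k * a j k) = b j" if "j \<in> J" for j
    using d d' that by (cases "j = \<rho>") auto
  then show ?case by blast
qed

text \<open>The value at x is the coefficient of z^n in G(z) e^(xz).\<close>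

definition appell :: "real fps \<Rightarrow> nat \<Rightarrow> complex poly" where
  "appell G n = (\<Sum>i\<le>n. monom (of_real (fps_nth G (n - i) / fact i)) i)"

lemma coeff_appell: "coeff (appell G n) i = (if i \<le> n then of_real (fps_nth G (n - i) / fact i) else 0)"
  by (simp add: appell_def coeff_sum)

lemma pderiv_appell: "pderiv (appell G (Suc n)) = appell G n"
proof (rule poly_eqI)
  fix i
  have "real (Suc i) * (x / fact (Suc i)) = x / fact i" for x by (simp add: fact_Suc del: of_nat_Suc)
  then have "of_nat (Suc i) * of_real (x / fact (Suc i)) = (of_real (x / fact i) :: complex)" for x
    by (metis of_real_mult of_real_of_nat_eq)
  then show "coeff (pderiv (appell G (Suc n))) i = coeff (appell G n) i"
    by (simp only: coeff_pderiv coeff_appell) simp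
qed

lemma funpow_pderiv_appell: "j \<le> n \<Longrightarrow> (pderiv ^^ j) (appell G n) = appell G (n - j)"
proof (induction j)
  case (Suc j)
  then have "n - j = Suc (n - Suc j)" by simp
  then show ?case using Suc pderiv_appell[of G "n - Suc j"] by simp
qed simp

lemma poly_appell_0: "poly (appell G n) 0 = of_real (fps_nth G n)"
  by (simp add: poly_0_coeff_0 coeff_appell)

lemma poly_appell_1: "poly (appell G n) 1 = of_real (fps_nth (G * fps_exp 1) n)"
proof -
  have "fps_nth (G * fps_exp 1) n = (\<Sum>i=0..n. fps_nth G (n - i) / fact i)"
    by (subst mult.commute) (simp add: fps_mult_nth)
  then show ?thesis by (simp add: appell_def poly_sum poly_monom atLeast0AtMost)
qed

lemma cnj_poly_appell: "cnj (poly (appell G n) (of_real x)) = poly (appell G n) (of_real x)"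
  by (simp add: appell_def poly_sum poly_monom)

section \<open>The series 1/(e^z - q) and its coefficients\<close>

definition frobenius_fps :: "real \<Rightarrow> real fps" where
  "frobenius_fps q = inverse (fps_exp 1 - fps_const q)"

lemma frobenius_fps_mult: "q \<noteq> 1 \<Longrightarrow> frobenius_fps q * (fps_exp 1 - fps_const q) = 1"
  unfolding frobenius_fps_def by (rule inverse_mult_eq_1) simp

text \<open>Multiplication by e^z passes from the left to the right end of a cell. All coefficients
  except the constant one are thereby multiplied by q: this is s(x + 1) = q s(x), with a jump in a
  single derivative.\<close>

lemma frobenius_fps_exp: "q \<noteq> 1 \<Longrightarrow> frobenius_fps q * fps_exp 1 = fps_const q * frobenius_fps q + 1"
  using frobenius_fps_mult[of q] by (simp add: algebra_simps)

lemma frobenius_fps_0: "q \<noteq> 1 \<Longrightarrow> fps_nth (frobenius_fps q) 0 = 1 / (1 - q)"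
  by (simp add: frobenius_fps_def field_simps)

text \<open>Coefficientwise form of 1/(e^(-z) - 1/q) = -q^2/(e^z - q) - q. Replacing z by -z
  reflects a cell, so reflection exchanges the null splines for q and 1/q. In the proof both series
  are inverses of e^(-z) - 1/q.\<close>

lemma frobenius_fps_reciprocal:
  assumes "q \<noteq> 0" "q \<noteq> 1"
  shows "(-1)^j * fps_nth (frobenius_fps (1/q)) j = - (q\<^sup>2 * fps_nth (frobenius_fps q) j) - (if j = 0 then q else 0)"
proof -
  let ?n = "fps_const (-1) * fps_X :: real fps"
  let ?F = "frobenius_fps (1/q) oo ?n"
  have "(frobenius_fps (1/q) * (fps_exp 1 - fps_const (1/q))) oo ?n = 1"
    using assms by (subst frobenius_fps_mult) (auto simp: fps_compose_1)
  then have 1: "?F * (fps_exp (-1) - fps_const (1/q)) = 1"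
    by (simp add: fps_compose_mult_distrib fps_compose_sub_distrib fps_exp_compose_linear)
  have inv: "fps_exp (-1) * fps_exp 1 = (1 :: real fps)" by (simp flip: fps_exp_add_mult)
  let ?R = "- (fps_const (q\<^sup>2) * frobenius_fps q) - fps_const q"
  have e: "(fps_exp (-1) - fps_const (1/q)) * fps_exp 1 = - (fps_const (1/q) * (fps_exp 1 - fps_const q))"
    using assms inv by (simp add: algebra_simps)
  have "?R * (fps_exp (-1) - fps_const (1/q)) * fps_exp 1 = fps_exp 1"
  proof -
    have "?R * (fps_exp (-1) - fps_const (1/q)) * fps_exp 1
      = fps_const (q\<^sup>2) * fps_const (1/q) * (frobenius_fps q * (fps_exp 1 - fps_const q)) + fps_const q * fps_const (1/q) * (fps_exp 1 - fps_const q)"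
    proof -
      have "(- (Q2 * A) - Q) * (- (P * D)) = Q2 * P * (A * D) + Q * P * D" for A D P Q Q2 :: "real fps"
        by (simp add: algebra_simps)
      then show ?thesis unfolding mult.assoc[of ?R] e by (simp only:)
    qed
    also have "\<dots> = fps_const q + (fps_exp 1 - fps_const q)"
      unfolding frobenius_fps_mult[OF assms(2)] fps_const_mult using assms by (simp add: power2_eq_square)
    finally show ?thesis by simp
  qed
  then have "?R * (fps_exp (-1) - fps_const (1/q)) * (fps_exp 1 * fps_exp (-1)) = fps_exp 1 * fps_exp (-1)"
    by (simp only: mult.assoc[symmetric])
  then have 2: "?R * (fps_exp (-1) - fps_const (1/q)) = 1"
    using inv by (simp add: mult.commute[of "fps_exp 1"])
  have "?F = ?F * (?R * (fps_exp (-1) - fps_const (1/q)))" using 2 by simp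
  also have "\<dots> = ?R * (?F * (fps_exp (-1) - fps_const (1/q)))" by (simp only: mult.left_commute)
  finally have "?F = ?R" using 1 by simp
  then have "fps_nth ?F j = fps_nth ?R j" by simp
  then show ?thesis by (auto simp: fps_compose_linear)
qed

text \<open>Binomial expansion of the power. The term l = 0 contributes 0^j = 0 because j >= 1,
  which matches the sum from 1 in \<open>diff_zero_power\<close>.\<close>

lemma fps_nth_exp_minus_one_power:
  assumes "j \<ge> 1"
  shows "fps_nth ((fps_exp 1 - 1 :: real fps) ^ t) j = diff_zero_power t j / fact j"
proof -
  have "(fps_exp 1 - 1 :: real fps) ^ t = (\<Sum>l\<le>t. of_nat (t choose l) * fps_exp 1 ^ l * (-1) ^ (t - l))"
    using binomial_ring[of "fps_exp 1" "-1 :: real fps" t] by simp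
  also have "\<dots> = (\<Sum>l\<le>t. fps_const ((-1) ^ (t - l) * real (t choose l)) * fps_exp (real l))"
  proof (rule sum.cong[OF refl])
    fix l
    have "(-1 :: real fps) ^ (t - l) = fps_const ((-1) ^ (t - l))"
      by (metis fps_const_1_eq_1 fps_const_neg fps_const_power)
    then show "of_nat (t choose l) * fps_exp 1 ^ l * (-1 :: real fps) ^ (t - l)
        = fps_const ((-1) ^ (t - l) * real (t choose l)) * fps_exp (real l)"
      by (simp add: fps_exp_power_mult mult_ac flip: fps_of_nat fps_const_mult)
  qed
  finally have "fps_nth ((fps_exp 1 - 1 :: real fps) ^ t) j = (\<Sum>l\<le>t. (-1) ^ (t - l) * real (t choose l) * real l ^ j) / fact j"
    by (simp add: fps_sum_nth sum_divide_distrib)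
  also have "(\<Sum>l\<le>t. (-1) ^ (t - l) * real (t choose l) * real l ^ j) = diff_zero_power t j"
    unfolding diff_zero_power_def using assms by (intro sum.mono_neutral_right) auto
  finally show ?thesis .
qed

text \<open>Geometric series for 1/((1 - q) + w) with w = e^z - 1. It may be cut off after t = j,
  since w^(j+1) has no terms of order at most j.\<close>

lemma frobenius_fps_nth:
  assumes "q \<noteq> 1"
  shows "fps_nth (frobenius_fps q) j = (\<Sum>t\<le>j. (-1)^t * (1 / (1 - q))^(t+1) * fps_nth ((fps_exp 1 - 1) ^ t) j)"
proof -
  define y where "y = 1 / (1 - q)"
  have y: "y * (1 - q) = 1" using assms by (simp add: y_def)
  let ?w = "fps_exp 1 - 1 :: real fps"
  define S where "S = (\<lambda>n. \<Sum>t\<le>n. fps_const ((-1)^t * y^(t+1)) * ?w ^ t)"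
  have fac: "fps_exp 1 - fps_const q = fps_const (1 - q) + ?w" by (simp add: fps_const_sub[symmetric] del: fps_const_sub)
  \<comment> \<open>The telescoping partial sum with its explicit remainder, which is divisible by
    w^(n+1).\<close>
  have tel: "S n * (fps_const (1 - q) + ?w) = 1 + fps_const ((-1)^n * y^(n+1)) * ?w ^ (n+1)" for n
  proof (induction n)
    case 0
    have "fps_const y * fps_const (1 - q) = 1" using y by simp
    then show ?case by (simp add: S_def distrib_left)
  next
    case (Suc n)
    have "(-1)^Suc n * y^(Suc n+1) * (1 - q) = - ((-1)^n * y^(n+1))"
    proof -
      have "y^(Suc n+1) * (1 - q) = y^(n+1) * (y * (1 - q))" by simp
      then show ?thesis unfolding y by simp
    qed
    then have c: "fps_const ((-1)^Suc n * y^(Suc n+1)) * fps_const (1 - q) = - fps_const ((-1)^n * y^(n+1))"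
      by (simp only: fps_const_mult fps_const_neg)
    have "S (Suc n) * (fps_const (1 - q) + ?w) = S n * (fps_const (1 - q) + ?w)
       + (fps_const ((-1)^Suc n * y^(Suc n+1)) * fps_const (1 - q)) * ?w ^ Suc n
       + fps_const ((-1)^Suc n * y^(Suc n+1)) * ?w ^ (Suc n + 1)"
    proof -
      have "(s + e * W) * (r + v) = s * (r + v) + (e * r) * W + e * (W * v)" for s e W r v :: "real fps"
        by (simp add: algebra_simps)
      then show ?thesis unfolding S_def sum.atMost_Suc power_add power_one_right by (simp only:)
    qed
    also have "\<dots> = 1 + fps_const ((-1)^Suc n * y^(Suc n+1)) * ?w ^ (Suc n + 1)"
    proof -
      have "1 + C * V + - C * V + Z = 1 + Z" for C V Z :: "real fps" by simp
      then show ?thesis unfolding Suc.IH c unfolding Suc_eq_plus1[symmetric] by (simp only:)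
    qed
    finally show ?case .
  qed
  have "frobenius_fps q = frobenius_fps q * (S j * (fps_exp 1 - fps_const q) - fps_const ((-1)^j * y^(j+1)) * ?w ^ (j+1))"
    unfolding fac tel by simp
  also have "\<dots> = S j * (frobenius_fps q * (fps_exp 1 - fps_const q)) - fps_const ((-1)^j * y^(j+1)) * (frobenius_fps q * ?w ^ (j+1))"
    by (simp only: right_diff_distrib mult_ac)
  finally have "frobenius_fps q = S j - fps_const ((-1)^j * y^(j+1)) * (frobenius_fps q * ?w ^ (j+1))"
    using frobenius_fps_mult[OF assms] by simp
  then have "fps_nth (frobenius_fps q) j = fps_nth (S j) j - (-1)^j * y^(j+1) * fps_nth (frobenius_fps q * ?w ^ (j+1)) j"
    by (metis fps_mult_left_const_nth fps_sub_nth)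
  also have "fps_nth (frobenius_fps q * ?w ^ (j+1)) j = 0"
    unfolding fps_mult_nth using startsby_zero_power_prefix[of ?w "j+1"] by (intro sum.neutral) auto
  finally show ?thesis by (simp add: S_def fps_sum_nth y_def)
qed

lemma frobenius_fps_nth_diff:
  assumes "q \<noteq> 1" "j \<ge> 1"
  shows "fps_nth (frobenius_fps q) j = - (\<Sum>t=1..j. diff_zero_power t j / (q - 1)^(t+1)) / fact j"
proof -
  have "fps_nth (frobenius_fps q) j = (\<Sum>t\<le>j. (-1)^t * (1 / (1 - q))^(t+1) * (diff_zero_power t j / fact j))"
    unfolding frobenius_fps_nth[OF assms(1)] fps_nth_exp_minus_one_power[OF assms(2)] ..
  also have "\<dots> = (\<Sum>t=1..j. (-1)^t * (1 / (1 - q))^(t+1) * (diff_zero_power t j / fact j))"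
    by (intro sum.mono_neutral_right) (auto simp: diff_zero_power_def not_le)
  also have "\<dots> = (\<Sum>t=1..j. - (diff_zero_power t j / (q - 1)^(t+1)) / fact j)"
  proof (rule sum.cong[OF refl])
    fix t
    have "(1 - q)^(t+1) = (-1)^(t+1) * (q - 1)^(t+1)" by (metis minus_diff_eq power_minus)
    then show "(-1)^t * (1 / (1 - q))^(t+1) * (diff_zero_power t j / fact j) = - (diff_zero_power t j / (q - 1)^(t+1)) / fact j"
      using assms by (simp add: power_divide field_simps flip: power_mult_distrib)
  qed
  finally show ?thesis by (simp add: sum_negf sum_divide_distrib)
qed

text \<open>The sum on the left occurs in two places, in the Euler-Frobenius polynomial at q and in
  the part of the linear system that carries q^N; in both it stands for a coefficient of the series
  with 1/q.\<close>

lemma sum_diff_zero_power_reciprocal: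
  assumes "q \<noteq> 0" "q \<noteq> 1" "j \<ge> 1"
  shows "(\<Sum>t=1..j. diff_zero_power t j * q^t / (1 - q)^(t+1)) = - (fact j / q) * fps_nth (frobenius_fps (1/q)) j"
proof -
  have "(\<Sum>t=1..j. diff_zero_power t j * q^t / (1 - q)^(t+1)) = (\<Sum>t=1..j. (1/q) * (diff_zero_power t j / (1/q - 1)^(t+1)))"
  proof (rule sum.cong[OF refl])
    fix t
    have "1/q - 1 = (1 - q) / q" using assms by (simp add: field_simps)
    then have "(1/q - 1)^(t+1) = (1 - q)^(t+1) / q^(t+1)" by (simp only: power_divide)
    then show "diff_zero_power t j * q^t / (1 - q)^(t+1) = (1/q) * (diff_zero_power t j / (1/q - 1)^(t+1))"
      using assms by simp
  qed
  also have "\<dots> = - (fact j / q) * fps_nth (frobenius_fps (1/q)) j"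
  proof -
    have "1 / q \<noteq> 1" using assms by simp
    from frobenius_fps_nth_diff[OF this assms(3)] show ?thesis
      by (simp only: sum_distrib_left[symmetric]) simp
  qed
  finally show ?thesis .
qed

text \<open>The summand q is the expansion for q. The summand with q^(N+t) is the expansion for 1/q,
  because (-1)^(t+1)/(q - 1)^(t+1) = 1/(1 - q)^(t+1).\<close>

lemma coefficient_system_entry:
  assumes "q \<noteq> 0" "q \<noteq> 1" "j \<ge> 1" "N \<ge> 1"
  shows "(\<Sum>t=1..j. (q + (-1)^(t+1) * q^(N+t)) / (q - 1)^(t+1) * diff_zero_power t j)
    = - fact j * (q * fps_nth (frobenius_fps q) j + q^(N-1) * fps_nth (frobenius_fps (1/q)) j)"
proof -
  have "(\<Sum>t=1..j. (q + (-1)^(t+1) * q^(N+t)) / (q - 1)^(t+1) * diff_zero_power t j)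
     = (\<Sum>t=1..j. q * (diff_zero_power t j / (q - 1)^(t+1)) + q^N * (diff_zero_power t j * q^t / (1 - q)^(t+1)))"
  proof (rule sum.cong[OF refl])
    fix t
    have "(1 - q)^(t+1) = (-1)^(t+1) * (q - 1)^(t+1)" by (metis minus_diff_eq power_minus)
    then have "(-1)^(t+1) / (q - 1)^(t+1) = 1 / (1 - q)^(t+1)" using assms by (simp add: field_simps flip: power_mult_distrib)
    then have eq: "(q + (-1)^(t+1) * q^(N+t)) / (q - 1)^(t+1) = q / (q - 1)^(t+1) + q^(N+t) * (1 / (1 - q)^(t+1))"
    proof -
      have "(q + c * x) / y = q / y + x * (c / y)" for c x y :: real by (simp add: add_divide_distrib)
      then show ?thesis using \<open>(-1)^(t+1) / (q - 1)^(t+1) = 1 / (1 - q)^(t+1)\<close> by (simp only:)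
    qed
    then show "(q + (-1)^(t+1) * q^(N+t)) / (q - 1)^(t+1) * diff_zero_power t j
       = q * (diff_zero_power t j / (q - 1)^(t+1)) + q^N * (diff_zero_power t j * q^t / (1 - q)^(t+1))"
    proof -
      have "(q / y + (c * x) * (1 / z)) * e = q * (e / y) + c * (e * x / z)" for c e x y z :: real
        by (simp add: distrib_right)
      then show ?thesis unfolding eq unfolding power_add[of q N t] by (simp only:)
    qed
  qed
  also have "\<dots> = q * (\<Sum>t=1..j. diff_zero_power t j / (q - 1)^(t+1)) + q^N * (\<Sum>t=1..j. diff_zero_power t j * q^t / (1 - q)^(t+1))"
    by (simp only: sum.distrib sum_distrib_left)
  also have "(\<Sum>t=1..j. diff_zero_power t j / (q - 1)^(t+1)) = - fact j * fps_nth (frobenius_fps q) j"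
    using assms by (simp add: frobenius_fps_nth_diff)
  also have "q^N * (\<Sum>t=1..j. diff_zero_power t j * q^t / (1 - q)^(t+1)) = - fact j * (q^(N-1) * fps_nth (frobenius_fps (1/q)) j)"
    using assms unfolding sum_diff_zero_power_reciprocal[OF assms(1-3)] by (cases N) auto
  finally show ?thesis by (simp add: algebra_simps)
qed

section \<open>Euler-Frobenius polynomials in terms of differences of zero\<close>

lemma diff_zero_power_Suc:
  assumes "j \<ge> 1"
  shows "diff_zero_power (Suc s) (Suc j) = real (Suc s) * (diff_zero_power (Suc s) j + diff_zero_power s j)"
proof -
  let ?w = "fps_exp 1 - 1 :: real fps"
  \<comment> \<open>The recurrence compares coefficients in (w^(s+1))' = (s+1) w^s e^z = (s+1)
    (w^(s+1) + w^s), where w = e^z - 1.\<close>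
  have "fps_deriv (?w ^ Suc s) = fps_const (real (Suc s)) * (?w ^ s * fps_exp 1)"
    by (subst fps_deriv_power) (simp add: mult_ac)
  also have "?w ^ s * fps_exp 1 = ?w ^ Suc s + ?w ^ s" by (simp add: algebra_simps)
  finally have "fps_nth (fps_deriv (?w ^ Suc s)) j = real (Suc s) * (fps_nth (?w ^ Suc s) j + fps_nth (?w ^ s) j)"
    by (simp only: fps_mult_left_const_nth fps_add_nth)
  then have "real (Suc j) * fps_nth (?w ^ Suc s) (Suc j) = real (Suc s) * (fps_nth (?w ^ Suc s) j + fps_nth (?w ^ s) j)"
    by (simp only: fps_deriv_nth Suc_eq_plus1)
  then have "real (Suc j) * (diff_zero_power (Suc s) (Suc j) / fact (Suc j))
      = real (Suc s) * (diff_zero_power (Suc s) j / fact j + diff_zero_power s j / fact j)"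
    using assms by (simp add: fps_nth_exp_minus_one_power del: of_nat_Suc power_Suc fact_Suc)
  moreover have "real (Suc j) * (diff_zero_power (Suc s) (Suc j) / fact (Suc j)) = diff_zero_power (Suc s) (Suc j) / fact j"
    by (simp add: fact_Suc del: of_nat_Suc)
  moreover have "x / fact j + y / fact j = (x + y) / fact j" for x y :: real by (simp add: add_divide_distrib)
  ultimately have "diff_zero_power (Suc s) (Suc j) / fact j
      = (real (Suc s) * (diff_zero_power (Suc s) j + diff_zero_power s j)) / fact j"
    by (simp only: times_divide_eq_right)
  then show ?thesis by (simp only: divide_cancel_right fact_nonzero simp_thms)
qed

lemma diff_zero_power_eq_0: "j \<ge> 1 \<Longrightarrow> diff_zero_power (Suc j) j = 0"
  using startsby_zero_power_prefix[of "fps_exp 1 - 1 :: real fps" "Suc j"] fps_nth_exp_minus_one_power[of j "Suc j"]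
  by simp

lemma diff_zero_power_1: "j \<ge> 1 \<Longrightarrow> diff_zero_power 1 j = 1"
  by (simp add: diff_zero_power_def)

text \<open>For |x| < 1 both sides are the sum of n^(k+1) x^n, the right one through Newton's
  expansion of n^(k+1) in binomial coefficients. The induction uses that x d/dx maps T_t =
  x^t/(1-x)^(t+1) to t T_t + (t+1) T_(t+1), which is the recurrence for
  \<open>diff_zero_power\<close>.\<close>

lemma iterated_euler_operator:
  "x \<noteq> 1 \<Longrightarrow> ((\<lambda>f x. x * deriv f x) ^^ k) (\<lambda>x::real. x / (1 - x)\<^sup>2) x
     = (\<Sum>t=1..Suc k. diff_zero_power t (Suc k) * x^t / (1 - x)^(t+1))"
proof (induction k arbitrary: x)
  case 0
  then show ?case by (simp add: diff_zero_power_def power2_eq_square)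
next
  case (Suc k)
  let ?g = "((\<lambda>f x. x * deriv f x) ^^ k) (\<lambda>x::real. x / (1 - x)\<^sup>2)"
  let ?\<Delta> = "\<lambda>t. diff_zero_power t (Suc k)"
  define T where "T = (\<lambda>t. x^t / (1 - x)^(t+1))"
  have D: "((\<lambda>x. ?\<Delta> t * x^t / (1 - x)^(t+1)) has_field_derivative
      ?\<Delta> t * (real t * x^(t-1) / (1 - x)^(t+1) + real (t+1) * x^t / (1 - x)^(t+2))) (at x)" for t
  proof -
    define u w where "u = 1 - x" and "w = u ^ t"
    have u: "u \<noteq> 0" and w: "w \<noteq> 0" using Suc.prems by (auto simp: u_def w_def)
    have "((\<lambda>x. 1 - x) has_field_derivative - 1) (at x)"
      using DERIV_diff[OF DERIV_const[of 1] DERIV_ident] by simp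
    from DERIV_power[OF this, of "t + 1"]
    have D2: "((\<lambda>x. (1 - x) ^ (t + 1)) has_field_derivative - (real (t + 1) * w)) (at x)"
      by (simp add: w_def u_def)
    have D1: "((\<lambda>x. x ^ t) has_field_derivative real t * x ^ (t - 1)) (at x)"
      using DERIV_pow[of t x] by simp
    have "(1 - x) ^ (t + 1) \<noteq> 0" using Suc.prems by simp
    note D3 = DERIV_cmult[OF DERIV_divide[OF D1 D2 this], of "?\<Delta> t"]
    have U: "(1 - x)^(t+1) = u * w" "(1 - x)^(t+2) = u * (u * w)" by (simp_all add: u_def w_def)
    have "(n * (u * w) - y * - (r * w)) / ((u * w) * (u * w)) = n / (u * w) + r * y / (u * (u * w))" for n y r
      using u w by (simp add: field_simps)
    then have "?\<Delta> t * ((real t * x ^ (t-1) * (1 - x)^(t+1) - x ^ t * - (real (t+1) * w)) / ((1 - x)^(t+1) * (1 - x)^(t+1)))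
       = ?\<Delta> t * (real t * x^(t-1) / (1 - x)^(t+1) + real (t+1) * x^t / (1 - x)^(t+2))"
      unfolding U by (simp only:)
    with D3 show ?thesis by (simp only: times_divide_eq_right)
  qed
  have "((\<lambda>x. \<Sum>t=1..Suc k. ?\<Delta> t * x^t / (1 - x)^(t+1)) has_field_derivative
      (\<Sum>t=1..Suc k. ?\<Delta> t * (real t * x^(t-1) / (1 - x)^(t+1) + real (t+1) * x^t / (1 - x)^(t+2)))) (at x)"
    by (intro DERIV_sum D)
  then have "(?g has_field_derivative
      (\<Sum>t=1..Suc k. ?\<Delta> t * (real t * x^(t-1) / (1 - x)^(t+1) + real (t+1) * x^t / (1 - x)^(t+2)))) (at x)"
    by (rule has_field_derivative_transform_within_open[where S = "- {1}"]) (use Suc in auto)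
  then have "x * deriv ?g x = x * (\<Sum>t=1..Suc k. ?\<Delta> t * (real t * x^(t-1) / (1 - x)^(t+1) + real (t+1) * x^t / (1 - x)^(t+2)))"
    by (simp add: DERIV_imp_deriv)
  also have "\<dots> = (\<Sum>t=1..Suc k. ?\<Delta> t * (real t * T t + real (t+1) * T (t+1)))"
    unfolding sum_distrib_left
  proof (rule sum.cong[OF refl])
    fix t assume "t \<in> {1..Suc k}"
    then show "x * (?\<Delta> t * (real t * x^(t-1) / (1 - x)^(t+1) + real (t+1) * x^t / (1 - x)^(t+2)))
      = ?\<Delta> t * (real t * T t + real (t+1) * T (t+1))"
      by (cases t) (auto simp: T_def algebra_simps)
  qed
  also have "\<dots> = (\<Sum>t=1..Suc k. ?\<Delta> t * (real t * T t)) + (\<Sum>t=1..Suc k. ?\<Delta> t * (real (t+1) * T (t+1)))"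
    by (simp only: distrib_left sum.distrib)
  \<comment> \<open>Both sums are extended by a zero term so that their ranges agree after the
    shift: at the top \<open>diff_zero_power_eq_0\<close> applies, at the bottom
    \<open>diff_zero_power 0\<close> is an empty sum.\<close>
  also have "(\<Sum>t=1..Suc k. ?\<Delta> t * (real t * T t)) = (\<Sum>t=1..Suc (Suc k). ?\<Delta> t * (real t * T t))"
    by (simp add: diff_zero_power_eq_0)
  also have "(\<Sum>t=1..Suc k. ?\<Delta> t * (real (t+1) * T (t+1))) = (\<Sum>t=0..Suc k. ?\<Delta> t * (real (t+1) * T (t+1)))"
    by (simp add: sum.atLeast_Suc_atMost[of 0] diff_zero_power_def)
  also have "\<dots> = (\<Sum>t=1..Suc (Suc k). ?\<Delta> (t-1) * (real t * T t))"
    using sum.shift_bounds_cl_Suc_ivl[of "\<lambda>t. ?\<Delta> (t-1) * (real t * T t)" 0 "Suc k"] by simp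
  also have "(\<Sum>t=1..Suc (Suc k). ?\<Delta> t * (real t * T t)) + (\<Sum>t=1..Suc (Suc k). ?\<Delta> (t-1) * (real t * T t))
      = (\<Sum>t=1..Suc (Suc k). diff_zero_power t (Suc (Suc k)) * T t)"
    unfolding sum.distrib[symmetric]
  proof (rule sum.cong[OF refl])
    fix t assume "t \<in> {1..Suc (Suc k)}"
    then obtain s where "t = Suc s" by (cases t) auto
    then show "?\<Delta> t * (real t * T t) + ?\<Delta> (t-1) * (real t * T t) = diff_zero_power t (Suc (Suc k)) * T t"
      using diff_zero_power_Suc[of "Suc k" s] by (simp add: algebra_simps)
  qed
  finally show ?case by (simp add: T_def)
qed

text \<open>At 0 only the term t = 1 survives, with value 1. Hence roots may be inverted.\<close>

lemma euler_frobenius_root_nonzero: "poly (euler_frobenius k) 0 \<noteq> 0"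
proof -
  define P where "P = (\<Sum>t=1..Suc k. smult (diff_zero_power t (Suc k)) ([:0, 1:] ^ (t-1) * [:1, -1:] ^ (Suc k - t)))"
  have "poly (euler_frobenius k) x = poly P x" if x: "x \<noteq> 0" "x \<noteq> 1" for x
  proof -
    have "poly (euler_frobenius k) x = (\<Sum>t=1..Suc k. (1 - x)^(k+2) / x * (diff_zero_power t (Suc k) * x^t / (1 - x)^(t+1)))"
      unfolding poly_euler_frobenius[OF x] iterated_euler_operator[OF x(2)] sum_distrib_left ..
    also have "\<dots> = poly P x"
      unfolding P_def poly_sum
    proof (rule sum.cong[OF refl])
      fix t assume t: "t \<in> {1..Suc k}"
      then have "(1 - x)^(k+2) = (1 - x)^(Suc k - t) * (1 - x)^(t+1)" by (simp flip: power_add)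
      moreover have "x^t = x * x^(t-1)" using t by (cases t) auto
      ultimately show "(1 - x)^(k+2) / x * (diff_zero_power t (Suc k) * x^t / (1 - x)^(t+1))
        = poly (smult (diff_zero_power t (Suc k)) ([:0, 1:] ^ (t-1) * [:1, -1:] ^ (Suc k - t))) x"
        using x by (simp add: poly_power)
    qed
    finally show ?thesis .
  qed
  then have "- {0, 1} \<subseteq> {x. poly (euler_frobenius k - P) x = 0}" by auto
  moreover have "infinite (- {0, 1 :: real})"
    using infinite_UNIV_char_0 finite_compl[of "{0, 1 :: real}"] by auto
  ultimately have "\<not> finite {x. poly (euler_frobenius k - P) x = 0}" by (rule infinite_super)
  then have "euler_frobenius k = P" using poly_roots_finite[of "euler_frobenius k - P"] by auto
  moreover have "poly P 0 = (\<Sum>t=1..Suc k. if t = 1 then 1 else 0)"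
    unfolding P_def poly_sum by (intro sum.cong) (auto simp: poly_power diff_zero_power_1[simplified])
  ultimately show ?thesis by simp
qed

text \<open>Up to nonzero factors, the value of the Euler-Frobenius polynomial at q is the
  coefficient of order 2m-1 for 1/q; reciprocity then yields the one for q. These coefficients are
  the node values of the two null splines.\<close>

lemma frobenius_fps_nth_root:
  assumes "poly (euler_frobenius (2 * m - 2)) q = 0" "q \<noteq> 1" "m \<ge> 1"
  shows "fps_nth (frobenius_fps q) (2 * m - 1) = 0" "fps_nth (frobenius_fps (1/q)) (2 * m - 1) = 0"
proof -
  have q: "q \<noteq> 0" using assms(1) euler_frobenius_root_nonzero by metis
  have m: "Suc (2 * m - 2) = 2 * m - 1" using assms by simp
  have "0 = (1 - q)^(2*m-2+2) / q * (\<Sum>t=1..2*m-1. diff_zero_power t (2*m-1) * q^t / (1 - q)^(t+1))"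
    using poly_euler_frobenius[OF q assms(2), of "2*m-2"] iterated_euler_operator[OF assms(2), of "2*m-2"] assms(1)
    unfolding m by simp
  then have "(\<Sum>t=1..2*m-1. diff_zero_power t (2*m-1) * q^t / (1 - q)^(t+1)) = 0"
    using q assms(2) by simp
  then show r: "fps_nth (frobenius_fps (1/q)) (2 * m - 1) = 0"
    using sum_diff_zero_power_reciprocal[OF q assms(2), of "2*m-1"] assms(3) q by simp
  show "fps_nth (frobenius_fps q) (2 * m - 1) = 0"
    using frobenius_fps_reciprocal[OF q assms(2), of "2*m-1"] r assms(3) q by simp
qed

text \<open>In y = 1/(1 - p) the coefficient of order j is a polynomial of degree j+1 without
  constant term and with leading coefficient 1 or -1. So the n vanishing coefficients turn,
  triangularly, into n vanishing moments, and a Vandermonde argument applies to the distinct values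
  of y.\<close>

lemma frobenius_fps_linear_independent:
  fixes p e :: "'i \<Rightarrow> real"
  assumes I: "finite I" "card I \<le> n" and inj: "inj_on p I" and p1: "\<And>i. i \<in> I \<Longrightarrow> p i \<noteq> 1"
    and zero: "\<And>j. j < n \<Longrightarrow> (\<Sum>i\<in>I. e i * fps_nth (frobenius_fps (p i)) j) = 0"
    and i0: "i0 \<in> I"
  shows "e i0 = 0"
proof -
  define y where "y i = 1 / (1 - p i)" for i
  have y0: "y i \<noteq> 0" if "i \<in> I" for i using p1[OF that] by (simp add: y_def)
  have yinj: "y i \<noteq> y i'" if "i \<in> I" "i' \<in> I" "i \<noteq> i'" for i i'
    using inj that p1[OF that(1)] p1[OF that(2)] by (auto simp: y_def inj_on_def field_simps)
  have diag: "fps_nth ((fps_exp 1 - 1 :: real fps) ^ j) j = 1" for j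
  proof -
    have "fps_nth ((fps_exp 1 - 1 :: real fps) ^ j) j = (fps_nth (fps_exp 1 - 1 :: real fps) 1) ^ j"
      by (rule startsby_zero_power_nth_same) simp
    then show ?thesis by simp
  qed
  have moment: "(\<Sum>i\<in>I. e i * y i ^ (j+1)) = 0" if "j < n" for j
    using that
  proof (induction j rule: less_induct)
    case (less j)
    have "0 = (\<Sum>i\<in>I. e i * (\<Sum>t\<le>j. (-1)^t * y i^(t+1) * fps_nth ((fps_exp 1 - 1) ^ t) j))"
      using zero[OF less.prems] p1 by (simp add: frobenius_fps_nth y_def)
    also have "\<dots> = (\<Sum>t\<le>j. (-1)^t * fps_nth ((fps_exp 1 - 1) ^ t) j * (\<Sum>i\<in>I. e i * y i^(t+1)))"
      unfolding sum_distrib_left by (subst sum.swap) (simp add: mult_ac)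
    also have "\<dots> = (\<Sum>t\<in>{j}. (-1)^t * fps_nth ((fps_exp 1 - 1) ^ t) j * (\<Sum>i\<in>I. e i * y i^(t+1)))"
      using less by (intro sum.mono_neutral_right) auto
    finally show ?case by (simp add: diag)
  qed
  \<comment> \<open>The polynomial with zeros at all \<open>y i\<close> other than
    \<open>y i0\<close>; its degree is below \<open>n\<close>, so the moments suffice to evaluate
    it.\<close>
  define L where "L = (\<Prod>i\<in>I - {i0}. [:- y i, 1:])"
  have degL: "degree L < n"
  proof -
    have "degree L \<le> (\<Sum>i\<in>I - {i0}. degree [:- y i, 1:])"
      unfolding L_def using I degree_prod_sum_le[of "I - {i0}" "\<lambda>i. [:- y i, 1:]"] by (simp add: o_def)
    also have "\<dots> = card I - 1" using I i0 by (simp add: card_Diff_singleton)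
    also have "\<dots> < n" using I i0 card_gt_0_iff[of I] by fastforce
    finally show ?thesis .
  qed
  have "(\<Sum>i\<in>I. e i * y i * poly L (y i)) = (\<Sum>i\<in>I. \<Sum>j\<le>degree L. coeff L j * (e i * y i ^ (j+1)))"
    by (simp add: poly_altdef sum_distrib_left mult_ac)
  also have "\<dots> = (\<Sum>j\<le>degree L. coeff L j * (\<Sum>i\<in>I. e i * y i ^ (j+1)))"
    by (subst sum.swap) (simp only: sum_distrib_left)
  also have "\<dots> = 0" using degL moment by (intro sum.neutral) auto
  finally have "(\<Sum>i\<in>I. e i * y i * poly L (y i)) = 0" .
  moreover have "(\<Sum>i\<in>I. e i * y i * poly L (y i)) = (\<Sum>i\<in>{i0}. e i * y i * poly L (y i))"
  proof (rule sum.mono_neutral_right)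
    show "\<forall>i\<in>I - {i0}. e i * y i * poly L (y i) = 0"
    proof
      fix i assume i: "i \<in> I - {i0}"
      then have "poly L (y i) = 0" unfolding L_def poly_prod using I by (intro prod_zero) (auto intro!: bexI[of _ i])
      then show "e i * y i * poly L (y i) = 0" by simp
    qed
  qed (use I i0 in auto)
  moreover have "poly L (y i0) \<noteq> 0" unfolding L_def poly_prod using I yinj[OF i0] by auto
  ultimately show ?thesis using y0[OF i0] by simp
qed

section \<open>The optimal coefficients\<close>

lemma funpow_pderiv_eq_0_degree:
  fixes p :: "complex poly"
  shows "(pderiv ^^ m) p = 0 \<Longrightarrow> p = 0 \<or> degree p < m"
proof (induction m arbitrary: p)
  case (Suc m)
  then have "(pderiv ^^ m) (pderiv p) = 0" by (simp add: funpow_Suc_right del: funpow.simps)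
  from Suc.IH[OF this] show ?case
    by (auto simp: pderiv_eq_0_iff degree_pderiv)
qed simp

lemma poly_eq_0_if_derivs_vanish:
  fixes p :: "complex poly"
  shows "(pderiv ^^ m) p = 0 \<Longrightarrow> (\<And>j. j < m \<Longrightarrow> poly ((pderiv ^^ j) p) z = 0) \<Longrightarrow> p = 0"
proof (induction m arbitrary: p)
  case (Suc m)
  have "pderiv p = 0"
  proof (rule Suc.IH)
    show "(pderiv ^^ m) (pderiv p) = 0" using Suc.prems(1) by (simp add: funpow_Suc_right del: funpow.simps)
    show "poly ((pderiv ^^ j) (pderiv p)) z = 0" if "j < m" for j
      using Suc.prems(2)[of "Suc j"] that by (simp add: funpow_Suc_right del: funpow.simps)
  qed
  then obtain c where "p = [:c:]" using pderiv_eq_0_iff[of p] degree_eq_zeroE by metis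
  then show ?case using Suc.prems(2)[of 0] by simp
qed simp

context uniform_grid begin

text \<open>Pairing the spline with itself: with c = 0 and zero data, the integral of the squared
  modulus of the m-th derivative vanishes. So every piece has degree below m, smoothness makes all
  pieces equal, and the resulting polynomial has N + 1 >= m zeros.\<close>

lemma natural_spline_zero_unique:
  assumes p: "natural_spline m 0 p C" and m: "m \<ge> 1" "m \<le> N + 1"
    and zero: "\<And>\<beta>. \<beta> \<le> N \<Longrightarrow> spline p (node \<beta>) = 0"
    and real: "\<And>x. cnj (spline (pieces_deriv m p) x) = spline (pieces_deriv m p) x"
    and \<beta>: "\<beta> < N"
  shows "p \<beta> = 0"
proof -
  let ?M = "lebesgue_on {a..b}" and ?K = "spline (pieces_deriv m p)"
  have match: "\<And>j. j < 2 * m - 1 \<Longrightarrow> matching (pieces_deriv j p)"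
    using p by (auto simp: natural_spline_def smooth_pieces_def)
  have sp: "smooth_pieces m p" using match m by (auto simp: smooth_pieces_def)
  have "(LINT x|?M. (cmod (?K x))\<^sup>2) = 0"
  proof -
    have "(LINT x|?M. ?K x * deriv_within_Icc a b m (spline p) x) = 0"
      using natural_spline_pairing[OF p m(1) spline_in_sobolev_space[OF sp m(1)]] by (simp add: zero)
    also have "(LINT x|?M. ?K x * deriv_within_Icc a b m (spline p) x) = (LINT x|?M. complex_of_real ((cmod (?K x))\<^sup>2))"
    proof (rule integral_cong_AE)
      show "AE x in ?M. ?K x * deriv_within_Icc a b m (spline p) x = complex_of_real ((cmod (?K x))\<^sup>2)"
        using deriv_spline_AE[OF sp m(1)] by eventually_elim (simp only: complex_norm_square real)
      show "(\<lambda>x. ?K x * deriv_within_Icc a b m (spline p) x) \<in> borel_measurable ?M"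
        using deriv_spline_measurable[OF sp m(1)] by measurable
      show "(\<lambda>x. complex_of_real ((cmod (?K x))\<^sup>2)) \<in> borel_measurable ?M" by measurable
    qed
    finally show ?thesis by (simp only: integral_complex_of_real of_real_eq_0_iff)
  qed
  then have "AE x in ?M. (cmod (?K x))\<^sup>2 = 0"
    by (subst (asm) integral_nonneg_eq_0_iff_AE) (auto simp: integrable_norm_spline_power2)
  then have "AE x in lebesgue. x \<in> {a..b} \<longrightarrow> ?K x = 0"
    by (subst (asm) AE_restrict_space_iff) auto
  then obtain Z where Z: "negligible Z" "\<And>x. x \<in> {a..b} \<Longrightarrow> x \<notin> Z \<Longrightarrow> ?K x = 0"
    by (auto simp: eventually_ae_filter_negligible)
  \<comment> \<open>A nonzero polynomial has finitely many zeros, whereas an open cell is not a null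
    set.\<close>
  have D0: "(pderiv ^^ m) (p \<gamma>) = 0" if \<gamma>: "\<gamma> < N" for \<gamma>
  proof (rule ccontr)
    assume ne: "(pderiv ^^ m) (p \<gamma>) \<noteq> 0"
    let ?R = "{x :: real. poly ((pderiv ^^ m) (p \<gamma>)) (of_real x) = 0}"
    have "finite (complex_of_real -` {z. poly ((pderiv ^^ m) (p \<gamma>)) z = 0})"
      by (intro finite_vimageI poly_roots_finite ne) (simp add: inj_on_def)
    then have "negligible ?R" by (intro negligible_finite) (simp add: vimage_def)
    then have "negligible (Z \<union> ?R)" using Z by simp
    moreover have "{node \<gamma><..<node (Suc \<gamma>)} \<subseteq> Z \<union> ?R"
    proof
      fix x assume x: "x \<in> {node \<gamma><..<node (Suc \<gamma>)}"
      then have "x \<in> {a..b}" using node_in[of \<gamma>] node_in[of "Suc \<gamma>"] \<gamma> by auto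
      then show "x \<in> Z \<union> ?R" using Z(2)[of x] spline_on_open_cell[OF \<gamma> x] by auto
    qed
    ultimately have "negligible {node \<gamma><..<node (Suc \<gamma>)}" by (rule negligible_subset)
    then show False using open_not_negligible[of "{node \<gamma><..<node (Suc \<gamma>)}"] by simp
  qed
  \<comment> \<open>The difference of adjacent pieces has m-th derivative 0, and its derivatives of
    orders 0, ..., m-1 vanish at the common node.\<close>
  have step: "p (Suc \<gamma>) = p \<gamma>" if \<gamma>: "Suc \<gamma> < N" for \<gamma>
  proof -
    have "p (Suc \<gamma>) - p \<gamma> = 0"
    proof (rule poly_eq_0_if_derivs_vanish[where m = m and z = "of_real (node (Suc \<gamma>))"])
      show "(pderiv ^^ m) (p (Suc \<gamma>) - p \<gamma>) = 0" using D0[of \<gamma>] D0[of "Suc \<gamma>"] \<gamma> by (simp add: funpow_pderiv_diff)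
      show "poly ((pderiv ^^ j) (p (Suc \<gamma>) - p \<gamma>)) (of_real (node (Suc \<gamma>))) = 0" if "j < m" for j
        using match[of j] that m \<gamma> by (simp add: funpow_pderiv_diff matching_def)
    qed
    then show ?thesis by simp
  qed
  have all: "p \<gamma> = p 0" if "\<gamma> < N" for \<gamma>
    using that by (induction \<gamma>) (auto simp: step)
  have "p 0 = 0"
  proof (rule ccontr)
    assume ne: "p 0 \<noteq> 0"
    then have deg: "degree (p 0) < m" using funpow_pderiv_eq_0_degree[OF D0[of 0]] N by auto
    have "(\<lambda>\<gamma>. complex_of_real (node \<gamma>)) ` {..N} \<subseteq> {z. poly (p 0) z = 0}"
      using zero by (auto simp: spline_def all[OF cell_less])
    moreover have "card ((\<lambda>\<gamma>. complex_of_real (node \<gamma>)) ` {..N}) = N + 1"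
      by (subst card_image) (auto simp: inj_on_def)
    ultimately have "N + 1 \<le> card {z. poly (p 0) z = 0}"
      using card_mono[OF poly_roots_finite[OF ne]] by metis
    also have "\<dots> \<le> degree (p 0)" by (rule card_poly_roots_bound[OF ne])
    finally show False using deg m by simp
  qed
  with all[OF \<beta>] show ?thesis by simp
qed

text \<open>The Appell polynomial is placed on cell \<open>\<beta>\<close> in the local coordinate
  (x - node)/h. The factor h^n compensates the factors 1/h from differentiation, so the n-th
  derivative is independent of h. Subtracting \<open>c\<close> removes the common value at the
  nodes.\<close>

definition fps_pieces :: "nat \<Rightarrow> real \<Rightarrow> (nat \<Rightarrow> real fps) \<Rightarrow> nat \<Rightarrow> complex poly" where
  "fps_pieces n c G \<beta> = smult (of_real (h ^ n))
     (pcompose (appell (G \<beta>) n - [:of_real c:]) [:- of_real (node \<beta> / h), of_real (1 / h):])"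

lemma funpow_pderiv_fps_pieces:
  assumes "1 \<le> j" "j \<le> n"
  shows "(pderiv ^^ j) (fps_pieces n c G \<beta>) = smult (of_real (h ^ (n - j)))
     (pcompose (appell (G \<beta>) (n - j)) [:- of_real (node \<beta> / h), of_real (1 / h):])"
proof -
  have "(pderiv ^^ j) [:complex_of_real c:] = 0"
  proof -
    obtain i where "j = Suc i" using assms by (cases j) auto
    moreover have "(pderiv ^^ i) 0 = (0 :: complex poly)" by (induction i) auto
    ultimately show ?thesis by (simp add: funpow_Suc_right pderiv_pCons del: funpow.simps)
  qed
  moreover have "h ^ n * (1 / h) ^ j = h ^ (n - j)"
    using assms h_pos by (simp add: power_diff power_one_over field_simps)
  then have "complex_of_real (h ^ n) * of_real (1 / h) ^ j = of_real (h ^ (n - j))"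
    by (metis of_real_mult of_real_power)
  ultimately show ?thesis
    using assms by (simp only: fps_pieces_def funpow_pderiv_smult funpow_pderiv_pcompose_linear
       funpow_pderiv_diff funpow_pderiv_appell smult_smult diff_zero)
qed

lemma local_coordinate:
  "poly [:- complex_of_real (node \<beta> / h), of_real (1 / h):] (of_real x) = of_real ((x - node \<beta>) / h)"
  by (simp add: diff_divide_distrib)

lemma poly_funpow_pderiv_fps_pieces:
  assumes "1 \<le> j" "j \<le> n"
  shows "poly ((pderiv ^^ j) (fps_pieces n c G \<beta>)) (of_real (node \<beta>)) = of_real (h ^ (n - j) * fps_nth (G \<beta>) (n - j))"
    "poly ((pderiv ^^ j) (fps_pieces n c G \<beta>)) (of_real (node (Suc \<beta>)))
       = of_real (h ^ (n - j) * fps_nth (G \<beta> * fps_exp 1) (n - j))"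
proof -
  have 1: "(node (Suc \<beta>) - node \<beta>) / h = 1" using h_pos by (simp add: node_Suc)
  show "poly ((pderiv ^^ j) (fps_pieces n c G \<beta>)) (of_real (node \<beta>)) = of_real (h ^ (n - j) * fps_nth (G \<beta>) (n - j))"
    unfolding funpow_pderiv_fps_pieces[OF assms] poly_smult poly_pcompose local_coordinate
    by (simp add: poly_appell_0)
  show "poly ((pderiv ^^ j) (fps_pieces n c G \<beta>)) (of_real (node (Suc \<beta>)))
       = of_real (h ^ (n - j) * fps_nth (G \<beta> * fps_exp 1) (n - j))"
    unfolding funpow_pderiv_fps_pieces[OF assms] poly_smult poly_pcompose local_coordinate 1
    by (simp add: poly_appell_1)
qed

lemma poly_fps_pieces:
  "poly (fps_pieces n c G \<beta>) (of_real (node \<beta>)) = of_real (h ^ n * (fps_nth (G \<beta>) n - c))"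
  "poly (fps_pieces n c G \<beta>) (of_real (node (Suc \<beta>))) = of_real (h ^ n * (fps_nth (G \<beta> * fps_exp 1) n - c))"
proof -
  have 1: "(node (Suc \<beta>) - node \<beta>) / h = 1" using h_pos by (simp add: node_Suc)
  show "poly (fps_pieces n c G \<beta>) (of_real (node \<beta>)) = of_real (h ^ n * (fps_nth (G \<beta>) n - c))"
    unfolding fps_pieces_def poly_smult poly_pcompose local_coordinate by (simp add: poly_appell_0)
  show "poly (fps_pieces n c G \<beta>) (of_real (node (Suc \<beta>))) = of_real (h ^ n * (fps_nth (G \<beta> * fps_exp 1) n - c))"
    unfolding fps_pieces_def poly_smult poly_pcompose local_coordinate 1 by (simp add: poly_appell_1)
qed

lemma cnj_spline_fps_pieces:
  assumes "1 \<le> j" "j \<le> n"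
  shows "cnj (spline (pieces_deriv j (fps_pieces n c G)) x) = spline (pieces_deriv j (fps_pieces n c G)) x"
  unfolding spline_def funpow_pderiv_fps_pieces[OF assms] poly_smult poly_pcompose local_coordinate
  by (simp add: cnj_poly_appell del: of_real_diff of_real_divide)

text \<open>Dictionary between derivatives and coefficients: order j corresponds to i = 2m - j.
  Smoothness concerns i >= 2, the boundary conditions 2 <= i <= m, the jumps i = 1, and the 2m-th
  derivative i = 0. Order 0 is handled through \<open>zero\<close>, because the constant
  \<open>c0\<close> enters there.\<close>

lemma natural_spline_fps_pieces:
  assumes m: "m \<ge> 1"
    and match: "\<And>\<beta> i. Suc \<beta> < N \<Longrightarrow> 2 \<le> i \<Longrightarrow> i \<le> 2 * m \<Longrightarrow> fps_nth (G \<beta> * fps_exp 1) i = fps_nth (G (Suc \<beta>)) i"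
    and zero: "\<And>\<beta>. \<beta> < N \<Longrightarrow> fps_nth (G \<beta>) (2 * m) = c0" "\<And>\<beta>. \<beta> < N \<Longrightarrow> fps_nth (G \<beta> * fps_exp 1) (2 * m) = c0"
    and bnd: "\<And>i. 2 \<le> i \<Longrightarrow> i \<le> m \<Longrightarrow> fps_nth (G 0) i = 0" "\<And>i. 2 \<le> i \<Longrightarrow> i \<le> m \<Longrightarrow> fps_nth (G (N - 1) * fps_exp 1) i = 0"
    and top: "\<And>\<beta>. \<beta> < N \<Longrightarrow> fps_nth (G \<beta>) 0 = c"
    and C: "C 0 = of_real (- (h * fps_nth (G 0) 1))" "C N = of_real (h * fps_nth (G (N - 1) * fps_exp 1) 1)"
      "\<And>\<beta>. \<beta> \<in> {1..N-1} \<Longrightarrow> C \<beta> = of_real (h * (fps_nth (G (\<beta> - 1) * fps_exp 1) 1 - fps_nth (G \<beta>) 1))"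
  defines "p \<equiv> fps_pieces (2 * m) c0 G"
  shows "natural_spline m (of_real c) p C" "\<And>\<beta>. \<beta> \<le> N \<Longrightarrow> spline p (node \<beta>) = 0"
    "\<And>x. cnj (spline (pieces_deriv m p) x) = spline (pieces_deriv m p) x"
proof -
  note D = poly_funpow_pderiv_fps_pieces[of _ "2 * m" c0 G, folded p_def]
  note D0 = poly_fps_pieces[of "2 * m" c0 G, folded p_def]
  have sN: "Suc (N - 1) = N" using N by simp
  have "smooth_pieces (2 * m - 1) p"
    unfolding smooth_pieces_def matching_def
  proof (intro allI impI)
    fix j \<beta> assume j: "j < 2 * m - 1" and \<beta>: "Suc \<beta> < N"
    show "poly ((pderiv ^^ j) (p \<beta>)) (of_real (node (Suc \<beta>))) = poly ((pderiv ^^ j) (p (Suc \<beta>))) (of_real (node (Suc \<beta>)))"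
    proof (cases "j = 0")
      case True
      then show ?thesis using D0 \<beta> zero by simp
    next
      case False
      then show ?thesis using D(2)[of j \<beta>] D(1)[of j "Suc \<beta>"] j match[OF \<beta>, of "2 * m - j"] by simp
    qed
  qed
  moreover have "poly ((pderiv ^^ j) (p 0)) (of_real a) = 0 \<and> poly ((pderiv ^^ j) (p (N - 1))) (of_real b) = 0"
    if "j \<in> {m..<2 * m - 1}" for j
  proof -
    have "1 \<le> j" "j \<le> 2 * m" "2 \<le> 2 * m - j" "2 * m - j \<le> m" using that m by auto
    then show ?thesis using D(1)[of j 0] D(2)[of j "N - 1"] bnd[of "2 * m - j"] unfolding sN by simp
  qed
  moreover have "(pderiv ^^ (2 * m)) (p \<beta>) = [:of_real c:]" if "\<beta> < N" for \<beta>
  proof -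
    have "appell (G \<beta>) 0 = [:of_real c:]" using top[OF that] by (simp add: appell_def monom_0)
    then show ?thesis unfolding p_def using funpow_pderiv_fps_pieces[of "2*m" "2*m" c0 G \<beta>] m by simp
  qed
  moreover have "C 0 = - poly ((pderiv ^^ (2 * m - 1)) (p 0)) (of_real a)"
    using D(1)[of "2 * m - 1" 0] m C(1) by simp
  moreover have "C N = poly ((pderiv ^^ (2 * m - 1)) (p (N - 1))) (of_real b)"
    using D(2)[of "2 * m - 1" "N - 1"] m C(2) unfolding sN by simp
  moreover have "C \<beta> = poly ((pderiv ^^ (2 * m - 1)) (p (\<beta> - 1))) (of_real (node \<beta>))
                     - poly ((pderiv ^^ (2 * m - 1)) (p \<beta>)) (of_real (node \<beta>))" if "\<beta> \<in> {1..N - 1}" for \<beta>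
  proof -
    have "Suc (\<beta> - 1) = \<beta>" using that by simp
    then show ?thesis
      using D(2)[of "2 * m - 1" "\<beta> - 1"] D(1)[of "2 * m - 1" \<beta>] m C(3)[OF that] by (simp add: right_diff_distrib)
  qed
  ultimately show "natural_spline m (of_real c) p C" unfolding natural_spline_def by blast
  show "spline p (node \<beta>) = 0" if "\<beta> \<le> N" for \<beta>
  proof (cases "\<beta> = N")
    case True
    then show ?thesis using D0(2)[of "N-1"] zero(2)[of "N-1"] N unfolding sN by (simp add: spline_def cell_b)
  next
    case False
    then have "cell (node \<beta>) = \<beta>" using that by (intro cell_eq) auto
    then show ?thesis using D0(1)[of \<beta>] zero(1)[of \<beta>] False that by (simp add: spline_def)
  qed
  show "cnj (spline (pieces_deriv m p) x) = spline (pieces_deriv m p) x" for x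
    unfolding p_def using m by (intro cnj_spline_fps_pieces) auto
qed

end

section \<open>The Bernoulli part and the series of the optimal spline\<close>

definition bernoulli_fps :: "real fps" where
  "bernoulli_fps = Abs_fps (\<lambda>n. bernoulli_number n / fact n)"

lemma bernoulli_fps_mult: "bernoulli_fps * (fps_exp 1 - 1) = fps_X"
  unfolding bernoulli_fps_def by (rule bernoulli_number_generating_function)

text \<open>Across a cell only coefficient 1 changes: the periodic Bernoulli monospline jumps in its
  derivative of order 2m-1 alone.\<close>

lemma bernoulli_fps_exp: "bernoulli_fps * fps_exp 1 = bernoulli_fps + fps_X"
  using bernoulli_fps_mult by (simp add: algebra_simps)

lemma bernoulli_fps_0: "fps_nth bernoulli_fps 0 = 1"
  using arg_cong[OF bernoulli_fps_mult, of "\<lambda>F. fps_nth F 1"] by (simp add: fps_mult_nth)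

lemma bernoulli_fps_1: "fps_nth bernoulli_fps 1 = - 1 / 2"
  using arg_cong[OF bernoulli_fps_mult, of "\<lambda>F. fps_nth F 2"] bernoulli_fps_0
  by (simp add: fps_mult_nth numeral_2_eq_2)

text \<open>Replacing z by -z turns z/(e^z - 1) into z e^z/(e^z - 1), which is the series plus z. It
  is the reflection of a cell for the Bernoulli part.\<close>

lemma bernoulli_fps_reflect:
  "(-1)^i * fps_nth bernoulli_fps i = fps_nth bernoulli_fps i + (if i = 1 then 1 else 0)"
proof -
  let ?n = "fps_const (-1) * fps_X :: real fps"
  let ?B = "bernoulli_fps oo ?n"
  have "(bernoulli_fps * (fps_exp 1 - 1)) oo ?n = ?n" by (simp only: bernoulli_fps_mult) simp
  then have 1: "?B * (fps_exp (-1) - 1) = - fps_X"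
    by (simp add: fps_compose_mult_distrib fps_compose_sub_distrib fps_exp_compose_linear fps_compose_1)
  have inv: "fps_exp (-1) * fps_exp 1 = (1 :: real fps)" by (simp flip: fps_exp_add_mult)
  have "?B * (fps_exp 1 - 1) = - (?B * (fps_exp (-1) - 1) * fps_exp 1)"
    using inv by (simp add: algebra_simps)
  also have "\<dots> = bernoulli_fps * (fps_exp 1 - 1) * fps_exp 1" by (simp add: 1 bernoulli_fps_mult)
  also have "\<dots> = (bernoulli_fps + fps_X) * (fps_exp 1 - 1)"
    unfolding bernoulli_fps_exp[symmetric] by (simp only: mult_ac)
  finally have fin: "?B * (fps_exp 1 - 1) = (bernoulli_fps + fps_X) * (fps_exp 1 - 1)" .
  have "?B = bernoulli_fps + fps_X"
  proof -
    have "fps_exp 1 - 1 \<noteq> (0 :: real fps)" by (metis bernoulli_fps_mult fps_X_neq_zero mult_zero_right)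
    then show ?thesis using fin by simp
  qed
  then have "fps_nth ?B i = fps_nth (bernoulli_fps + fps_X) i" by simp
  then show ?thesis by (simp add: fps_compose_linear)
qed

text \<open>The term with 1/q is the null spline for q reflected at the midpoint of the interval.\<close>

definition sard_fps :: "nat \<Rightarrow> nat \<Rightarrow> (nat \<Rightarrow> real) \<Rightarrow> real \<Rightarrow> (nat \<Rightarrow> real) \<Rightarrow> nat \<Rightarrow> real fps" where
  "sard_fps n N q c d \<beta> = fps_const c * bernoulli_fps + fps_X * (\<Sum>k=1..n. fps_const (d k) *
     (fps_const (q k ^ (\<beta> + 1)) * frobenius_fps (q k) + fps_const (q k ^ (N - 1 - \<beta>)) * frobenius_fps (1 / q k)))"

lemma sard_fps_nth_0: "fps_nth (sard_fps n N q c d \<beta>) 0 = c"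
  by (simp add: sard_fps_def bernoulli_fps_0)

lemma sard_fps_nth_Suc:
  "fps_nth (sard_fps n N q c d \<beta>) (Suc j) = c * fps_nth bernoulli_fps (Suc j) + (\<Sum>k=1..n. d k *
     (q k ^ (\<beta> + 1) * fps_nth (frobenius_fps (q k)) j + q k ^ (N - 1 - \<beta>) * fps_nth (frobenius_fps (1 / q k)) j))"
  by (simp add: sard_fps_def fps_sum_nth del: power_Suc)

text \<open>The summand 1 in \<open>frobenius_fps_exp\<close> affects constant coefficients only;
  the factor \<open>fps_X\<close> moves it to coefficient 1, whence the case j = 0.\<close>

lemma sard_fps_exp_nth_Suc:
  assumes q: "\<And>k. k \<in> {1..n} \<Longrightarrow> q k \<noteq> 0 \<and> q k \<noteq> 1"
  shows "fps_nth (sard_fps n N q c d \<beta> * fps_exp 1) (Suc j) =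
     c * (fps_nth bernoulli_fps (Suc j) + (if j = 0 then 1 else 0)) + (\<Sum>k=1..n. d k *
     (q k ^ (\<beta> + 2) * fps_nth (frobenius_fps (q k)) j + q k ^ (N - 1 - \<beta>) / q k * fps_nth (frobenius_fps (1 / q k)) j
       + (if j = 0 then q k ^ (\<beta> + 1) + q k ^ (N - 1 - \<beta>) else 0)))"
proof -
  let ?F = frobenius_fps
  have "sard_fps n N q c d \<beta> * fps_exp 1 = fps_const c * (bernoulli_fps * fps_exp 1) + fps_X * (\<Sum>k=1..n. fps_const (d k) *
     (fps_const (q k ^ (\<beta> + 1)) * (?F (q k) * fps_exp 1) + fps_const (q k ^ (N - 1 - \<beta>)) * (?F (1 / q k) * fps_exp 1)))"
    unfolding sard_fps_def by (simp add: distrib_right sum_distrib_right mult.assoc del: power_Suc)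
  also have "(\<Sum>k=1..n. fps_const (d k) *
     (fps_const (q k ^ (\<beta> + 1)) * (?F (q k) * fps_exp 1) + fps_const (q k ^ (N - 1 - \<beta>)) * (?F (1 / q k) * fps_exp 1)))
    = (\<Sum>k=1..n. fps_const (d k) *
     (fps_const (q k ^ (\<beta> + 1)) * (fps_const (q k) * ?F (q k) + 1) + fps_const (q k ^ (N - 1 - \<beta>)) * (fps_const (1 / q k) * ?F (1 / q k) + 1)))"
  proof (rule sum.cong[OF refl])
    fix k assume "k \<in> {1..n}"
    then have q1: "q k \<noteq> 1" "1 / q k \<noteq> 1" using q by auto
    show "fps_const (d k) *
     (fps_const (q k ^ (\<beta> + 1)) * (?F (q k) * fps_exp 1) + fps_const (q k ^ (N - 1 - \<beta>)) * (?F (1 / q k) * fps_exp 1))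
     = fps_const (d k) *
     (fps_const (q k ^ (\<beta> + 1)) * (fps_const (q k) * ?F (q k) + 1) + fps_const (q k ^ (N - 1 - \<beta>)) * (fps_const (1 / q k) * ?F (1 / q k) + 1))"
      by (simp only: frobenius_fps_exp[OF q1(1)] frobenius_fps_exp[OF q1(2)])
  qed
  finally have eq: "sard_fps n N q c d \<beta> * fps_exp 1 = fps_const c * (bernoulli_fps + fps_X) + fps_X * (\<Sum>k=1..n. fps_const (d k) *
     (fps_const (q k ^ (\<beta> + 1)) * (fps_const (q k) * ?F (q k) + 1) + fps_const (q k ^ (N - 1 - \<beta>)) * (fps_const (1 / q k) * ?F (1 / q k) + 1)))"
    by (simp only: bernoulli_fps_exp)
  have "fps_nth (sard_fps n N q c d \<beta> * fps_exp 1) (Suc j) =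
     c * (fps_nth bernoulli_fps (Suc j) + (if j = 0 then 1 else 0)) + (\<Sum>k=1..n. d k *
     (q k ^ (\<beta> + 1) * (q k * fps_nth (?F (q k)) j + (if j = 0 then 1 else 0))
      + q k ^ (N - 1 - \<beta>) * (1 / q k * fps_nth (?F (1 / q k)) j + (if j = 0 then 1 else 0))))"
    unfolding eq by (simp add: fps_sum_nth del: power_Suc)
  also have "\<dots> = c * (fps_nth bernoulli_fps (Suc j) + (if j = 0 then 1 else 0)) + (\<Sum>k=1..n. d k *
     (q k ^ (\<beta> + 2) * fps_nth (frobenius_fps (q k)) j + q k ^ (N - 1 - \<beta>) / q k * fps_nth (frobenius_fps (1 / q k)) j
       + (if j = 0 then q k ^ (\<beta> + 1) + q k ^ (N - 1 - \<beta>) else 0)))"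
    by (intro arg_cong2[where f = "(+)"] sum.cong refl) (simp add: algebra_simps)
  finally show ?thesis .
qed

text \<open>The symmetry of the optimal spline about the midpoint: it transfers the boundary conditions
  from the left end to the right end.\<close>

lemma sard_fps_exp_reflect:
  assumes q: "\<And>k. k \<in> {1..n} \<Longrightarrow> q k \<noteq> 0 \<and> q k \<noteq> 1" and N: "N \<ge> 1"
  shows "fps_nth (sard_fps n N q c d (N - 1) * fps_exp 1) (Suc j) = (-1) ^ Suc j * fps_nth (sard_fps n N q c d 0) (Suc j)"
proof -
  let ?F = frobenius_fps
  let ?e = "if j = 0 then 1 else 0 :: real"
  have N': "N - 1 + 1 = N" "N - 1 + 2 = N + 1" "N - 1 - (N - 1) = 0" "N - 1 - 0 = N - 1" using N by auto
  \<comment> \<open>\<open>frobenius_fps_reciprocal\<close> is used for q and for 1/q. The two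
    summands change roles at the opposite end: q^(N-1) times q^2 gives the power q^(N+1)
    there.\<close>
  have S: "q k ^ (N + 1) * fps_nth (?F (q k)) j + q k ^ 0 / q k * fps_nth (?F (1 / q k)) j
       + (if j = 0 then q k ^ N + q k ^ 0 else 0)
     = (-1) ^ Suc j * (q k ^ (0 + 1) * fps_nth (?F (q k)) j + q k ^ (N - 1) * fps_nth (?F (1 / q k)) j)"
    if "k \<in> {1..n}" for k
  proof -
    have q0: "q k \<noteq> 0" "q k \<noteq> 1" "1 / q k \<noteq> 0" "1 / q k \<noteq> 1" using q[OF that] by auto
    have 1: "(-1)^j * fps_nth (?F (1 / q k)) j = - ((q k)\<^sup>2 * fps_nth (?F (q k)) j) - q k * ?e"
      using frobenius_fps_reciprocal[OF q0(1,2), of j] by simp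
    have 2: "(-1)^j * fps_nth (?F (q k)) j = - (1 / (q k)\<^sup>2 * fps_nth (?F (1 / q k)) j) - 1 / q k * ?e"
      using frobenius_fps_reciprocal[OF q0(3,4), of j] by (simp add: power_one_over)
    have "(-1) ^ Suc j * (q k ^ (0 + 1) * fps_nth (?F (q k)) j + q k ^ (N - 1) * fps_nth (?F (1 / q k)) j)
       = - (q k * ((-1)^j * fps_nth (?F (q k)) j)) - q k ^ (N - 1) * ((-1)^j * fps_nth (?F (1 / q k)) j)"
      by (simp add: algebra_simps)
    also have "\<dots> = (1 / q k * fps_nth (?F (1 / q k)) j + ?e) + (q k ^ (N - 1) * (q k)\<^sup>2 * fps_nth (?F (q k)) j + q k ^ (N - 1) * q k * ?e)"
      unfolding 1 2 using q0 by (simp add: power2_eq_square algebra_simps)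
    also have "q k ^ (N - 1) * (q k)\<^sup>2 = q k ^ (N + 1)"
      using N by (simp flip: power_add)
    also have "q k ^ (N - 1) * q k = q k ^ N"
      using N by (simp flip: power_Suc2)
    finally show ?thesis by (simp add: algebra_simps)
  qed
  have B: "fps_nth bernoulli_fps (Suc j) + ?e = (-1) ^ Suc j * fps_nth bernoulli_fps (Suc j)"
    using bernoulli_fps_reflect[of "Suc j"] by simp
  have "fps_nth (sard_fps n N q c d (N - 1) * fps_exp 1) (Suc j) =
     c * ((-1) ^ Suc j * fps_nth bernoulli_fps (Suc j)) + (\<Sum>k=1..n. d k *
     ((-1) ^ Suc j * (q k ^ (0 + 1) * fps_nth (?F (q k)) j + q k ^ (N - 1) * fps_nth (?F (1 / q k)) j)))"
  proof -
    have "fps_nth (sard_fps n N q c d (N - 1) * fps_exp 1) (Suc j) =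
       c * (fps_nth bernoulli_fps (Suc j) + ?e) + (\<Sum>k=1..n. d k *
       (q k ^ (N + 1) * fps_nth (?F (q k)) j + q k ^ 0 / q k * fps_nth (?F (1 / q k)) j
       + (if j = 0 then q k ^ N + q k ^ 0 else 0)))"
      using sard_fps_exp_nth_Suc[of n q N c d "N - 1" j] q unfolding N' by blast
    also have "\<dots> = c * ((-1) ^ Suc j * fps_nth bernoulli_fps (Suc j)) + (\<Sum>k=1..n. d k *
     ((-1) ^ Suc j * (q k ^ (0 + 1) * fps_nth (?F (q k)) j + q k ^ (N - 1) * fps_nth (?F (1 / q k)) j)))"
      unfolding B by (intro arg_cong2[where f = "(+)"] sum.cong refl arg_cong2[where f = "(*)"] S)
    finally show ?thesis .
  qed
  also have "\<dots> = (-1) ^ Suc j * fps_nth (sard_fps n N q c d 0) (Suc j)"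
    unfolding sard_fps_nth_Suc N' distrib_left sum_distrib_left
    by (intro arg_cong2[where f = "(+)"] sum.cong refl) (simp_all add: algebra_simps)
  finally show ?thesis .
qed


section \<open>The optimal coefficients as jumps, and the linear system\<close>

context uniform_grid begin

definition sard_coefficient :: "nat \<Rightarrow> (nat \<Rightarrow> real) \<Rightarrow> real \<Rightarrow> (nat \<Rightarrow> real) \<Rightarrow> nat \<Rightarrow> real" where
  "sard_coefficient n q c d \<beta> =
     (if \<beta> = 0 \<or> \<beta> = N then h * (c / 2 - (\<Sum>k=1..n. d k * ((q k - q k ^ N) / (1 - q k))))
      else h * (c + (\<Sum>k=1..n. d k * (q k ^ \<beta> + q k ^ (N - \<beta>)))))"

text \<open>The exponents in \<open>sard_fps\<close> are normalised so that the k-th term has, apart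
  from powers of h, the jump d_k (q_k^\<beta> + q_k^(N-\<beta>)) at an interior node. The hypothesis
  on the coefficients Suc j expresses the boundary conditions at the left end; those at the right
  end follow by reflection.\<close>

lemma natural_spline_sard_fps:
  assumes m: "m \<ge> 1" and q: "\<And>k. k \<in> {1..m - 1} \<Longrightarrow> q k \<noteq> 0 \<and> q k \<noteq> 1"
    and root: "\<And>k. k \<in> {1..m - 1} \<Longrightarrow> poly (euler_frobenius (2 * m - 2)) (q k) = 0"
    and sys: "\<And>j. j \<in> {1..m - 1} \<Longrightarrow> fps_nth (sard_fps (m - 1) N q c d 0) (Suc j) = 0"
  defines "p \<equiv> fps_pieces (2 * m) (c * fps_nth bernoulli_fps (2 * m)) (sard_fps (m - 1) N q c d)"
  shows "natural_spline m (of_real c) p (\<lambda>\<beta>. of_real (sard_coefficient (m - 1) q c d \<beta>))"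
    "\<And>\<beta>. \<beta> \<le> N \<Longrightarrow> spline p (node \<beta>) = 0"
    "\<And>x. cnj (spline (pieces_deriv m p) x) = spline (pieces_deriv m p) x"
proof -
  let ?G = "sard_fps (m - 1) N q c d" and ?F = frobenius_fps
  have E: "fps_nth (?G \<beta> * fps_exp 1) (Suc j) =
     c * (fps_nth bernoulli_fps (Suc j) + (if j = 0 then 1 else 0)) + (\<Sum>k=1..m-1. d k *
     (q k ^ (\<beta> + 2) * fps_nth (?F (q k)) j + q k ^ (N - 1 - \<beta>) / q k * fps_nth (?F (1 / q k)) j
       + (if j = 0 then q k ^ (\<beta> + 1) + q k ^ (N - 1 - \<beta>) else 0)))" for \<beta> j
    using sard_fps_exp_nth_Suc[of "m - 1" q N c d \<beta> j] q by blast
  have F0: "fps_nth (?F (q k)) (2 * m - 1) = 0" "fps_nth (?F (1 / q k)) (2 * m - 1) = 0"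
    if "k \<in> {1..m-1}" for k
    using frobenius_fps_nth_root[OF root[OF that]] q[OF that] m by auto
  have m2: "2 * m = Suc (2 * m - 1)" "2 * m - 1 \<noteq> 0" using m by auto
  have reflect: "fps_nth (?G (N - 1) * fps_exp 1) (Suc j) = (-1) ^ Suc j * fps_nth (?G 0) (Suc j)" for j
    using sard_fps_exp_reflect[of "m - 1" q N c d j] q N by blast
  \<comment> \<open>The term c/2 comes from B_1 = -1/2. The constant coefficients of the two series
    are 1/(1-q) and 1/(1 - 1/q) = -q/(1-q), and together they give (q - q^N)/(1-q).\<close>
  have G1: "- (h * fps_nth (?G 0) 1) = sard_coefficient (m - 1) q c d 0"
  proof -
    have "q k ^ (0 + 1) * fps_nth (?F (q k)) 0 + q k ^ (N - 1 - 0) * fps_nth (?F (1 / q k)) 0 = (q k - q k ^ N) / (1 - q k)"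
      if "k \<in> {1..m-1}" for k
    proof -
      have q0: "q k \<noteq> 0" "q k \<noteq> 1" "1 / q k \<noteq> 1" using q[OF that] by auto
      have "q k ^ (N - 1) * (1 / (1 - 1 / q k)) = - (q k ^ N / (1 - q k))"
      proof -
        have "1 / (1 - 1 / q k) = - (q k / (1 - q k))" using q0 by (simp add: field_simps)
        moreover have "q k ^ (N - 1) * q k = q k ^ N" using N by (simp flip: power_Suc2)
        ultimately show ?thesis by (simp flip: times_divide_eq_right) (simp add: mult.assoc[symmetric])
      qed
      then show ?thesis
        using q0 by (simp add: frobenius_fps_0 diff_divide_distrib)
    qed
    then have "(\<Sum>k=1..m-1. d k * (q k ^ (0 + 1) * fps_nth (?F (q k)) 0 + q k ^ (N - 1 - 0) * fps_nth (?F (1 / q k)) 0))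
      = (\<Sum>k=1..m-1. d k * ((q k - q k ^ N) / (1 - q k)))"
      by (intro sum.cong) auto
    then have eq: "fps_nth (?G 0) 1 = c * (- 1 / 2) + (\<Sum>k=1..m-1. d k * ((q k - q k ^ N) / (1 - q k)))"
      using sard_fps_nth_Suc[of "m-1" N q c d 0 0] bernoulli_fps_1 by simp
    have "- (h * (c * (- 1 / 2) + s)) = h * (c / 2 - s)" for s by (simp add: algebra_simps)
    then show ?thesis unfolding eq by (simp only: sard_coefficient_def simp_thms if_True)
  qed
  have "\<And>\<beta> i. Suc \<beta> < N \<Longrightarrow> 2 \<le> i \<Longrightarrow> i \<le> 2 * m \<Longrightarrow> fps_nth (?G \<beta> * fps_exp 1) i = fps_nth (?G (Suc \<beta>)) i"
  proof -
    fix \<beta> i assume \<beta>: "Suc \<beta> < N" and "2 \<le> i" "i \<le> 2 * m"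
    then obtain j where i: "i = Suc j" "j \<noteq> 0" by (cases i) auto
    have "q k ^ (N - 1 - \<beta>) / q k = q k ^ (N - 1 - Suc \<beta>)" if "k \<in> {1..m-1}" for k
    proof -
      have "N - 1 - \<beta> = Suc (N - 1 - Suc \<beta>)" using \<beta> by simp
      then show ?thesis using q[OF that] by simp
    qed
    then show "fps_nth (?G \<beta> * fps_exp 1) i = fps_nth (?G (Suc \<beta>)) i"
      unfolding i(1) E sard_fps_nth_Suc using i(2)
      by (intro arg_cong2[where f = "(+)"] sum.cong refl) simp_all
  qed
  moreover have "fps_nth (?G \<beta>) (2 * m) = c * fps_nth bernoulli_fps (2 * m)" for \<beta>
    using sard_fps_nth_Suc[of "m-1" N q c d \<beta> "2 * m - 1"] F0 unfolding m2(1)[symmetric] by simp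
  moreover have "fps_nth (?G \<beta> * fps_exp 1) (2 * m) = c * fps_nth bernoulli_fps (2 * m)" for \<beta>
    using E[of \<beta> "2 * m - 1"] F0 m2(2) unfolding m2(1)[symmetric] by simp
  moreover have bnd: "\<And>i. 2 \<le> i \<Longrightarrow> i \<le> m \<Longrightarrow> fps_nth (?G 0) i = 0"
  proof -
    fix i assume "2 \<le> i" "i \<le> m"
    then have "i = Suc (i - 1)" "i - 1 \<in> {1..m-1}" by auto
    then show "fps_nth (?G 0) i = 0" using sys by metis
  qed
  moreover have "\<And>i. 2 \<le> i \<Longrightarrow> i \<le> m \<Longrightarrow> fps_nth (?G (N - 1) * fps_exp 1) i = 0"
  proof -
    fix i assume "2 \<le> i" "i \<le> m"
    then show "fps_nth (?G (N - 1) * fps_exp 1) i = 0"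
      using reflect[of "i - 1"] bnd[of i] by simp
  qed
  moreover have "\<And>\<beta>. fps_nth (?G \<beta>) 0 = c" by (rule sard_fps_nth_0)
  moreover have "complex_of_real (sard_coefficient (m - 1) q c d 0) = of_real (- (h * fps_nth (?G 0) 1))"
    unfolding G1 ..
  moreover have "complex_of_real (sard_coefficient (m - 1) q c d N) = of_real (h * fps_nth (?G (N - 1) * fps_exp 1) 1)"
    using reflect[of 0] G1 by (simp add: sard_coefficient_def)
  moreover have "complex_of_real (sard_coefficient (m - 1) q c d \<beta>)
      = of_real (h * (fps_nth (?G (\<beta> - 1) * fps_exp 1) 1 - fps_nth (?G \<beta>) 1))" if \<beta>: "\<beta> \<in> {1..N-1}" for \<beta>
  proof -
    \<comment> \<open>The values of the null splines from both sides of the node cancel; what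
      remains of the jump is the contribution of the summand 1 in
      \<open>frobenius_fps_exp\<close>.\<close>
    have "d k * (q k ^ (\<beta> - 1 + 2) * fps_nth (?F (q k)) 0 + q k ^ (N - 1 - (\<beta> - 1)) / q k * fps_nth (?F (1 / q k)) 0
         + (q k ^ (\<beta> - 1 + 1) + q k ^ (N - 1 - (\<beta> - 1))))
       - d k * (q k ^ (\<beta> + 1) * fps_nth (?F (q k)) 0 + q k ^ (N - 1 - \<beta>) * fps_nth (?F (1 / q k)) 0)
       = d k * (q k ^ \<beta> + q k ^ (N - \<beta>))" if "k \<in> {1..m-1}" for k
    proof -
      have "\<beta> - 1 + 2 = \<beta> + 1" "\<beta> - 1 + 1 = \<beta>" "N - 1 - (\<beta> - 1) = N - \<beta>" "N - \<beta> = Suc (N - 1 - \<beta>)" using \<beta> by auto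
      moreover from this have "q k ^ (N - 1 - (\<beta> - 1)) / q k = q k ^ (N - 1 - \<beta>)" using q[OF that] by simp
      ultimately show ?thesis by (simp only:) (simp add: algebra_simps)
    qed
    then have "(\<Sum>k=1..m-1. d k * (q k ^ (\<beta> - 1 + 2) * fps_nth (?F (q k)) 0 + q k ^ (N - 1 - (\<beta> - 1)) / q k * fps_nth (?F (1 / q k)) 0
         + (q k ^ (\<beta> - 1 + 1) + q k ^ (N - 1 - (\<beta> - 1)))))
       - (\<Sum>k=1..m-1. d k * (q k ^ (\<beta> + 1) * fps_nth (?F (q k)) 0 + q k ^ (N - 1 - \<beta>) * fps_nth (?F (1 / q k)) 0))
       = (\<Sum>k=1..m-1. d k * (q k ^ \<beta> + q k ^ (N - \<beta>)))"
      unfolding sum_subtractf[symmetric] by (intro sum.cong refl)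
    then have "fps_nth (?G (\<beta> - 1) * fps_exp 1) (Suc 0) - fps_nth (?G \<beta>) (Suc 0) = c + (\<Sum>k=1..m-1. d k * (q k ^ \<beta> + q k ^ (N - \<beta>)))"
      unfolding E sard_fps_nth_Suc by (simp add: algebra_simps del: power_Suc)
    moreover have "\<beta> \<noteq> 0" "\<beta> \<noteq> N" using \<beta> N by auto
    ultimately show ?thesis by (simp add: sard_coefficient_def)
  qed
  ultimately show "natural_spline m (of_real c) p (\<lambda>\<beta>. of_real (sard_coefficient (m - 1) q c d \<beta>))"
    "\<And>\<beta>. \<beta> \<le> N \<Longrightarrow> spline p (node \<beta>) = 0"
    "\<And>x. cnj (spline (pieces_deriv m p) x) = spline (pieces_deriv m p) x"
    unfolding p_def by (rule natural_spline_fps_pieces[OF m]; blast)+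
qed

end


text \<open>Row j is the left boundary condition for the coefficient of z^(j+1), scaled by j!,
  because B_(j+1)/(j+1) is j! times that coefficient of z/(e^z - 1).\<close>

lemma coefficient_system_iff_sard_fps:
  assumes q: "\<And>k. k \<in> {1..m - 1} \<Longrightarrow> q k \<noteq> 0 \<and> q k \<noteq> 1" and "N \<ge> 1"
  shows "coefficient_system m N q d \<longleftrightarrow> (\<forall>j\<in>{1..m - 1}. fps_nth (sard_fps (m - 1) N q 1 d 0) (Suc j) = 0)"
  unfolding coefficient_system_def
proof (intro ball_cong refl)
  fix j assume j: "j \<in> {1..m - 1}"
  let ?S = "\<Sum>k=1..m-1. d k * (q k ^ (0 + 1) * fps_nth (frobenius_fps (q k)) j + q k ^ (N - 1 - 0) * fps_nth (frobenius_fps (1 / q k)) j)"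
  have "(\<Sum>k=1..m - 1. d k *
           (\<Sum>t=1..j. (q k + (-1) ^ (t + 1) * q k ^ (N + t)) / (q k - 1) ^ (t + 1) * diff_zero_power t j)) = - fact j * ?S"
  proof -
    have "(\<Sum>k=1..m - 1. d k *
           (\<Sum>t=1..j. (q k + (-1) ^ (t + 1) * q k ^ (N + t)) / (q k - 1) ^ (t + 1) * diff_zero_power t j))
      = (\<Sum>k=1..m - 1. d k * (- fact j * (q k * fps_nth (frobenius_fps (q k)) j + q k ^ (N - 1) * fps_nth (frobenius_fps (1 / q k)) j)))"
      using j q \<open>N \<ge> 1\<close> by (intro sum.cong arg_cong2[where f = "(*)"] refl coefficient_system_entry) auto
    also have "\<dots> = - fact j * ?S" unfolding sum_distrib_left by (intro sum.cong) auto
    finally show ?thesis .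
  qed
  moreover have "bernoulli_number (j + 1) / real (j + 1) = fact j * fps_nth bernoulli_fps (Suc j)"
    by (simp add: bernoulli_fps_def fact_Suc del: of_nat_Suc)
  moreover have "- f * s = f * e \<longleftrightarrow> e + s = 0" if "f \<noteq> 0" for f s e :: real
  proof -
    have "- f * s = f * e \<longleftrightarrow> f * (e + s) = 0" by (auto simp: algebra_simps)
    then show ?thesis using that by simp
  qed
  ultimately show "(\<Sum>k=1..m - 1. d k *
           (\<Sum>t=1..j. (q k + (-1) ^ (t + 1) * q k ^ (N + t)) / (q k - 1) ^ (t + 1) * diff_zero_power t j))
        = bernoulli_number (j + 1) / real (j + 1) \<longleftrightarrow> fps_nth (sard_fps (m - 1) N q 1 d 0) (Suc j) = 0"
    unfolding sard_fps_nth_Suc by simp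
qed

text \<open>A homogeneous solution yields a natural spline with c = 0 that vanishes at the nodes, so
  its first piece is 0. That gives 2m-1 relations between the 2m-2 series belonging to q_k and
  1/q_k, which are linearly independent.\<close>

lemma (in uniform_grid) homogeneous_system_trivial:
  assumes m: "m \<ge> 1" "m \<le> N + 1" and q: "\<And>k. k \<in> {1..m - 1} \<Longrightarrow> q k \<noteq> 0 \<and> \<bar>q k\<bar> < 1"
    and inj: "inj_on q {1..m - 1}"
    and root: "\<And>k. k \<in> {1..m - 1} \<Longrightarrow> poly (euler_frobenius (2 * m - 2)) (q k) = 0"
    and sys: "\<And>j. j \<in> {1..m - 1} \<Longrightarrow> fps_nth (sard_fps (m - 1) N q 0 d 0) (Suc j) = 0"
    and k: "k \<in> {1..m - 1}"
  shows "d k = 0"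
proof -
  have q1: "q k \<noteq> 0 \<and> q k \<noteq> 1" if "k \<in> {1..m-1}" for k using q[OF that] by auto
  let ?G = "sard_fps (m - 1) N q 0 d"
  let ?p = "fps_pieces (2 * m) (0 * fps_nth bernoulli_fps (2 * m)) ?G"
  note nat = natural_spline_sard_fps[OF m(1) q1 root sys]
  have "?p 0 = 0"
    by (rule natural_spline_zero_unique[OF nat(1)[simplified of_real_0] m nat(2,3)]) (use N in auto)
  \<comment> \<open>Coefficient i is read off from the derivative of order 2m - i at the left end;
    this order is at least 1, so the subtracted constant does not interfere.\<close>
  have G0: "fps_nth (?G 0) i = 0" if i: "i < 2 * m" for i
  proof -
    have "poly ((pderiv ^^ (2 * m - i)) (?p 0)) (of_real (node 0)) = of_real (h ^ (2 * m - (2 * m - i)) * fps_nth (?G 0) (2 * m - (2 * m - i)))"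
      using i by (intro poly_funpow_pderiv_fps_pieces) auto
    moreover have "(pderiv ^^ j) 0 = (0 :: complex poly)" for j by (induction j) auto
    ultimately have "complex_of_real (h ^ i * fps_nth (?G 0) i) = 0"
      unfolding \<open>?p 0 = 0\<close> using i by simp
    then show ?thesis using h_pos by simp
  qed
  \<comment> \<open>The Boolean selects q_k or 1/q_k. These numbers are pairwise distinct because q
    is injective and |q_k| < 1 < |1/q_k|.\<close>
  define I where "I = {1..m-1} \<times> (UNIV :: bool set)"
  define r where "r = (\<lambda>(k, s). if s then q k else 1 / q k)"
  define e where "e = (\<lambda>(k, s). d k * (if s then q k else q k ^ (N - 1)))"
  have "e (k, True) = 0"
  proof (rule frobenius_fps_linear_independent[where I = I and p = r and n = "2 * m - 1"])
    show "card I \<le> 2 * m - 1" using m by (simp add: I_def card_cartesian_product card_UNIV_bool)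
    show "r i \<noteq> 1" if "i \<in> I" for i using that q1[of "fst i"] by (auto simp: I_def r_def split: if_splits)
    show "inj_on r I"
    proof (rule inj_onI)
      fix x y assume xy: "x \<in> I" "y \<in> I" "r x = r y"
      obtain i s j t where ij: "x = (i, s)" "y = (j, t)" by fastforce
      have ij': "i \<in> {1..m-1}" "j \<in> {1..m-1}" using xy ij by (auto simp: I_def)
      have big: "\<bar>1 / q k\<bar> > 1" if "k \<in> {1..m-1}" for k using q[OF that] by (simp add: abs_divide)
      have "s = t"
        using xy(3) big[OF ij'(1)] big[OF ij'(2)] q[OF ij'(1)] q[OF ij'(2)]
        unfolding ij r_def by (cases s; cases t) auto
      moreover have "q i = q j" using xy(3) \<open>s = t\<close> q[OF ij'(1)] q[OF ij'(2)] unfolding ij r_def by (cases s) auto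
      then have "i = j" using inj ij' by (auto dest: inj_onD)
      ultimately show "x = y" using ij by simp
    qed
    show "(\<Sum>i\<in>I. e i * fps_nth (frobenius_fps (r i)) j) = 0" if j: "j < 2 * m - 1" for j
    proof -
      have "(\<Sum>i\<in>I. e i * fps_nth (frobenius_fps (r i)) j) = (\<Sum>k=1..m-1. \<Sum>s\<in>UNIV. e (k, s) * fps_nth (frobenius_fps (r (k, s))) j)"
        unfolding I_def by (subst sum.cartesian_product) (simp add: case_prod_unfold)
      also have "\<dots> = (\<Sum>k=1..m-1. d k * (q k ^ (0 + 1) * fps_nth (frobenius_fps (q k)) j + q k ^ (N - 1 - 0) * fps_nth (frobenius_fps (1 / q k)) j))"
        by (intro sum.cong refl) (simp add: UNIV_bool e_def r_def algebra_simps)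
      also have "\<dots> = 0" using G0[of "Suc j"] j unfolding sard_fps_nth_Suc by simp
      finally show ?thesis .
    qed
  qed (use k in \<open>auto simp: I_def\<close>)
  then show "d k = 0" using q[OF k] by (simp add: e_def)
qed

text \<open>Solvability of the system keeps the second conjunct from being vacuous. The equivalence
  there contains both the optimality of the coefficients and their uniqueness.\<close>

theorem theorem8:
  fixes m N :: nat and a b h :: real and q :: "nat \<Rightarrow> real"
  assumes "m \<ge> 1" and "N \<ge> 1" and "N + 1 \<ge> m" and "a < b" and "h = (b - a) / real N"
    and "bij_betw q {1..m - 1} {x. poly (euler_frobenius (2 * m - 2)) x = 0 \<and> \<bar>x\<bar> < 1}"
  shows "(\<exists>d. coefficient_system m N q d) \<and>
    (\<forall>d. coefficient_system m N q d \<longrightarrow>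
      (\<forall>C. sard_optimal m N a b C \<longleftrightarrow>
         C 0 = complex_of_real (h * (1 / 2 - (\<Sum>k=1..m - 1. d k * ((q k - q k ^ N) / (1 - q k))))) \<and>
         (\<forall>\<beta>\<in>{1..N - 1}. C \<beta> = complex_of_real
            (h * (1 + (\<Sum>k=1..m - 1. d k * (q k ^ \<beta> + q k ^ (N - \<beta>)))))) \<and>
         C N = complex_of_real (h * (1 / 2 - (\<Sum>k=1..m - 1. d k * ((q k - q k ^ N) / (1 - q k)))))))"
proof -
  interpret grid: uniform_grid a b N using assms by unfold_locales
  have h: "grid.h = h" using assms by (simp add: grid.h_def)
  have root: "poly (euler_frobenius (2 * m - 2)) (q k) = 0" and small: "\<bar>q k\<bar> < 1" if "k \<in> {1..m - 1}" for k
    using assms(6) that by (auto simp: bij_betw_def)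
  have q: "q k \<noteq> 0 \<and> \<bar>q k\<bar> < 1" if "k \<in> {1..m - 1}" for k
    using root[OF that] small[OF that] euler_frobenius_root_nonzero[of "2 * m - 2"] by auto
  have q1: "q k \<noteq> 0 \<and> q k \<noteq> 1" if "k \<in> {1..m - 1}" for k using q[OF that] by auto
  have inj: "inj_on q {1..m - 1}" using assms(6) by (simp add: bij_betw_def)
  have system: "coefficient_system m N q d \<longleftrightarrow> (\<forall>j\<in>{1..m - 1}. fps_nth (sard_fps (m - 1) N q 1 d 0) (Suc j) = 0)" for d
    by (rule coefficient_system_iff_sard_fps) (use q1 assms(2) in auto)
  define A where "A j k = q k ^ (0 + 1) * fps_nth (frobenius_fps (q k)) j + q k ^ (N - 1 - 0) * fps_nth (frobenius_fps (1 / q k)) j" for j k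
  have nth: "fps_nth (sard_fps (m - 1) N q c d 0) (Suc j) = c * fps_nth bernoulli_fps (Suc j) + (\<Sum>k=1..m - 1. d k * A j k)" for c d j
    unfolding A_def by (rule sard_fps_nth_Suc)
  \<comment> \<open>There are m-1 equations for m-1 unknowns, so existence reduces to the
    homogeneous system, that is, to \<open>sard_fps\<close> with c = 0.\<close>
  have "\<exists>d. \<forall>j\<in>{1..m - 1}. (\<Sum>k\<in>{1..m - 1}. d k * A j k) = - fps_nth bernoulli_fps (Suc j)"
  proof (rule square_linear_system_solvable)
    fix d k assume "\<And>j. j \<in> {1..m - 1} \<Longrightarrow> (\<Sum>k\<in>{1..m - 1}. d k * A j k) = 0" and "k \<in> {1..m - 1}"
    then show "d k = 0"
      using grid.homogeneous_system_trivial[OF assms(1,3) q inj root, of d] nth[of 0 d] by simp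
  qed auto
  then obtain d where "\<forall>j\<in>{1..m - 1}. (\<Sum>k\<in>{1..m - 1}. d k * A j k) = - fps_nth bernoulli_fps (Suc j)" ..
  then have "coefficient_system m N q d" unfolding system nth by simp
  then have "\<exists>d. coefficient_system m N q d" by (rule exI[of _ d])
  moreover have "sard_optimal m N a b C \<longleftrightarrow>
         C 0 = complex_of_real (h * (1 / 2 - (\<Sum>k=1..m - 1. d k * ((q k - q k ^ N) / (1 - q k))))) \<and>
         (\<forall>\<beta>\<in>{1..N - 1}. C \<beta> = complex_of_real
            (h * (1 + (\<Sum>k=1..m - 1. d k * (q k ^ \<beta> + q k ^ (N - \<beta>)))))) \<and>
         C N = complex_of_real (h * (1 / 2 - (\<Sum>k=1..m - 1. d k * ((q k - q k ^ N) / (1 - q k)))))"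
    if d: "coefficient_system m N q d" for d C
  proof -
    have sys: "\<And>j. j \<in> {1..m - 1} \<Longrightarrow> fps_nth (sard_fps (m - 1) N q 1 d 0) (Suc j) = 0"
      using d unfolding system by blast
    note nat = grid.natural_spline_sard_fps[OF assms(1) q1 root sys]
    have "sard_optimal m N a b C \<longleftrightarrow> (\<forall>\<beta>\<le>N. C \<beta> = of_real (grid.sard_coefficient (m - 1) q 1 d \<beta>))"
      by (rule grid.sard_optimal_natural_spline[OF nat(1)[unfolded of_real_1] assms(1) nat(2,3)])
    also have "(\<forall>\<beta>\<le>N. P \<beta>) \<longleftrightarrow> P 0 \<and> (\<forall>\<beta>\<in>{1..N - 1}. P \<beta>) \<and> P N" for P
    proof
      assume R: "P 0 \<and> (\<forall>\<beta>\<in>{1..N - 1}. P \<beta>) \<and> P N"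
      have "P \<beta>" if "\<beta> \<le> N" for \<beta>
      proof -
        have "\<beta> = 0 \<or> \<beta> = N \<or> \<beta> \<in> {1..N - 1}" using that by auto
        then show ?thesis using R by blast
      qed
      then show "\<forall>\<beta>\<le>N. P \<beta>" by blast
    qed auto
    finally have opt: "sard_optimal m N a b C \<longleftrightarrow> C 0 = of_real (grid.sard_coefficient (m - 1) q 1 d 0) \<and>
        (\<forall>\<beta>\<in>{1..N - 1}. C \<beta> = of_real (grid.sard_coefficient (m - 1) q 1 d \<beta>)) \<and>
        C N = of_real (grid.sard_coefficient (m - 1) q 1 d N)" .
    have ends: "grid.sard_coefficient (m - 1) q 1 d 0 = h * (1 / 2 - (\<Sum>k=1..m - 1. d k * ((q k - q k ^ N) / (1 - q k))))"
      "grid.sard_coefficient (m - 1) q 1 d N = h * (1 / 2 - (\<Sum>k=1..m - 1. d k * ((q k - q k ^ N) / (1 - q k))))"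
      by (simp_all only: grid.sard_coefficient_def h simp_thms if_True)
    have interior: "grid.sard_coefficient (m - 1) q 1 d \<beta> = h * (1 + (\<Sum>k=1..m - 1. d k * (q k ^ \<beta> + q k ^ (N - \<beta>))))"
      if "\<beta> \<in> {1..N - 1}" for \<beta>
    proof -
      have "\<not> (\<beta> = 0 \<or> \<beta> = N)" using that by auto
      then show ?thesis by (simp only: grid.sard_coefficient_def h if_False)
    qed
    show ?thesis unfolding opt ends by (intro conj_cong ball_cong refl) (simp only: interior)
  qed
  ultimately show ?thesis by blast
qed

end
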